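(* Let $R$ be the subring of the Green ring $r(D_4)$ generated by $g=[V(1)]$, $x=[V(2,0)]$, $y=[\Omega V(0)]$ and $z=[\Omega^{-1}V(0)]$. Let $\mathbb{Z}[g_1,x_1,y_1,z_1]$ be the polynomial algebra over $\mathbb{Z}$ in four variables and let $I$ be its ideal generated by $$g_1^2-1,\quad x_1^3-2x_1(1+g_1),\quad x_1(y_1-1-2g_1),\quad x_1(y_1-z_1),\quad y_1z_1-1-2x_1^2.$$ Then $R$ is isomorphic, as a ring, to the quotient ring $\mathbb{Z}[g_1,x_1,y_1,z_1]/I$.
   Context: Let $k$ be an algebraically closed field with $\mathrm{char}(k)\neq 2$. All modules are finite-dimensional left modules; $\otimes=\otimes_k$; $\mathbb{Z}_2=\mathbb{Z}/2\mathbb{Z}$. $D_4$ is the $k$-algebra generated by $a,b,c,d$ subject to $ba=-ab$, $db=-bd$, $ca=-ac$, $dc=-cd$, $bc=cb$, $a^2=0$, $b^2=1$, $c^2=1$, $d^2=0$, $da+ad=1-bc$. It is a $16$-dimensional Hopf algebra (isomorphic to the Drinfeld double of Sweedler's 4-dimensional Hopf algebra) with comultiplication $\Delta(a)=a\otimes b+1\otimes a$, $\Delta(b)=b\otimes b$, $\Delta(c)=c\otimes c$, $\Delta(d)=d\otimes c+1\otimes d$, counit $\varepsilon(a)=\varepsilon(d)=0$, $\varepsilon(b)=\varepsilon(c)=1$, antipode $S(a)=-ab$, $S(b)=b$, $S(c)=c$, $S(d)=-dc$. Tensor products of $D_4$-modules are $D_4$-modules via $\Delta$. For $r\in\mathbb{Z}_2$: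 $V(r)$ is the one-dimensional simple module on which $a,d$ act as $0$ and $b,c$ act as $(-1)^r$. $V(2,r)$ is the simple module with basis $v_1,v_2$ and action $av_1=v_2$, $dv_1=0$, $bv_1=(-1)^rv_1$, $cv_1=(-1)^{r+1}v_1$, $av_2=0$, $dv_2=2v_1$, $bv_2=(-1)^{r+1}v_2$, $cv_2=(-1)^rv_2$. For a module $M$, $\Omega M$ is the kernel of a projective cover $P(M)\to M$ and $\Omega^{-1}M$ is the cokernel of an injective envelope $M\to I(M)$. The Green ring $r(D_4)$ is the abelian group generated by isomorphism classes $[M]$ of finite-dimensional $D_4$-modules modulo the relations $[M\oplus N]=[M]+[N]$, with multiplication $[M][N]=[M\otimes N]$ and identity $[V(0)]$. It is commutative since $D_4$ is quasitriangular. *)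

theory Defs
  imports
    "HOL-Algebra.Algebraic_Closure_Type"
    "HOL-Algebra.Free_Abelian_Groups"
    "HOL-Algebra.Generated_Rings"
    "Jordan_Normal_Form.Matrix_Kernel"
begin

section \<open>Finite-dimensional modules over the algebra \<open>D\<^sub>4\<close>\<close>

text \<open>
  A module structure on \<open>k\<^sup>n\<close> over the algebra presented by the generators \<open>a, b, c, d\<close> and the
  relations below is a choice of four \<open>n \<times> n\<close> matrices, acting on column vectors, that satisfy
  these relations.  Up to isomorphism these are all the finite-dimensional left modules.
\<close>

datatype D4_gen = Gen_a | Gen_b | Gen_c | Gen_d

datatype 'k rep = Rep (rdim: nat) (act: "D4_gen \<Rightarrow> 'k mat")

definition D4_module :: "'k :: field rep \<Rightarrow> bool" where
  "D4_module M \<longleftrightarrow>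
     (let n = rdim M; a = act M Gen_a; b = act M Gen_b; c = act M Gen_c; d = act M Gen_d in
      a \<in> carrier_mat n n \<and> b \<in> carrier_mat n n \<and> c \<in> carrier_mat n n \<and> d \<in> carrier_mat n n \<and>
      b * a = - (a * b) \<and> d * b = - (b * d) \<and> c * a = - (a * c) \<and> d * c = - (c * d) \<and>
      b * c = c * b \<and>
      a * a = 0\<^sub>m n n \<and> b * b = 1\<^sub>m n \<and> c * c = 1\<^sub>m n \<and> d * d = 0\<^sub>m n n \<and>
      d * a + a * d = 1\<^sub>m n - b * c)"

definition D4_hom :: "'k :: field rep \<Rightarrow> 'k rep \<Rightarrow> 'k mat set" where
  "D4_hom M N =
     {f \<in> carrier_mat (rdim N) (rdim M). \<forall>s. f * act M s = act N s * f}"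

definition mat_image :: "'k :: field mat \<Rightarrow> 'k vec set" where
  "mat_image f = (\<lambda>v. f *\<^sub>v v) ` carrier_vec (dim_col f)"

definition mat_inj :: "'k :: field mat \<Rightarrow> bool" where
  "mat_inj f \<longleftrightarrow> inj_on (\<lambda>v. f *\<^sub>v v) (carrier_vec (dim_col f))"

definition mat_surj :: "'k :: field mat \<Rightarrow> bool" where
  "mat_surj f \<longleftrightarrow> mat_image f = carrier_vec (dim_row f)"

definition D4_iso :: "'k :: field rep \<Rightarrow> 'k rep \<Rightarrow> bool" where
  "D4_iso M N \<longleftrightarrow> (\<exists>f \<in> D4_hom M N. mat_inj f \<and> mat_surj f)"


subsection \<open>Direct sums and tensor products\<close>

definition direct_sum_rep :: "'k :: field rep \<Rightarrow> 'k rep \<Rightarrow> 'k rep" where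
  "direct_sum_rep M N =
     Rep (rdim M + rdim N)
       (\<lambda>s. four_block_mat (act M s) (0\<^sub>m (rdim M) (rdim N)) (0\<^sub>m (rdim N) (rdim M)) (act N s))"

text \<open>
  The matrix of \<open>f \<otimes> g\<close>; the basis vector \<open>v\<^sub>i \<otimes> w\<^sub>j\<close> has index \<open>i \<cdot> m + j\<close>, where \<open>m\<close> is the
  dimension of the second factor.
\<close>

definition kronecker :: "'k :: field mat \<Rightarrow> 'k mat \<Rightarrow> 'k mat" where
  "kronecker A B = mat (dim_row A * dim_row B) (dim_col A * dim_col B)
     (\<lambda>(i, j). A $$ (i div dim_row B, j div dim_col B) * B $$ (i mod dim_row B, j mod dim_col B))"

text \<open>
  \<open>D\<^sub>4\<close> acts on \<open>M \<otimes> N\<close> through the comultiplication \<open>\<Delta>(a) = a \<otimes> b + 1 \<otimes> a\<close>, \<open>\<Delta>(b) = b \<otimes> b\<close>,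
  \<open>\<Delta>(c) = c \<otimes> c\<close>, \<open>\<Delta>(d) = d \<otimes> c + 1 \<otimes> d\<close>.
\<close>

fun tensor_act :: "'k :: field rep \<Rightarrow> 'k rep \<Rightarrow> D4_gen \<Rightarrow> 'k mat" where
  "tensor_act M N Gen_a =
     kronecker (act M Gen_a) (act N Gen_b) + kronecker (1\<^sub>m (rdim M)) (act N Gen_a)"
| "tensor_act M N Gen_b = kronecker (act M Gen_b) (act N Gen_b)"
| "tensor_act M N Gen_c = kronecker (act M Gen_c) (act N Gen_c)"
| "tensor_act M N Gen_d =
     kronecker (act M Gen_d) (act N Gen_c) + kronecker (1\<^sub>m (rdim M)) (act N Gen_d)"

definition tensor_rep :: "'k :: field rep \<Rightarrow> 'k rep \<Rightarrow> 'k rep" where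
  "tensor_rep M N = Rep (rdim M * rdim N) (tensor_act M N)"


subsection \<open>The simple modules \<open>V(r)\<close> and \<open>V(2,r)\<close>\<close>

text \<open>The parameter \<open>r \<in> \<int>/2\<close> is given by a natural number, of which only the parity matters.\<close>

definition V1 :: "nat \<Rightarrow> 'k :: field rep" where
  "V1 r = Rep 1 (\<lambda>s. case s of
       Gen_a \<Rightarrow> 0\<^sub>m 1 1
     | Gen_b \<Rightarrow> (- 1) ^ r \<cdot>\<^sub>m 1\<^sub>m 1
     | Gen_c \<Rightarrow> (- 1) ^ r \<cdot>\<^sub>m 1\<^sub>m 1
     | Gen_d \<Rightarrow> 0\<^sub>m 1 1)"

text \<open>The \<open>j\<close>-th column of each matrix is the image of the basis vector \<open>v\<^sub>j\<close>.\<close>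

definition V2 :: "nat \<Rightarrow> 'k :: field rep" where
  "V2 r = Rep 2 (\<lambda>s. mat_of_rows_list 2 (case s of
       Gen_a \<Rightarrow> [[0, 0],
                 [1, 0]]
     | Gen_b \<Rightarrow> [[(- 1) ^ r, 0],
                 [0, (- 1) ^ (r + 1)]]
     | Gen_c \<Rightarrow> [[(- 1) ^ (r + 1), 0],
                 [0, (- 1) ^ r]]
     | Gen_d \<Rightarrow> [[0, 2],
                 [0, 0]]))"


subsection \<open>Projective covers, injective envelopes and syzygies\<close>

definition D4_projective :: "'k :: field rep \<Rightarrow> bool" where
  "D4_projective P \<longleftrightarrow> D4_module P \<and>
     (\<forall>M N. \<forall>f \<in> D4_hom M N. \<forall>g \<in> D4_hom P N.
        D4_module M \<and> D4_module N \<and> mat_surj f \<longrightarrow> (\<exists>h \<in> D4_hom P M. f * h = g))"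

definition D4_injective :: "'k :: field rep \<Rightarrow> bool" where
  "D4_injective I \<longleftrightarrow> D4_module I \<and>
     (\<forall>M N. \<forall>f \<in> D4_hom M N. \<forall>g \<in> D4_hom M I.
        D4_module M \<and> D4_module N \<and> mat_inj f \<longrightarrow> (\<exists>h \<in> D4_hom N I. h * f = g))"

text \<open>A projective cover is an essential epimorphism from a projective module, and dually.\<close>

definition projective_cover :: "'k :: field rep \<Rightarrow> 'k rep \<Rightarrow> 'k mat \<Rightarrow> bool" where
  "projective_cover M P p \<longleftrightarrow>
     D4_projective P \<and> p \<in> D4_hom P M \<and> mat_surj p \<and>
     (\<forall>T. \<forall>h \<in> D4_hom T P. D4_module T \<and> mat_surj (p * h) \<longrightarrow> mat_surj h)"

definition injective_envelope :: "'k :: field rep \<Rightarrow> 'k rep \<Rightarrow> 'k mat \<Rightarrow> bool" where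
  "injective_envelope M I i \<longleftrightarrow>
     D4_injective I \<and> i \<in> D4_hom M I \<and> mat_inj i \<and>
     (\<forall>T. \<forall>h \<in> D4_hom I T. D4_module T \<and> mat_inj (h * i) \<longrightarrow> mat_inj h)"

text \<open>
  \<open>K\<close> is a kernel of a projective cover of \<open>M\<close>; respectively \<open>C\<close> is a cokernel of an injective
  envelope of \<open>M\<close>.  These modules are unique only up to isomorphism, so \<open>\<Omega> M\<close> and \<open>\<Omega>\<^sup>-\<^sup>1 M\<close> below
  are arbitrary representatives.
\<close>

definition is_syzygy :: "'k :: field rep \<Rightarrow> 'k rep \<Rightarrow> bool" where
  "is_syzygy M K \<longleftrightarrow> D4_module K \<and>
     (\<exists>P p. projective_cover M P p \<and>
        (\<exists>j \<in> D4_hom K P. mat_inj j \<and> mat_image j = mat_kernel p))"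

definition is_cosyzygy :: "'k :: field rep \<Rightarrow> 'k rep \<Rightarrow> bool" where
  "is_cosyzygy M C \<longleftrightarrow> D4_module C \<and>
     (\<exists>I i. injective_envelope M I i \<and>
        (\<exists>q \<in> D4_hom I C. mat_surj q \<and> mat_kernel q = mat_image i))"

definition Omega :: "'k :: field rep \<Rightarrow> 'k rep" where
  "Omega M = (SOME K. is_syzygy M K)"

definition Omega_inv :: "'k :: field rep \<Rightarrow> 'k rep" where
  "Omega_inv M = (SOME C. is_cosyzygy M C)"


section \<open>The Green ring\<close>

definition iso_class :: "'k :: field rep \<Rightarrow> 'k rep set" where
  "iso_class M = {N. D4_module N \<and> D4_iso M N}"

definition iso_classes :: "'k :: field rep set set" where
  "iso_classes = {iso_class M | M. D4_module M}"

definition tensor_class :: "'k :: field rep set \<Rightarrow> 'k rep set \<Rightarrow> 'k rep set" where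
  "tensor_class U W = (\<Union>M\<in>U. \<Union>N\<in>W. iso_class (tensor_rep M N))"

text \<open>
  The free abelian group on the isomorphism classes, with the bilinear extension of the tensor
  product as multiplication.  The Green ring is its quotient by the subgroup generated by the
  elements \<open>[M \<oplus> N] - [M] - [N]\<close>, which is an ideal.
\<close>

definition free_class_ring :: "('k :: field rep set \<Rightarrow>\<^sub>0 int) ring" where
  "free_class_ring =
     \<lparr>carrier = carrier (free_Abelian_group iso_classes),
      monoid.mult = (\<lambda>p q. frag_extend (\<lambda>U. frag_extend (\<lambda>W. frag_of (tensor_class U W)) q) p),
      one = frag_of (iso_class (V1 0)),
      ring.zero = 0,
      add = (+)\<rparr>"

definition split_relations :: "('k :: field rep set \<Rightarrow>\<^sub>0 int) set" where
  "split_relations = generate (free_Abelian_group iso_classes)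
     {frag_of (iso_class (direct_sum_rep M N)) -
        (frag_of (iso_class M) + frag_of (iso_class N)) | M N. D4_module M \<and> D4_module N}"

definition green_ring :: "('k :: field rep set \<Rightarrow>\<^sub>0 int) set ring" where
  "green_ring = free_class_ring Quot split_relations"

definition green_class :: "'k :: field rep \<Rightarrow> ('k rep set \<Rightarrow>\<^sub>0 int) set" where
  "green_class M = split_relations +>\<^bsub>free_class_ring\<^esub> frag_of (iso_class M)"

definition subring_generated :: "('a, 'b) ring_scheme \<Rightarrow> 'a set \<Rightarrow> ('a, 'b) ring_scheme" where
  "subring_generated R S = R \<lparr>carrier := generate_ring R S\<rparr>"


section \<open>The polynomial ring in four variables\<close>

datatype poly_var = Var_g | Var_x | Var_y | Var_z

text \<open>Polynomials are finitely supported functions from monomials, i.e.\ exponent vectors, to \<open>\<int>\<close>.\<close>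

type_synonym int_poly4 = "(poly_var \<Rightarrow>\<^sub>0 nat) \<Rightarrow>\<^sub>0 int"

definition pvar :: "poly_var \<Rightarrow> int_poly4" where
  "pvar i = Poly_Mapping.single (Poly_Mapping.single i 1) 1"

abbreviation g1 :: int_poly4 where "g1 \<equiv> pvar Var_g"
abbreviation x1 :: int_poly4 where "x1 \<equiv> pvar Var_x"
abbreviation y1 :: int_poly4 where "y1 \<equiv> pvar Var_y"
abbreviation z1 :: int_poly4 where "z1 \<equiv> pvar Var_z"

definition int_poly4_ring :: "int_poly4 ring" where
  "int_poly4_ring = ring_of_type_algebra"

end

theory Submission
  imports Defs "HOL-Library.Function_Algebras"
begin

text \<open>
  The five relations and the pairwise commutation of the generators come from explicit
  isomorphisms of modules of dimension at most 9, and \<open>\<Omega> V(0)\<close>, \<open>\<Omega>\<^sup>-\<^sup>1 V(0)\<close> are identified with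
  the radical of \<open>P(V(0))\<close> and its dual.  So there is a ring homomorphism from the polynomial ring
  onto \<open>R\<close> whose kernel contains the ideal \<open>I\<close> of the relations.

  Equality of the kernel with \<open>I\<close> needs no Krull-Schmidt theorem: a subspace \<open>F(M)\<close> of every module
  \<open>M\<close> that is preserved by all homomorphisms makes \<open>dim F(M)\<close> additive on direct sums, hence a
  functional on the Green ring.  With \<open>Inv\<close> the trivial isotypic part of the socle and \<open>rad M = a M + d M\<close>,
  the functional \<open>dim (Inv + rad) - dim rad\<close> counts the summands \<open>V(0)\<close>; it is nonzero on \<open>V(0)\<close>
  and vanishes on \<open>x R\<close>, on \<open>g\<close>, and on \<open>g\<^sup>i y\<^sup>m\<close> for \<open>m > 0\<close>.  Modulo \<open>I\<close> and \<open>x\<close>, where \<open>y\<close> and \<open>z\<close> are mutually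
  inverse, every kernel element can be multiplied by a power of \<open>y\<close> to become a polynomial in \<open>g\<close> and
  \<open>y\<close>, whose coefficients this functional shows to be zero one after the other.  What remains is a
  combination of \<open>x, g x, x\<^sup>2, g x\<^sup>2\<close> modulo \<open>I\<close>, and its coefficients are detected by the functionals
  that count the summands \<open>V(2,0)\<close> and \<open>P(V(0))\<close>.
\<close>

section \<open>Kronecker products\<close>

text \<open>Modulo \<open>x\<close> the relations present Laurent polynomials in \<open>y\<close>
  over the group ring of \<open>g\<close>. So the kernel question splits into the independence of
  the powers of \<open>y\<close>, where infinitely many modules enter, and a question of rank four
  about multiples of \<open>x\<close>. In the former the obstacle is that the tensor powers of
  \<Omega> V(0) are never decomposed; \<open>a_absorbs\<close> passes from a module to its tensor
  product with \<Omega> V(0) and excludes trivial summands in all powers at once. The functional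
  sees only the constant term, and multiplication by \<open>g\<close> and \<open>z\<close> brings
  the other coefficients there. In the latter, \<open>x\<close>, \<open>g x\<close>,
  \<open>x^2\<close>, \<open>g x^2\<close> are the classes of V(2,0), V(2,1), P(V(1)), P(V(0));
  multiplication by \<open>g\<close> exchanges them in pairs, so two functionals detect four
  coefficients. Isomorphisms are checked on integer matrices that are mutually inverse up to a power
  of 2, so one computation serves all fields of characteristic other than 2. Transposition of
  matrices exchanges projective covers with injective envelopes, hence only a projective cover has
  to be found.\<close>

lemma sum_div_mod:
  fixes f :: "nat \<Rightarrow> nat \<Rightarrow> 'a :: comm_monoid_add"
  shows "(\<Sum>k<m * n. f (k div n) (k mod n)) = (\<Sum>i<m. \<Sum>j<n. f i j)"
proof -
  have "(\<Sum>k<m * n. f (k div n) (k mod n)) = (\<Sum>i<m. \<Sum>k = i * n..<i * n + n. f (k div n) (k mod n))"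
    by (simp add: sum.nat_group)
  also have "\<dots> = (\<Sum>i<m. \<Sum>j<n. f i j)"
  proof (rule sum.cong [OF refl])
    fix i
    have "(\<Sum>k = i * n..<i * n + n. f (k div n) (k mod n))
        = (\<Sum>j<n. f ((i * n + j) div n) ((i * n + j) mod n))"
      using sum.shift_bounds_nat_ivl[of "\<lambda>k. f (k div n) (k mod n)" 0 "i * n" n]
      by (simp add: atLeast0LessThan add.commute)
    also have "\<dots> = (\<Sum>j<n. f i j)"
      by (rule sum.cong) auto
    finally show "(\<Sum>k = i * n..<i * n + n. f (k div n) (k mod n)) = (\<Sum>j<n. f i j)" .
  qed
  finally show ?thesis .
qed

lemma kronecker_carrier [simp, intro]:
  "A \<in> carrier_mat m n \<Longrightarrow> B \<in> carrier_mat p q \<Longrightarrow> kronecker A B \<in> carrier_mat (m * p) (n * q)"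
  by (auto simp: kronecker_def)

lemma dim_row_kronecker [simp]: "dim_row (kronecker A B) = dim_row A * dim_row B"
  and dim_col_kronecker [simp]: "dim_col (kronecker A B) = dim_col A * dim_col B"
  by (simp_all add: kronecker_def)

lemma index_kronecker:
  assumes "i < dim_row A * dim_row B" "j < dim_col A * dim_col B"
  shows "kronecker A B $$ (i, j) =
    A $$ (i div dim_row B, j div dim_col B) * B $$ (i mod dim_row B, j mod dim_col B)"
  using assms by (simp add: kronecker_def)

lemma div_mod_bounds:
  fixes i m n :: nat
  assumes "i < m * n"
  shows "i div n < m" "i mod n < n"
proof -
  have "n > 0" using assms by (cases n) auto
  then show "i div n < m" "i mod n < n" using assms by (auto simp: less_mult_imp_div_less)
qed

text \<open>The contraction index of the large product splits into quotient and remainder, so the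
  sum factors into the two small ones. This interchange law is the main tool for tensor products of
  actions and of maps.\<close>

lemma kronecker_mult:
  fixes A B C D :: "'k :: field mat"
  assumes "A \<in> carrier_mat m n" "B \<in> carrier_mat n p" "C \<in> carrier_mat m' n'" "D \<in> carrier_mat n' p'"
  shows "kronecker A C * kronecker B D = kronecker (A * B) (C * D)"
proof (rule eq_matI)
  fix i j assume "i < dim_row (kronecker (A * B) (C * D))" "j < dim_col (kronecker (A * B) (C * D))"
  then have i: "i < m * m'" and j: "j < p * p'" using assms by auto
  note ib = div_mod_bounds [OF i] and jb = div_mod_bounds [OF j]
  have "(kronecker A C * kronecker B D) $$ (i, j) =
     (\<Sum>k<n * n'. kronecker A C $$ (i, k) * kronecker B D $$ (k, j))"
    using assms i j by (auto simp: scalar_prod_def atLeast0LessThan intro!: sum.cong)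
  also have "\<dots> = (\<Sum>k<n * n'. (A $$ (i div m', k div n') * C $$ (i mod m', k mod n')) *
       (B $$ (k div n', j div p') * D $$ (k mod n', j mod p')))"
    using assms i j by (intro sum.cong refl) (auto simp: index_kronecker)
  also have "\<dots> = (\<Sum>k<n. \<Sum>l<n'. (A $$ (i div m', k) * C $$ (i mod m', l)) *
       (B $$ (k, j div p') * D $$ (l, j mod p')))"
    by (rule sum_div_mod)
  also have "\<dots> = (\<Sum>k<n. A $$ (i div m', k) * B $$ (k, j div p')) * (\<Sum>l<n'. C $$ (i mod m', l) * D $$ (l, j mod p'))"
    by (simp add: sum_product mult_ac)
  also have "\<dots> = kronecker (A * B) (C * D) $$ (i, j)"
    using assms i j ib jb by (simp add: index_kronecker scalar_prod_def atLeast0LessThan)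
  finally show "(kronecker A C * kronecker B D) $$ (i, j) = kronecker (A * B) (C * D) $$ (i, j)" .
qed (use assms in auto)

lemma kronecker_add_left:
  fixes A B C :: "'k :: field mat"
  assumes "A \<in> carrier_mat m n" "B \<in> carrier_mat m n" "C \<in> carrier_mat p q"
  shows "kronecker (A + B) C = kronecker A C + kronecker B C"
  using assms by (intro eq_matI) (auto simp: index_kronecker div_mod_bounds algebra_simps)

lemma kronecker_add_right:
  fixes A B C :: "'k :: field mat"
  assumes "A \<in> carrier_mat m n" "B \<in> carrier_mat p q" "C \<in> carrier_mat p q"
  shows "kronecker A (B + C) = kronecker A B + kronecker A C"
  using assms by (intro eq_matI) (auto simp: index_kronecker div_mod_bounds distrib_left)

lemma kronecker_uminus_left:
  fixes A B :: "'k :: field mat"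
  shows "kronecker (- A) B = - kronecker A B"
  by (intro eq_matI) (auto simp: index_kronecker div_mod_bounds)

lemma kronecker_uminus_right:
  fixes A B :: "'k :: field mat"
  shows "kronecker A (- B) = - kronecker A B"
  by (intro eq_matI) (auto simp: index_kronecker div_mod_bounds)

lemma kronecker_zero_left [simp]:
  fixes B :: "'k :: field mat"
  shows "kronecker (0\<^sub>m m n) B = 0\<^sub>m (m * dim_row B) (n * dim_col B)"
  by (intro eq_matI) (auto simp: index_kronecker div_mod_bounds)

lemma kronecker_zero_right [simp]:
  fixes A :: "'k :: field mat"
  shows "kronecker A (0\<^sub>m m n) = 0\<^sub>m (dim_row A * m) (dim_col A * n)"
  by (intro eq_matI) (auto simp: index_kronecker div_mod_bounds)

lemma kronecker_one [simp]: "kronecker (1\<^sub>m m) (1\<^sub>m n) = (1\<^sub>m (m * n) :: 'k :: field mat)"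
proof (intro eq_matI)
  fix i j assume "i < dim_row (1\<^sub>m (m * n) :: 'k mat)" "j < dim_col (1\<^sub>m (m * n) :: 'k mat)"
  then show "kronecker (1\<^sub>m m) (1\<^sub>m n) $$ (i, j) = (1\<^sub>m (m * n) :: 'k mat) $$ (i, j)"
    by (auto simp: index_kronecker div_mod_bounds) (metis div_mult_mod_eq)
qed auto

text \<open>Reading an index in the mixed radix given by the three dimensions yields the same three
  digits for either bracketing. Associativity is therefore an equality of matrices and not merely an
  isomorphism.\<close>

lemma kronecker_assoc:
  fixes A B C :: "'k :: field mat"
  shows "kronecker (kronecker A B) C = kronecker A (kronecker B C)"
proof (intro eq_matI)
  fix i j assume "i < dim_row (kronecker A (kronecker B C))" "j < dim_col (kronecker A (kronecker B C))"
  then have i: "i < dim_row A * dim_row B * dim_row C" and j: "j < dim_col A * dim_col B * dim_col C"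
    by (auto simp: mult.assoc)
  have i': "i < dim_row A * (dim_row B * dim_row C)" and j': "j < dim_col A * (dim_col B * dim_col C)"
    using i j by (auto simp: mult.assoc)
  have split: "k div (p * q) = k div q div p" "k mod (p * q) div q = k div q mod p"
    "k mod (p * q) mod q = k mod q" for k p q :: nat
  proof -
    show "k div (p * q) = k div q div p" by (simp add: div_mult2_eq mult.commute [of p q])
    have "k mod (p * q) = q * (k div q mod p) + k mod q"
      by (simp add: mod_mult2_eq mult.commute [of p q])
    then show "k mod (p * q) div q = k div q mod p" "k mod (p * q) mod q = k mod q"
      by (cases "q = 0"; simp)+
  qed
  note bounds = div_mod_bounds [OF i] div_mod_bounds [OF j] div_mod_bounds [OF i'] div_mod_bounds [OF j']
  show "kronecker (kronecker A B) C $$ (i, j) = kronecker A (kronecker B C) $$ (i, j)"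
    using i j i' j' bounds by (simp add: index_kronecker split mult.assoc)
qed (auto simp: mult.assoc)

section \<open>Isomorphisms, tensor products and biproducts\<close>

lemma act_carrier [simp]:
  "D4_module M \<Longrightarrow> act M s \<in> carrier_mat (rdim M) (rdim M)"
  by (cases s) (auto simp: D4_module_def Let_def)

lemma D4_moduleD:
  assumes "D4_module M"
  shows "act M Gen_b * act M Gen_a = - (act M Gen_a * act M Gen_b)"
    "act M Gen_d * act M Gen_b = - (act M Gen_b * act M Gen_d)"
    "act M Gen_c * act M Gen_a = - (act M Gen_a * act M Gen_c)"
    "act M Gen_d * act M Gen_c = - (act M Gen_c * act M Gen_d)"
    "act M Gen_b * act M Gen_c = act M Gen_c * act M Gen_b"
    "act M Gen_a * act M Gen_a = 0\<^sub>m (rdim M) (rdim M)"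
    "act M Gen_b * act M Gen_b = 1\<^sub>m (rdim M)"
    "act M Gen_c * act M Gen_c = 1\<^sub>m (rdim M)"
    "act M Gen_d * act M Gen_d = 0\<^sub>m (rdim M) (rdim M)"
    "act M Gen_d * act M Gen_a + act M Gen_a * act M Gen_d
      = 1\<^sub>m (rdim M) - act M Gen_b * act M Gen_c"
  using assms unfolding D4_module_def Let_def by blast+

lemma D4_homI:
  assumes "f \<in> carrier_mat (rdim N) (rdim M)" "\<And>s. f * act M s = act N s * f"
  shows "f \<in> D4_hom M N"
  using assms by (auto simp: D4_hom_def)

lemma D4_homD:
  assumes "f \<in> D4_hom M N"
  shows "f \<in> carrier_mat (rdim N) (rdim M)" "f * act M s = act N s * f"
  using assms by (auto simp: D4_hom_def)

lemma D4_hom_one [simp]: "D4_module M \<Longrightarrow> 1\<^sub>m (rdim M) \<in> D4_hom M M"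
  by (rule D4_homI) (simp_all add: left_mult_one_mat [OF act_carrier] right_mult_one_mat [OF act_carrier])

lemma D4_hom_comp:
  assumes "f \<in> D4_hom M N" "g \<in> D4_hom N L" "D4_module M" "D4_module N" "D4_module L"
  shows "g * f \<in> D4_hom M L"
proof (rule D4_homI)
  note f = D4_homD [OF assms(1)] and g = D4_homD [OF assms(2)]
  show "g * f \<in> carrier_mat (rdim L) (rdim M)" using f(1) g(1) by auto
  fix s
  note ac = assms(3-5) [THEN act_carrier, of s]
  have "g * f * act M s = g * (f * act M s)" by (rule assoc_mult_mat [OF g(1) f(1) ac(1)])
  also have "\<dots> = g * act N s * f" unfolding f(2) by (rule assoc_mult_mat [OF g(1) ac(2) f(1), symmetric])
  also have "\<dots> = act L s * (g * f)" unfolding g(2) by (rule assoc_mult_mat [OF ac(3) g(1) f(1)])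
  finally show "g * f * act M s = act L s * (g * f)" .
qed

lemma D4_hom_add:
  assumes "f \<in> D4_hom M N" "g \<in> D4_hom M N" "D4_module M" "D4_module N"
  shows "f + g \<in> D4_hom M N"
proof (rule D4_homI)
  note f = D4_homD [OF assms(1)] and g = D4_homD [OF assms(2)]
  show "f + g \<in> carrier_mat (rdim N) (rdim M)" using f(1) g(1) by auto
  fix s
  show "(f + g) * act M s = act N s * (f + g)"
    using f(2) [of s] g(2) [of s] add_mult_distrib_mat [OF f(1) g(1) act_carrier [OF assms(3)], of s]
      mult_add_distrib_mat [OF act_carrier [OF assms(4)] f(1) g(1), of s] by simp
qed

text \<open>Matrix associativity carries dimension conditions; this form exposes the inner product
  \<open>B * C\<close>, which collapses to an identity or to zero in its uses.\<close>

lemma mult_mat_middle: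
  fixes A B C D :: "'a :: semiring_0 mat"
  assumes "A \<in> carrier_mat m n" "B \<in> carrier_mat n p" "C \<in> carrier_mat p q" "D \<in> carrier_mat q r"
  shows "A * B * (C * D) = A * (B * C) * D"
  using assoc_mult_mat [OF mult_carrier_mat [OF assms(1,2)] assms(3,4)] assoc_mult_mat [OF assms(1-3)]
  by simp

lemma mult_mat_vec_eq_iff_inj:
  fixes f :: "'k :: field mat"
  assumes "mat_inj f" "f \<in> carrier_mat m n" "v \<in> carrier_vec n" "w \<in> carrier_vec n"
  shows "f *\<^sub>v v = f *\<^sub>v w \<longleftrightarrow> v = w"
  using assms by (auto simp: mat_inj_def inj_on_def)

lemma mat_injI:
  fixes f :: "'k :: field mat"
  assumes "f \<in> carrier_mat m n" "g \<in> carrier_mat n m" "g * f = 1\<^sub>m n"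
  shows "mat_inj f"
  unfolding mat_inj_def
proof (rule inj_on_inverseI)
  fix v :: "'k vec" assume "v \<in> carrier_vec (dim_col f)"
  then show "g *\<^sub>v (f *\<^sub>v v) = v"
    using assms assoc_mult_mat_vec [OF assms(2,1), of v, symmetric] by auto
qed

lemma mat_surjI:
  fixes f :: "'k :: field mat"
  assumes "f \<in> carrier_mat m n" "g \<in> carrier_mat n m" "f * g = 1\<^sub>m m"
  shows "mat_surj f"
proof -
  have "v \<in> mat_image f" if "v \<in> carrier_vec m" for v
  proof -
    have "f *\<^sub>v (g *\<^sub>v v) = v"
      using assoc_mult_mat_vec [OF assms(1,2) that, symmetric] assms(3) that by simp
    then show ?thesis using assms that
      by (auto simp: mat_image_def intro!: rev_image_eqI [of "g *\<^sub>v v"])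
  qed
  then show ?thesis using assms by (auto simp: mat_surj_def mat_image_def)
qed

lemma mat_eqI_vec:
  fixes A B :: "'k :: field mat"
  assumes "A \<in> carrier_mat m n" "B \<in> carrier_mat m n"
    and "\<And>v. v \<in> carrier_vec n \<Longrightarrow> A *\<^sub>v v = B *\<^sub>v v"
  shows "A = B"
proof (rule eq_matI)
  fix i j assume "i < dim_row B" "j < dim_col B"
  then have ij: "i < m" "j < n" using assms by auto
  have "(A *\<^sub>v unit_vec n j) $ i = (B *\<^sub>v unit_vec n j) $ i" using assms by auto
  then show "A $$ (i, j) = B $$ (i, j)" using assms(1,2) ij by simp
qed (use assms in auto)

text \<open>The columns of the inverse are chosen preimages of the unit vectors.\<close>

lemma mat_surj_right_inverse:
  fixes f :: "'k :: field mat"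
  assumes "mat_surj f" "f \<in> carrier_mat m n"
  obtains g where "g \<in> carrier_mat n m" "f * g = 1\<^sub>m m"
proof -
  have "\<exists>v \<in> carrier_vec n. f *\<^sub>v v = unit_vec m j" for j
  proof -
    have "unit_vec m j \<in> mat_image f" using assms by (auto simp: mat_surj_def)
    then show ?thesis using assms by (auto simp: mat_image_def)
  qed
  then obtain h where h: "\<And>j. h j \<in> carrier_vec n" "\<And>j. f *\<^sub>v h j = unit_vec m j" by metis
  define g where "g = mat_of_cols n (map h [0..<m])"
  have g: "g \<in> carrier_mat n m" unfolding g_def by (metis diff_zero length_map length_upt mat_of_cols_carrier(1))
  have "f * g = 1\<^sub>m m"
  proof (rule mat_col_eqI)
    fix j assume "j < dim_col (1\<^sub>m m :: 'k mat)"
    then have j: "j < m" by simp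
    have "col (f * g) j = f *\<^sub>v col g j" using assms g j by (intro eq_vecI) auto
    also have "col g j = h j" using j h by (simp add: g_def)
    finally show "col (f * g) j = col (1\<^sub>m m) j" using h j by simp
  qed (use assms g in auto)
  with g show thesis by (rule that)
qed

text \<open>\<open>D4_iso\<close> only promises a bijective homomorphism. Surjectivity gives a
  linear right inverse, and cancelling the injective \<open>f\<close> on the left shows that it is
  also a left inverse and commutes with the action.\<close>

lemma D4_iso_inverse:
  assumes "D4_iso M N" "D4_module M" "D4_module N"
  obtains f g where "f \<in> D4_hom M N" "g \<in> D4_hom N M" "g * f = 1\<^sub>m (rdim M)" "f * g = 1\<^sub>m (rdim N)"
proof -
  obtain f where f: "f \<in> D4_hom M N" "mat_inj f" "mat_surj f"
    using assms by (auto simp: D4_iso_def)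
  note fc = D4_homD(1) [OF f(1)]
  obtain g where g: "g \<in> carrier_mat (rdim M) (rdim N)" "f * g = 1\<^sub>m (rdim N)"
    using mat_surj_right_inverse [OF f(3) fc] .
  have cancel: "U = W" if "f * U = f * W" and "U \<in> carrier_mat (rdim M) k" and "W \<in> carrier_mat (rdim M) k"
    for U W :: "'a mat" and k
  proof (rule mat_eqI_vec [OF that(2,3)])
    fix v :: "'a vec" assume v: "v \<in> carrier_vec k"
    have "f *\<^sub>v (U *\<^sub>v v) = f *\<^sub>v (W *\<^sub>v v)"
      using that(1) assoc_mult_mat_vec [OF fc that(2) v] assoc_mult_mat_vec [OF fc that(3) v] by simp
    then show "U *\<^sub>v v = W *\<^sub>v v" using mult_mat_vec_eq_iff_inj [OF f(2) fc] that v by auto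
  qed
  have gf: "g * f = 1\<^sub>m (rdim M)"
  proof (rule cancel)
    show "f * (g * f) = f * 1\<^sub>m (rdim M)"
      using assoc_mult_mat [OF fc g(1) fc] g(2) fc by simp
  qed (use fc g in auto)
  have "g \<in> D4_hom N M"
  proof (rule D4_homI [OF g(1)])
    fix s
    note am = act_carrier [OF assms(2), of s] and an = act_carrier [OF assms(3), of s]
    show "g * act N s = act M s * g"
    proof (rule cancel)
      have "f * (g * act N s) = act N s"
        using assoc_mult_mat [OF fc g(1) an] g(2) an by simp
      also have "\<dots> = act N s * (f * g)" using g an by simp
      also have "\<dots> = f * act M s * g"
        using assoc_mult_mat [OF an fc g(1)] D4_homD(2) [OF f(1), of s] by simp
      also have "\<dots> = f * (act M s * g)" by (rule assoc_mult_mat [OF fc am g(1)])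
      finally show "f * (g * act N s) = f * (act M s * g)" .
    qed (use am an g in auto)
  qed
  with f(1) show thesis using gf g(2) that by blast
qed

lemma D4_isoI:
  assumes "f \<in> D4_hom M N" "g \<in> carrier_mat (rdim M) (rdim N)" "g * f = 1\<^sub>m (rdim M)" "f * g = 1\<^sub>m (rdim N)"
  shows "D4_iso M N"
  using assms mat_injI [OF D4_homD(1) [OF assms(1)]] mat_surjI [OF D4_homD(1) [OF assms(1)]]
  by (auto simp: D4_iso_def)

lemma D4_iso_refl [simp]: "D4_module M \<Longrightarrow> D4_iso M M"
  by (rule D4_isoI [of "1\<^sub>m (rdim M)" _ _ "1\<^sub>m (rdim M)"]) auto

lemma D4_iso_sym:
  assumes "D4_iso M N" "D4_module M" "D4_module N"
  shows "D4_iso N M"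
  using D4_iso_inverse [OF assms] D4_isoI D4_homD(1) by metis

lemma D4_iso_trans:
  assumes "D4_iso M N" "D4_iso N L" "D4_module M" "D4_module N" "D4_module L"
  shows "D4_iso M L"
proof -
  obtain f g where fg: "f \<in> D4_hom M N" "g \<in> D4_hom N M" "g * f = 1\<^sub>m (rdim M)" "f * g = 1\<^sub>m (rdim N)"
    using D4_iso_inverse [OF assms(1,3,4)] .
  obtain f' g' where fg': "f' \<in> D4_hom N L" "g' \<in> D4_hom L N" "g' * f' = 1\<^sub>m (rdim N)" "f' * g' = 1\<^sub>m (rdim L)"
    using D4_iso_inverse [OF assms(2,4,5)] .
  note c = D4_homD(1) [OF fg(1)] D4_homD(1) [OF fg(2)] D4_homD(1) [OF fg'(1)] D4_homD(1) [OF fg'(2)]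
  have 1: "g * g' * (f' * f) = 1\<^sub>m (rdim M)"
    using mult_mat_middle [OF c(2,4,3,1)] c fg(3) fg'(3) by simp
  have 2: "f' * f * (g * g') = 1\<^sub>m (rdim L)"
    using mult_mat_middle [OF c(3,1,2,4)] c fg(4) fg'(4) by simp
  show ?thesis
    by (rule D4_isoI [of "f' * f" _ _ "g * g'"])
      (use c 1 2 D4_hom_comp [OF fg(1) fg'(1) assms(3-5)] in auto)
qed

lemma iso_class_eq_iff:
  assumes "D4_module M" "D4_module N"
  shows "iso_class M = iso_class N \<longleftrightarrow> D4_iso M N"
  using assms D4_iso_refl D4_iso_sym D4_iso_trans unfolding iso_class_def by blast

lemma rdim_tensor_rep [simp]: "rdim (tensor_rep M N) = rdim M * rdim N"
  by (simp add: tensor_rep_def)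

lemma act_tensor_rep [simp]: "act (tensor_rep M N) = tensor_act M N"
  by (simp add: tensor_rep_def)

lemma kronecker_hom:
  assumes "f \<in> D4_hom M M'" "g \<in> D4_hom N N'" "D4_module M" "D4_module N" "D4_module M'" "D4_module N'"
  shows "kronecker f g \<in> D4_hom (tensor_rep M N) (tensor_rep M' N')"
proof (rule D4_homI)
  note f = D4_homD [OF assms(1)] and g = D4_homD [OF assms(2)]
  note c = f(1) g(1)
  show "kronecker f g \<in> carrier_mat (rdim (tensor_rep M' N')) (rdim (tensor_rep M N))"
    using c by auto
  fix s
  have K: "kronecker f g * kronecker (act M s) (act N t) = kronecker (act M' s) (act N' t) * kronecker f g" for s t
    using assms(3-6) f(2) [of s] g(2) [of t]
    by (simp add: kronecker_mult [OF f(1) act_carrier g(1) act_carrier]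
        kronecker_mult [OF act_carrier f(1) act_carrier g(1)])
  have K1: "kronecker f g * kronecker (1\<^sub>m (rdim M)) (act N t) = kronecker (1\<^sub>m (rdim M')) (act N' t) * kronecker f g" for t
    using assms(3-6) f(1) g(2) [of t]
    by (simp add: kronecker_mult [OF f(1) one_carrier_mat g(1) act_carrier]
        kronecker_mult [OF one_carrier_mat f(1) act_carrier g(1)])
  have c': "kronecker (act M s) (act N t) \<in> carrier_mat (rdim M * rdim N) (rdim M * rdim N)"
     "kronecker (act M' s) (act N' t) \<in> carrier_mat (rdim M' * rdim N') (rdim M' * rdim N')"
     "kronecker (1\<^sub>m (rdim M)) (act N t) \<in> carrier_mat (rdim M * rdim N) (rdim M * rdim N)"
     "kronecker (1\<^sub>m (rdim M')) (act N' t) \<in> carrier_mat (rdim M' * rdim N') (rdim M' * rdim N')"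
    for s t using assms by auto
  note kc = kronecker_carrier [OF c]
  show "kronecker f g * act (tensor_rep M N) s = act (tensor_rep M' N') s * kronecker f g"
    by (cases s) (simp_all add: K K1 mult_add_distrib_mat [OF kc c'(1) c'(3)] add_mult_distrib_mat [OF c'(2) c'(4) kc])
qed

lemma kronecker_minus_left:
  fixes A B C :: "'k :: field mat"
  assumes "A \<in> carrier_mat m n" "B \<in> carrier_mat m n" "C \<in> carrier_mat p q"
  shows "kronecker (A - B) C = kronecker A C - kronecker B C"
  using assms by (intro eq_matI) (auto simp: index_kronecker div_mod_bounds left_diff_distrib)

lemma kronecker_minus_right:
  fixes A B C :: "'k :: field mat"
  assumes "A \<in> carrier_mat m n" "B \<in> carrier_mat p q" "C \<in> carrier_mat p q"
  shows "kronecker A (B - C) = kronecker A B - kronecker A C"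
  using assms by (intro eq_matI) (auto simp: index_kronecker div_mod_bounds right_diff_distrib)

text \<open>In terms of the algebra: the comultiplication respects the defining relations. The
  images of the generators are multiplied out with \<open>kronecker_mult\<close>, and the relations
  of both factors finish each case.\<close>

lemma D4_module_tensor [simp]:
  assumes M: "D4_module M" and N: "D4_module N"
  shows "D4_module (tensor_rep M N)"
proof -
  let ?m = "rdim M" and ?n = "rdim N"
  note m = D4_moduleD [OF M] and n = D4_moduleD [OF N]
  note km = kronecker_mult [of _ ?m ?m _ ?m _ ?n ?n _ ?n]
  have kc: "kronecker U W \<in> carrier_mat (?m * ?n) (?m * ?n)"
    if "U \<in> carrier_mat ?m ?m" "W \<in> carrier_mat ?n ?n" for U W :: "'a mat" using that by auto
  note dist = add_mult_distrib_mat [of _ "?m * ?n" "?m * ?n" _ _ "?m * ?n"]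
    mult_add_distrib_mat [of _ "?m * ?n" "?m * ?n" _ "?m * ?n"]
  note ac = act_carrier [OF M] act_carrier [OF N]
  note act_prod = mult_carrier_mat [OF ac(1) ac(1)] mult_carrier_mat [OF ac(2) ac(2)]
  note S = km dist kc ac act_prod m(1-9) n(1-9) kronecker_uminus_left kronecker_uminus_right
    left_mult_one_mat [OF ac(1)] right_mult_one_mat [OF ac(1)]
    left_mult_one_mat [OF ac(2)] right_mult_one_mat [OF ac(2)]
  note cR = add_carrier_mat [of _ "?m * ?n" "?m * ?n"]
  let ?K = kronecker and ?a = "act M Gen_a" and ?b = "act M Gen_b" and ?c = "act M Gen_c" and ?d = "act M Gen_d"
    and ?a' = "act N Gen_a" and ?b' = "act N Gen_b" and ?c' = "act N Gen_c" and ?d' = "act N Gen_d"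
  have neg: "- A + - B = - (A + B)" if "A \<in> carrier_mat k k" "B \<in> carrier_mat k k" for A B :: "'a mat" and k
    using that by (intro eq_matI) auto
  let ?A = "?K ?a ?b' + ?K (1\<^sub>m ?m) ?a'" and ?D = "?K ?d ?c' + ?K (1\<^sub>m ?m) ?d'"
  have 1: "?K ?b ?b' * ?A = - (?A * ?K ?b ?b')" by (simp add: S neg [of _ "?m * ?n"])
  have 2: "?D * ?K ?b ?b' = - (?K ?b ?b' * ?D)" by (simp add: S neg [of _ "?m * ?n"])
  have 3: "?K ?c ?c' * ?A = - (?A * ?K ?c ?c')" by (simp add: S neg [of _ "?m * ?n"])
  have 4: "?D * ?K ?c ?c' = - (?K ?c ?c' * ?D)" by (simp add: S neg [of _ "?m * ?n"])
  have inv: "A + - A = 0\<^sub>m k k" "- A + A = 0\<^sub>m k k" if "A \<in> carrier_mat k k" for A :: "'a mat" and k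
    using that by (intro eq_matI; auto)+
  have 5: "?A * ?A = 0\<^sub>m (?m * ?n) (?m * ?n)" by (simp add: S inv [of _ "?m * ?n"])
  have 6: "?D * ?D = 0\<^sub>m (?m * ?n) (?m * ?n)" by (simp add: S inv [of _ "?m * ?n"])
  \<comment> \<open>The mixed terms of \<open>?D * ?A + ?A * ?D\<close> pair \<open>d\<close> with
    \<open>c' a' + a' c'\<close> and \<open>a\<close> with \<open>d' b' + b' d'\<close>; both sums
    vanish by anticommutation in \<open>N\<close>.\<close>
  have cancel: "p + - q + (- r + s) + (t + r + (q + u)) = (p + t) + (s + u)"
    if "p \<in> carrier_mat k k" "q \<in> carrier_mat k k" "r \<in> carrier_mat k k" "s \<in> carrier_mat k k"
      "t \<in> carrier_mat k k" "u \<in> carrier_mat k k" for p q r s t u :: "'a mat" and k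
    using that by (intro eq_matI) auto
  have "?D * ?A + ?A * ?D = (?K (?d * ?a) (?c' * ?b') + ?K (?a * ?d) (?c' * ?b'))
      + (?K (1\<^sub>m ?m) (?d' * ?a') + ?K (1\<^sub>m ?m) (?a' * ?d'))"
    by (simp add: S) (rule cancel [of _ "?m * ?n"]; simp add: kc act_prod ac)
  also have "\<dots> = ?K (?d * ?a + ?a * ?d) (?c' * ?b') + ?K (1\<^sub>m ?m) (?d' * ?a' + ?a' * ?d')"
    by (simp add: kronecker_add_left [of _ ?m ?m _ _ ?n ?n] kronecker_add_right [of _ ?m ?m _ ?n ?n] act_prod ac)
  also have "\<dots> = ?K (1\<^sub>m ?m - ?b * ?c) (?c' * ?b') + ?K (1\<^sub>m ?m) (1\<^sub>m ?n - ?b' * ?c')"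
    by (simp only: m(10) n(10))
  also have "\<dots> = ?K (1\<^sub>m ?m) (?b' * ?c') - ?K (?b * ?c) (?b' * ?c') + (1\<^sub>m (?m * ?n) - ?K (1\<^sub>m ?m) (?b' * ?c'))"
    by (simp add: kronecker_minus_left [of _ ?m ?m _ _ ?n ?n] kronecker_minus_right [of _ ?m ?m _ ?n ?n] act_prod ac n(5))
  also have "\<dots> = 1\<^sub>m (?m * ?n) - ?K (?b * ?c) (?b' * ?c')"
  proof -
    have "p - q + (1\<^sub>m k - p) = 1\<^sub>m k - q" if "p \<in> carrier_mat k k" "q \<in> carrier_mat k k"
      for p q :: "'a mat" and k
      using that by (intro eq_matI) auto
    then show ?thesis by (simp add: kc act_prod ac)
  qed
  also have "?K (?b * ?c) (?b' * ?c') = ?K ?b ?b' * ?K ?c ?c'" by (simp add: km ac)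
  finally have 7: "?D * ?A + ?A * ?D = 1\<^sub>m (?m * ?n) - ?K ?b ?b' * ?K ?c ?c'" .
  have 8: "?K ?b ?b' * ?K ?c ?c' = ?K ?c ?c' * ?K ?b ?b'" "?K ?b ?b' * ?K ?b ?b' = 1\<^sub>m (?m * ?n)"
    "?K ?c ?c' * ?K ?c ?c' = 1\<^sub>m (?m * ?n)" by (simp_all add: S)
  have 9: "?A \<in> carrier_mat (?m * ?n) (?m * ?n)" "?D \<in> carrier_mat (?m * ?n) (?m * ?n)"
    by (simp_all add: kc ac)
  show ?thesis
    unfolding D4_module_def Let_def rdim_tensor_rep act_tensor_rep tensor_act.simps
    by (intro conjI) (fact 1 2 3 4 5 6 7 8 9 | simp add: kc ac)+
qed

lemma rep_eqI: "rdim M = rdim N \<Longrightarrow> (\<And>s. act M s = act N s) \<Longrightarrow> M = N"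
  by (cases M, cases N) auto

text \<open>An equality, because \<open>kronecker\<close> is strictly associative and
  coassociativity on the generators only regroups sums. Products of classes become associative
  without transport along isomorphisms.\<close>

lemma tensor_rep_assoc:
  assumes "D4_module M" "D4_module N" "D4_module L"
  shows "tensor_rep (tensor_rep M N) L = tensor_rep M (tensor_rep N L)"
proof (rule rep_eqI)
  note ac = assms [THEN act_carrier]
  have 1: "kronecker (A + B) C = kronecker A C + kronecker B C"
    if "A \<in> carrier_mat (rdim M * rdim N) (rdim M * rdim N)" "B \<in> carrier_mat (rdim M * rdim N) (rdim M * rdim N)"
      "C \<in> carrier_mat (rdim L) (rdim L)" for A B C :: "'a mat"
    using that by (rule kronecker_add_left)
  have 2: "kronecker A (B + C) = kronecker A B + kronecker A C"
    if "A \<in> carrier_mat (rdim M) (rdim M)" "B \<in> carrier_mat (rdim N * rdim L) (rdim N * rdim L)"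
      "C \<in> carrier_mat (rdim N * rdim L) (rdim N * rdim L)" for A B C :: "'a mat"
    using that by (rule kronecker_add_right)
  have 3: "A + B + C = A + (B + C)"
    if "A \<in> carrier_mat k k" "B \<in> carrier_mat k k" "C \<in> carrier_mat k k" for A B C :: "'a mat" and k
    using that by (rule assoc_add_mat)
  fix s
  show "act (tensor_rep (tensor_rep M N) L) s = act (tensor_rep M (tensor_rep N L)) s"
    by (cases s) (simp_all add: 1 2 3 [of _ "rdim M * rdim N * rdim L"] ac kronecker_assoc mult.assoc flip: kronecker_one)
qed simp

lemma D4_iso_tensor:
  assumes "D4_iso M M'" "D4_iso N N'" "D4_module M" "D4_module N" "D4_module M'" "D4_module N'"
  shows "D4_iso (tensor_rep M N) (tensor_rep M' N')"
proof -
  obtain f f' where f: "f \<in> D4_hom M M'" "f' \<in> D4_hom M' M" "f' * f = 1\<^sub>m (rdim M)" "f * f' = 1\<^sub>m (rdim M')"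
    using D4_iso_inverse [OF assms(1,3,5)] .
  obtain g g' where g: "g \<in> D4_hom N N'" "g' \<in> D4_hom N' N" "g' * g = 1\<^sub>m (rdim N)" "g * g' = 1\<^sub>m (rdim N')"
    using D4_iso_inverse [OF assms(2,4,6)] .
  note c = D4_homD(1) [OF f(1)] D4_homD(1) [OF f(2)] D4_homD(1) [OF g(1)] D4_homD(1) [OF g(2)]
  show ?thesis
    by (rule D4_isoI [OF kronecker_hom [OF f(1) g(1) assms(3-6)], of "kronecker f' g'"])
      (use c f g in \<open>auto simp: kronecker_mult [OF c(2,1,4,3)] kronecker_mult [OF c(1,2,3,4)]\<close>)
qed

section \<open>Direct sums described by injections and projections\<close>

definition is_biproduct ::
  "'k :: field rep \<Rightarrow> 'k rep \<Rightarrow> 'k rep \<Rightarrow> 'k mat \<Rightarrow> 'k mat \<Rightarrow> 'k mat \<Rightarrow> 'k mat \<Rightarrow> bool" where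
  "is_biproduct A B M i j p q \<longleftrightarrow>
     i \<in> D4_hom A M \<and> j \<in> D4_hom B M \<and> p \<in> D4_hom M A \<and> q \<in> D4_hom M B \<and>
     p * i = 1\<^sub>m (rdim A) \<and> q * j = 1\<^sub>m (rdim B) \<and>
     p * j = 0\<^sub>m (rdim A) (rdim B) \<and> q * i = 0\<^sub>m (rdim B) (rdim A) \<and>
     i * p + j * q = 1\<^sub>m (rdim M)"

lemma is_biproductD:
  assumes "is_biproduct A B M i j p q"
  shows "i \<in> D4_hom A M" "j \<in> D4_hom B M" "p \<in> D4_hom M A" "q \<in> D4_hom M B"
    "p * i = 1\<^sub>m (rdim A)" "q * j = 1\<^sub>m (rdim B)"
    "p * j = 0\<^sub>m (rdim A) (rdim B)" "q * i = 0\<^sub>m (rdim B) (rdim A)"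
    "i * p + j * q = 1\<^sub>m (rdim M)"
  using assms unfolding is_biproduct_def by blast+

text \<open>The row-times-column rule for maps through a biproduct: the components
  \<open>q * i\<close> and \<open>p * j\<close> vanish. With the maps of a second biproduct as
  primed data it gives the comparison isomorphism in \<open>is_biproduct_iso\<close>.\<close>

lemma is_biproduct_mult:
  assumes bp: "is_biproduct A B M i j p q"
    and c': "i' \<in> carrier_mat n (rdim A)" "j' \<in> carrier_mat n (rdim B)"
      "p' \<in> carrier_mat (rdim A) k" "q' \<in> carrier_mat (rdim B) k"
  shows "(i' * p + j' * q) * (i * p' + j * q') = i' * p' + j' * q'"
proof -
  note b = is_biproductD [OF bp]
  note c = b(1-4) [THEN D4_homD(1)]
  have "(i' * p + j' * q) * (i * p' + j * q')
      = i' * (p * i) * p' + j' * (q * i) * p' + (i' * (p * j) * q' + j' * (q * j) * q')"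
    using c c' by (simp add: add_mult_distrib_mat [of _ n "rdim M" _ _ k] mult_add_distrib_mat [of _ n "rdim M" _ k]
      mult_mat_middle [of _ n _ _ "rdim M" _ _ _ k])
  then show ?thesis using c' b(5-8) by (simp add: left_mult_zero_mat [of _ _ k] right_mult_zero_mat [of _ n])
qed

lemma is_biproduct_iso:
  assumes M: "is_biproduct A B M i j p q" and N: "is_biproduct A B N i' j' p' q'"
    and mods: "D4_module A" "D4_module B" "D4_module M" "D4_module N"
  shows "D4_iso M N"
proof (rule D4_isoI [of "i' * p + j' * q" _ _ "i * p' + j * q'"])
  note m = is_biproductD [OF M] and n = is_biproductD [OF N]
  note mc = m(1-4) [THEN D4_homD(1)] and nc = n(1-4) [THEN D4_homD(1)]
  show "i' * p + j' * q \<in> D4_hom M N"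
    using D4_hom_comp [OF m(3) n(1) mods(3,1,4)] D4_hom_comp [OF m(4) n(2) mods(3,2,4)] mods
    by (intro D4_hom_add)
  show "i * p' + j * q' \<in> carrier_mat (rdim M) (rdim N)" using mc nc by auto
  show "(i * p' + j * q') * (i' * p + j' * q) = 1\<^sub>m (rdim M)"
    using is_biproduct_mult [OF N mc] m(9) by simp
  show "(i' * p + j' * q) * (i * p' + j * q') = 1\<^sub>m (rdim N)"
    using is_biproduct_mult [OF M nc] n(9) by simp
qed

text \<open>Tensoring with \<open>L\<close> is an additive functor, so the equations of a biproduct
  are carried to equations of the same shape. Distributivity then follows without block matrices of
  Kronecker products.\<close>

lemma is_biproduct_tensor_left:
  assumes bp: "is_biproduct A B M i j p q"
    and mods: "D4_module L" "D4_module A" "D4_module B" "D4_module M"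
  shows "is_biproduct (tensor_rep L A) (tensor_rep L B) (tensor_rep L M)
    (kronecker (1\<^sub>m (rdim L)) i) (kronecker (1\<^sub>m (rdim L)) j) (kronecker (1\<^sub>m (rdim L)) p) (kronecker (1\<^sub>m (rdim L)) q)"
proof -
  note b = is_biproductD [OF bp]
  note c = b(1-4) [THEN D4_homD(1)]
  note h = D4_hom_one [OF mods(1)] and l = one_carrier_mat [of "rdim L"]
  note mm = mult_carrier_mat [OF c(1,3)] mult_carrier_mat [OF c(2,4)]
  show ?thesis
    unfolding is_biproduct_def
    using kronecker_hom [OF h b(1)] kronecker_hom [OF h b(2)] kronecker_hom [OF h b(3)] kronecker_hom [OF h b(4)] mods
      kronecker_mult [OF l l c(3,1)] kronecker_mult [OF l l c(4,2)] kronecker_mult [OF l l c(3,2)] kronecker_mult [OF l l c(4,1)]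
      kronecker_mult [OF l l c(1,3)] kronecker_mult [OF l l c(2,4)] b(5-8)
      kronecker_add_right [OF l mm] b(9)
    by simp
qed

lemma is_biproduct_tensor_right:
  assumes bp: "is_biproduct A B M i j p q"
    and mods: "D4_module L" "D4_module A" "D4_module B" "D4_module M"
  shows "is_biproduct (tensor_rep A L) (tensor_rep B L) (tensor_rep M L)
    (kronecker i (1\<^sub>m (rdim L))) (kronecker j (1\<^sub>m (rdim L))) (kronecker p (1\<^sub>m (rdim L))) (kronecker q (1\<^sub>m (rdim L)))"
proof -
  note b = is_biproductD [OF bp]
  note c = b(1-4) [THEN D4_homD(1)]
  note h = D4_hom_one [OF mods(1)] and l = one_carrier_mat [of "rdim L"]
  note mm = mult_carrier_mat [OF c(1,3)] mult_carrier_mat [OF c(2,4)]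
  show ?thesis
    unfolding is_biproduct_def
    using kronecker_hom [OF b(1) h] kronecker_hom [OF b(2) h] kronecker_hom [OF b(3) h] kronecker_hom [OF b(4) h] mods
      kronecker_mult [OF c(3,1) l l] kronecker_mult [OF c(4,2) l l] kronecker_mult [OF c(3,2) l l] kronecker_mult [OF c(4,1) l l]
      kronecker_mult [OF c(1,3) l l] kronecker_mult [OF c(2,4) l l] b(5-8)
      kronecker_add_left [OF mm l] b(9)
    by simp
qed

lemma rdim_direct_sum_rep [simp]: "rdim (direct_sum_rep M N) = rdim M + rdim N"
  and act_direct_sum_rep: "act (direct_sum_rep M N) s =
    four_block_mat (act M s) (0\<^sub>m (rdim M) (rdim N)) (0\<^sub>m (rdim N) (rdim M)) (act N s)"
  by (simp_all add: direct_sum_rep_def)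

lemma D4_module_direct_sum [simp]:
  assumes M: "D4_module M" and N: "D4_module N"
  shows "D4_module (direct_sum_rep M N)"
proof -
  let ?m = "rdim M" and ?n = "rdim N"
  note m = D4_moduleD [OF M] and n = D4_moduleD [OF N]
  note ac = act_carrier [OF M] act_carrier [OF N]
  define diag :: "'a mat \<Rightarrow> 'a mat \<Rightarrow> 'a mat" where
    "diag A B = four_block_mat A (0\<^sub>m ?m ?n) (0\<^sub>m ?n ?m) B" for A B
  have mult: "diag A B * diag C D = diag (A * C) (B * D)"
    if "A \<in> carrier_mat ?m ?m" "B \<in> carrier_mat ?n ?n" "C \<in> carrier_mat ?m ?m" "D \<in> carrier_mat ?n ?n" for A B C D
    unfolding diag_def using that
    by (subst mult_four_block_mat [of _ ?m ?m _ ?n _ ?n _ _ ?m _ ?n]) auto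
  have add: "diag A B + diag C D = diag (A + C) (B + D)"
    if "A \<in> carrier_mat ?m ?m" "B \<in> carrier_mat ?n ?n" "C \<in> carrier_mat ?m ?m" "D \<in> carrier_mat ?n ?n" for A B C D
    unfolding diag_def using that
    by (subst add_four_block_mat [of _ ?m ?m _ ?n _ ?n]) auto
  have neg: "- diag A B = diag (- A) (- B)"
    if "A \<in> carrier_mat ?m ?m" "B \<in> carrier_mat ?n ?n" for A B
    unfolding diag_def using that by (intro eq_matI) auto
  have minus: "diag A B - diag C D = diag (A - C) (B - D)"
    if "A \<in> carrier_mat ?m ?m" "B \<in> carrier_mat ?n ?n" "C \<in> carrier_mat ?m ?m" "D \<in> carrier_mat ?n ?n" for A B C D
    unfolding diag_def using that by (intro eq_matI) auto
  have one: "1\<^sub>m (?m + ?n) = diag (1\<^sub>m ?m) (1\<^sub>m ?n)" and zero: "0\<^sub>m (?m + ?n) (?m + ?n) = diag (0\<^sub>m ?m ?m) (0\<^sub>m ?n ?n)"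
    unfolding diag_def by auto
  have carrier: "diag A B \<in> carrier_mat (?m + ?n) (?m + ?n)"
    if "A \<in> carrier_mat ?m ?m" "B \<in> carrier_mat ?n ?n" for A B
    unfolding diag_def using that by auto
  note S = mult add neg minus one zero carrier ac mult_carrier_mat [OF ac(1) ac(1)] mult_carrier_mat [OF ac(2) ac(2)]
  show ?thesis
    unfolding D4_module_def Let_def rdim_direct_sum_rep act_direct_sum_rep diag_def [symmetric]
    by (simp add: S m n)
qed

text \<open>Injections and projections are written as four-block matrices with an empty second block
  column or row, so that every product is an instance of block multiplication; \<open>pad\<close>
  drops the empty blocks.\<close>

lemma is_biproduct_direct_sum:
  assumes M: "D4_module M" and N: "D4_module N"
  obtains i j p q where "is_biproduct M N (direct_sum_rep M N) i j p q"
proof -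
  let ?m = "rdim M" and ?n = "rdim N"
  note ac = act_carrier [OF M] act_carrier [OF N]
  define i where "i = four_block_mat (1\<^sub>m ?m) (0\<^sub>m ?m 0) (0\<^sub>m ?n ?m) (0\<^sub>m ?n 0 :: 'a mat)"
  define j where "j = four_block_mat (0\<^sub>m ?m ?n) (0\<^sub>m ?m 0) (1\<^sub>m ?n) (0\<^sub>m ?n 0 :: 'a mat)"
  define p where "p = four_block_mat (1\<^sub>m ?m) (0\<^sub>m ?m ?n) (0\<^sub>m 0 ?m) (0\<^sub>m 0 ?n :: 'a mat)"
  define q where "q = four_block_mat (0\<^sub>m ?n ?m) (1\<^sub>m ?n) (0\<^sub>m 0 ?m) (0\<^sub>m 0 ?n :: 'a mat)"
  note defs = i_def j_def p_def q_def
  have pad: "four_block_mat A (0\<^sub>m k 0) (0\<^sub>m 0 l) (0\<^sub>m 0 0) = A" if "A \<in> carrier_mat k l" for A :: "'a mat" and k l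
    using that by (intro eq_matI) auto
  have c: "i \<in> carrier_mat (?m + ?n) ?m" "j \<in> carrier_mat (?m + ?n) ?n"
    "p \<in> carrier_mat ?m (?m + ?n)" "q \<in> carrier_mat ?n (?m + ?n)"
    by (auto simp: defs)
  have "is_biproduct M N (direct_sum_rep M N) i j p q"
    unfolding is_biproduct_def
  proof (intro conjI)
    show "i \<in> D4_hom M (direct_sum_rep M N)" "j \<in> D4_hom N (direct_sum_rep M N)"
      "p \<in> D4_hom (direct_sum_rep M N) M" "q \<in> D4_hom (direct_sum_rep M N) N"
    proof (rule_tac [!] D4_homI)
      fix s
      note a = ac [of s]
      have "i * four_block_mat (act M s) (0\<^sub>m ?m 0) (0\<^sub>m 0 ?m) (0\<^sub>m 0 0) = act (direct_sum_rep M N) s * i"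
        unfolding act_direct_sum_rep defs using a
        by (simp add: mult_four_block_mat [of _ ?m ?m _ ?n _ ?n _ _ ?m _ 0] mult_four_block_mat [of _ ?m ?m _ 0 _ ?n _ _ ?m _ 0])
      then show "i * act M s = act (direct_sum_rep M N) s * i" by (simp only: pad [OF a(1)])
      have "j * four_block_mat (act N s) (0\<^sub>m ?n 0) (0\<^sub>m 0 ?n) (0\<^sub>m 0 0) = act (direct_sum_rep M N) s * j"
        unfolding act_direct_sum_rep defs using a
        by (simp add: mult_four_block_mat [of _ ?m ?m _ ?n _ ?n _ _ ?n _ 0] mult_four_block_mat [of _ ?m ?n _ 0 _ ?n _ _ ?n _ 0])
      then show "j * act N s = act (direct_sum_rep M N) s * j" by (simp only: pad [OF a(2)])
      have "p * act (direct_sum_rep M N) s = four_block_mat (act M s) (0\<^sub>m ?m 0) (0\<^sub>m 0 ?m) (0\<^sub>m 0 0) * p"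
        unfolding act_direct_sum_rep defs using a
        by (simp add: mult_four_block_mat [of _ ?m ?m _ ?n _ 0 _ _ ?m _ ?n] mult_four_block_mat [of _ ?m ?m _ 0 _ 0 _ _ ?m _ ?n])
      then show "p * act (direct_sum_rep M N) s = act M s * p" by (simp only: pad [OF a(1)])
      have "q * act (direct_sum_rep M N) s = four_block_mat (act N s) (0\<^sub>m ?n 0) (0\<^sub>m 0 ?n) (0\<^sub>m 0 0) * q"
        unfolding act_direct_sum_rep defs using a
        by (simp add: mult_four_block_mat [of _ ?n ?m _ ?n _ 0 _ _ ?m _ ?n] mult_four_block_mat [of _ ?n ?n _ 0 _ 0 _ _ ?m _ ?n])
      then show "q * act (direct_sum_rep M N) s = act N s * q" by (simp only: pad [OF a(2)])
    qed (use c in auto)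
    show "p * i = 1\<^sub>m ?m" unfolding defs
      by (subst mult_four_block_mat [of _ ?m ?m _ ?n _ 0 _ _ ?m _ 0]) (auto simp: pad)
    show "q * j = 1\<^sub>m ?n" unfolding defs
      by (subst mult_four_block_mat [of _ ?n ?m _ ?n _ 0 _ _ ?n _ 0]) (auto simp: pad)
    show "p * j = 0\<^sub>m ?m ?n" unfolding defs
      by (subst mult_four_block_mat [of _ ?m ?m _ ?n _ 0 _ _ ?n _ 0]) (auto simp: pad)
    show "q * i = 0\<^sub>m ?n ?m" unfolding defs
      by (subst mult_four_block_mat [of _ ?n ?m _ ?n _ 0 _ _ ?m _ 0]) (auto simp: pad)
    have "i * p = four_block_mat (1\<^sub>m ?m) (0\<^sub>m ?m ?n) (0\<^sub>m ?n ?m) (0\<^sub>m ?n ?n)" unfolding defs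
      by (subst mult_four_block_mat [of _ ?m ?m _ 0 _ ?n _ _ ?m _ ?n]) auto
    moreover have "j * q = four_block_mat (0\<^sub>m ?m ?m) (0\<^sub>m ?m ?n) (0\<^sub>m ?n ?m) (1\<^sub>m ?n)" unfolding defs
      by (subst mult_four_block_mat [of _ ?m ?n _ 0 _ ?n _ _ ?m _ ?n]) auto
    ultimately show "i * p + j * q = 1\<^sub>m (rdim (direct_sum_rep M N))"
      by (simp add: add_four_block_mat [of _ ?m ?m _ ?n _ ?n])
  qed
  then show thesis by (rule that)
qed

lemma D4_iso_direct_sumI:
  assumes "is_biproduct A B M i j p q" "D4_module A" "D4_module B" "D4_module M"
  shows "D4_iso M (direct_sum_rep A B)"
  using is_biproduct_direct_sum [OF assms(2,3)] is_biproduct_iso [OF assms(1)] assms(2-4)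
  by (metis D4_module_direct_sum)

lemma D4_iso_tensor_direct_sum:
  assumes "D4_module L" "D4_module M" "D4_module N"
  shows "D4_iso (tensor_rep L (direct_sum_rep M N)) (direct_sum_rep (tensor_rep L M) (tensor_rep L N))"
    and "D4_iso (tensor_rep (direct_sum_rep M N) L) (direct_sum_rep (tensor_rep M L) (tensor_rep N L))"
proof -
  obtain i j p q where bp: "is_biproduct M N (direct_sum_rep M N) i j p q"
    using is_biproduct_direct_sum [OF assms(2,3)] .
  show "D4_iso (tensor_rep L (direct_sum_rep M N)) (direct_sum_rep (tensor_rep L M) (tensor_rep L N))"
    using is_biproduct_tensor_left [OF bp] assms by (intro D4_iso_direct_sumI) auto
  show "D4_iso (tensor_rep (direct_sum_rep M N) L) (direct_sum_rep (tensor_rep M L) (tensor_rep N L))"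
    using is_biproduct_tensor_right [OF bp] assms by (intro D4_iso_direct_sumI) auto
qed

section \<open>The Green ring\<close>

lemma D4_module_V1 [simp]: "D4_module (V1 r :: 'k :: field rep)"
proof -
  have "(- 1 :: 'k) ^ r * (- 1) ^ r = 1"
    by (simp flip: power_mult_distrib)
  then show ?thesis
    unfolding D4_module_def V1_def Let_def
    by (auto intro!: eq_matI simp: scalar_prod_def)
qed

lemma rdim_V1 [simp]: "rdim (V1 r) = 1"
  by (simp add: V1_def)

lemma act_V1:
  "act (V1 r) Gen_a = 0\<^sub>m 1 1" "act (V1 r) Gen_b = (- 1) ^ r \<cdot>\<^sub>m 1\<^sub>m 1"
  "act (V1 r) Gen_c = (- 1) ^ r \<cdot>\<^sub>m 1\<^sub>m 1" "act (V1 r) Gen_d = 0\<^sub>m 1 1"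
  by (simp_all add: V1_def)

lemma kronecker_one_one_left:
  fixes A :: "'k :: field mat"
  shows "kronecker (c \<cdot>\<^sub>m 1\<^sub>m (Suc 0)) A = c \<cdot>\<^sub>m A"
  by (intro eq_matI) (auto simp: index_kronecker)

lemma kronecker_one_one_right:
  fixes A :: "'k :: field mat"
  shows "kronecker A (c \<cdot>\<^sub>m 1\<^sub>m (Suc 0)) = c \<cdot>\<^sub>m A"
  by (intro eq_matI) (auto simp: index_kronecker)

lemma smult_one_mat [simp]: "(1 :: 'k :: field) \<cdot>\<^sub>m A = A"
  by (intro eq_matI) auto

lemma tensor_V1_left:
  assumes "D4_module M"
  shows "act (tensor_rep (V1 r) M) Gen_a = act M Gen_a" "act (tensor_rep (V1 r) M) Gen_d = act M Gen_d"
    "act (tensor_rep (V1 r) M) Gen_b = (- 1) ^ r \<cdot>\<^sub>m act M Gen_b"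
    "act (tensor_rep (V1 r) M) Gen_c = (- 1) ^ r \<cdot>\<^sub>m act M Gen_c"
proof -
  note ac = act_carrier [OF assms] and ac' = carrier_matD [OF act_carrier [OF assms]]
  have 1: "kronecker (1\<^sub>m (Suc 0)) A = A" for A :: "'a mat"
    using kronecker_one_one_left [of 1 A] by simp
  show "act (tensor_rep (V1 r) M) Gen_a = act M Gen_a" "act (tensor_rep (V1 r) M) Gen_d = act M Gen_d"
    "act (tensor_rep (V1 r) M) Gen_b = (- 1) ^ r \<cdot>\<^sub>m act M Gen_b"
    "act (tensor_rep (V1 r) M) Gen_c = (- 1) ^ r \<cdot>\<^sub>m act M Gen_c"
    using ac by (simp_all add: act_V1 ac' kronecker_one_one_left 1 left_add_zero_mat [OF ac])
qed

lemma tensor_V1_right: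
  assumes "D4_module M"
  shows "act (tensor_rep M (V1 r)) s = (- 1) ^ r \<cdot>\<^sub>m act M s"
proof -
  note ac = act_carrier [OF assms] and ac' = carrier_matD [OF act_carrier [OF assms]]
  note z = right_add_zero_mat [OF smult_carrier_mat [OF ac]]
  show ?thesis
    by (cases s) (simp_all add: act_V1 ac' kronecker_one_one_right z)
qed

lemma tensor_V1_0 [simp]:
  assumes "D4_module M"
  shows "tensor_rep (V1 0) M = M" "tensor_rep M (V1 0) = M"
proof -
  show "tensor_rep (V1 0) M = M"
  proof (rule rep_eqI)
    fix s show "act (tensor_rep (V1 0) M) s = act M s"
      by (cases s) (simp_all add: tensor_V1_left [OF assms, of 0] del: act_tensor_rep)
  qed simp
  show "tensor_rep M (V1 0) = M"
    by (rule rep_eqI) (simp_all add: tensor_V1_right [OF assms] del: act_tensor_rep)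
qed

lemma iso_class_in [simp]: "D4_module M \<Longrightarrow> iso_class M \<in> iso_classes"
  by (auto simp: iso_classes_def)

lemma iso_classesE:
  assumes "U \<in> iso_classes"
  obtains M where "D4_module M" "U = iso_class M"
  using assms by (auto simp: iso_classes_def)

text \<open>All representatives in the union that defines \<open>tensor_class\<close> give one and
  the same class, since tensoring respects isomorphism in both factors.\<close>

lemma tensor_class_iso_class [simp]:
  assumes "D4_module M" "D4_module N"
  shows "tensor_class (iso_class M) (iso_class N) = iso_class (tensor_rep M N)"
proof -
  have "iso_class (tensor_rep M' N') = iso_class (tensor_rep M N)"
    if "M' \<in> iso_class M" "N' \<in> iso_class N" for M' N'
  proof -
    have "D4_module M'" "D4_module N'" "D4_iso M M'" "D4_iso N N'"
      using that by (auto simp: iso_class_def)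
    then show ?thesis
      using assms D4_iso_sym [OF D4_iso_tensor [of M M' N N']] by (subst iso_class_eq_iff) auto
  qed
  moreover have "M \<in> iso_class M" "N \<in> iso_class N" using assms by (auto simp: iso_class_def)
  ultimately show ?thesis unfolding tensor_class_def by blast
qed

lemma tensor_class_closed [simp]:
  "U \<in> iso_classes \<Longrightarrow> W \<in> iso_classes \<Longrightarrow> tensor_class U W \<in> iso_classes"
  by (elim iso_classesE) simp

lemma tensor_class_assoc:
  "U \<in> iso_classes \<Longrightarrow> W \<in> iso_classes \<Longrightarrow> Z \<in> iso_classes \<Longrightarrow>
    tensor_class (tensor_class U W) Z = tensor_class U (tensor_class W Z)"
  by (elim iso_classesE) (simp add: tensor_rep_assoc)

lemma tensor_class_unit [simp]:
  assumes "U \<in> iso_classes"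
  shows "tensor_class (iso_class (V1 0)) U = U" "tensor_class U (iso_class (V1 0)) = U"
  using assms by (auto elim!: iso_classesE)

text \<open>Isomorphism classes form a monoid before any linear extension; its powers serve to
  evaluate monomials.\<close>

definition class_monoid :: "'k :: field rep set monoid" where
  "class_monoid = \<lparr>carrier = iso_classes, monoid.mult = tensor_class, one = iso_class (V1 0)\<rparr>"

lemma class_monoid_simps [simp]:
  "carrier class_monoid = iso_classes" "monoid.mult class_monoid = tensor_class"
  "one class_monoid = iso_class (V1 0)"
  by (simp_all add: class_monoid_def)

lemma monoid_class_monoid: "monoid class_monoid"
  by unfold_locales (auto simp: tensor_class_assoc elim!: iso_classesE)

lemma frag_extend_fun_diff:
  "frag_extend (\<lambda>x. f x - g x) c = frag_extend f c - frag_extend g c"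
  using subset_UNIV
  by (induction c rule: frag_induction) (auto simp: frag_extend_diff)

lemma frag_extend_fun_0 [simp]: "frag_extend (\<lambda>x. 0) c = 0"
  by (rule frag_extend_eq_0) simp

lemma free_class_ring_simps [simp]:
  "carrier free_class_ring = {p. Poly_Mapping.keys p \<subseteq> iso_classes}"
  "one free_class_ring = frag_of (iso_class (V1 0))"
  "ring.zero free_class_ring = 0"
  "add free_class_ring p q = p + q"
  by (auto simp: free_class_ring_def)

lemma free_class_mult_frag_of [simp]:
  "frag_of U \<otimes>\<^bsub>free_class_ring\<^esub> frag_of W = frag_of (tensor_class U W)"
  by (simp add: free_class_ring_def)

lemma free_class_mult_diff_left:
  "(p - p') \<otimes>\<^bsub>free_class_ring\<^esub> q = (p \<otimes>\<^bsub>free_class_ring\<^esub> q) - (p' \<otimes>\<^bsub>free_class_ring\<^esub> q)"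
  by (simp add: free_class_ring_def frag_extend_diff)

lemma free_class_mult_diff_right:
  "p \<otimes>\<^bsub>free_class_ring\<^esub> (q - q') = (p \<otimes>\<^bsub>free_class_ring\<^esub> q) - (p \<otimes>\<^bsub>free_class_ring\<^esub> q')"
  by (simp add: free_class_ring_def frag_extend_diff frag_extend_fun_diff)

lemma free_class_mult_0 [simp]:
  "0 \<otimes>\<^bsub>free_class_ring\<^esub> q = 0" "p \<otimes>\<^bsub>free_class_ring\<^esub> 0 = 0"
  by (simp_all add: free_class_ring_def)

lemma free_class_mult_add_left:
  "(p + p') \<otimes>\<^bsub>free_class_ring\<^esub> q = (p \<otimes>\<^bsub>free_class_ring\<^esub> q) + (p' \<otimes>\<^bsub>free_class_ring\<^esub> q)"
  using free_class_mult_diff_left [of p "0 - p'" q] free_class_mult_diff_left [of 0 p' q] by simp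

lemma free_class_mult_add_right:
  "p \<otimes>\<^bsub>free_class_ring\<^esub> (q + q') = (p \<otimes>\<^bsub>free_class_ring\<^esub> q) + (p \<otimes>\<^bsub>free_class_ring\<^esub> q')"
  using free_class_mult_diff_right [of p q "0 - q'"] free_class_mult_diff_right [of p 0 q'] by simp

lemma free_class_mult_closed:
  assumes "Poly_Mapping.keys p \<subseteq> iso_classes" "Poly_Mapping.keys q \<subseteq> iso_classes"
  shows "Poly_Mapping.keys (p \<otimes>\<^bsub>free_class_ring\<^esub> q) \<subseteq> iso_classes"
  using assms(1)
proof (induction p rule: frag_induction)
  case (one U)
  show ?case
    using assms(2)
  proof (induction q rule: frag_induction)
    case (diff q q')
    then show ?case using keys_diff by (fastforce simp: free_class_mult_diff_right)
  qed (use \<open>U \<in> iso_classes\<close> in auto)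
next
  case (diff p p')
  then show ?case using keys_diff by (fastforce simp: free_class_mult_diff_left)
qed auto

lemma free_class_mult_assoc:
  assumes "Poly_Mapping.keys p \<subseteq> iso_classes" "Poly_Mapping.keys q \<subseteq> iso_classes" "Poly_Mapping.keys r \<subseteq> iso_classes"
  shows "(p \<otimes>\<^bsub>free_class_ring\<^esub> q) \<otimes>\<^bsub>free_class_ring\<^esub> r = p \<otimes>\<^bsub>free_class_ring\<^esub> (q \<otimes>\<^bsub>free_class_ring\<^esub> r)"
  using assms(1)
proof (induction p rule: frag_induction)
  case (one U)
  show ?case using assms(2)
  proof (induction q rule: frag_induction)
    case (one W)
    show ?case using assms(3)
    proof (induction r rule: frag_induction)
      case (one Z)
      then show ?case using \<open>U \<in> iso_classes\<close> \<open>W \<in> iso_classes\<close> by (simp add: tensor_class_assoc)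
    qed (simp_all add: free_class_mult_diff_right)
  qed (simp_all add: free_class_mult_diff_left free_class_mult_diff_right)
qed (simp_all add: free_class_mult_diff_left)

lemma free_class_mult_one:
  assumes "Poly_Mapping.keys p \<subseteq> iso_classes"
  shows "frag_of (iso_class (V1 0)) \<otimes>\<^bsub>free_class_ring\<^esub> p = p" "p \<otimes>\<^bsub>free_class_ring\<^esub> frag_of (iso_class (V1 0)) = p"
  using assms
  by (induction p rule: frag_induction)
    (auto simp: free_class_mult_diff_left free_class_mult_diff_right elim!: iso_classesE)

lemma ring_free_class_ring: "ring (free_class_ring :: ('k :: field rep set \<Rightarrow>\<^sub>0 int) ring)"
proof (rule ringI)
  show "abelian_group (free_class_ring :: ('k rep set \<Rightarrow>\<^sub>0 int) ring)"
  proof (rule abelian_groupI)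
    fix p :: "'k rep set \<Rightarrow>\<^sub>0 int" assume "p \<in> carrier free_class_ring"
    then show "\<exists>q \<in> carrier free_class_ring. q \<oplus>\<^bsub>free_class_ring\<^esub> p = \<zero>\<^bsub>free_class_ring\<^esub>"
      by (intro bexI [of _ "- p"]) (auto simp: keys_minus)
  qed (use keys_add in \<open>fastforce simp: add_ac\<close>)+
  show "Group.monoid (free_class_ring :: ('k rep set \<Rightarrow>\<^sub>0 int) ring)"
    by (rule monoidI) (simp_all add: free_class_mult_closed free_class_mult_assoc free_class_mult_one)
qed (simp_all add: free_class_mult_add_left free_class_mult_add_right)

abbreviation split_relation :: "'k :: field rep \<Rightarrow> 'k rep \<Rightarrow> ('k rep set \<Rightarrow>\<^sub>0 int)" where
  "split_relation M N \<equiv> frag_of (iso_class (direct_sum_rep M N)) - (frag_of (iso_class M) + frag_of (iso_class N))"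

lemma split_relations_subgroup: "subgroup split_relations (free_Abelian_group iso_classes)"
proof -
  have "Poly_Mapping.keys (split_relation M N) \<subseteq> iso_classes" if "D4_module M" "D4_module N" for M N :: "'k :: field rep"
    using that by (auto dest!: subsetD [OF keys_diff] subsetD [OF keys_add])
  then show ?thesis
    unfolding split_relations_def
    by (intro group.generate_is_subgroup group_free_Abelian_group) fastforce
qed

lemma split_relations_keys: "p \<in> split_relations \<Longrightarrow> Poly_Mapping.keys p \<subseteq> iso_classes"
  using subsetD [OF subgroup.subset [OF split_relations_subgroup]] by simp

lemma split_relations_0 [simp]: "0 \<in> split_relations"
  using subgroup.one_closed [OF split_relations_subgroup] by simp

lemma split_relations_add: "p \<in> split_relations \<Longrightarrow> q \<in> split_relations \<Longrightarrow> p + q \<in> split_relations"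
  using subgroup.m_closed [OF split_relations_subgroup] by simp

lemma split_relations_uminus: "p \<in> split_relations \<Longrightarrow> - p \<in> split_relations"
  using subgroup.m_inv_closed [OF split_relations_subgroup] split_relations_keys by fastforce

lemma split_relations_diff: "p \<in> split_relations \<Longrightarrow> q \<in> split_relations \<Longrightarrow> p - q \<in> split_relations"
  using split_relations_add [OF _ split_relations_uminus, of p q] by simp

lemma split_relation_in: "D4_module M \<Longrightarrow> D4_module N \<Longrightarrow> split_relation M N \<in> split_relations"
  unfolding split_relations_def by (rule generate.incl) auto

text \<open>Sums and inverses are both expressible by differences, so a property stable under
  differences has to be checked only at zero and on the generating relations.\<close>

lemma split_relations_induct [consumes 1, case_names zero relation diff]:
  fixes p :: "'k :: field rep set \<Rightarrow>\<^sub>0 int"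
  assumes "p \<in> split_relations" and P0: "P 0"
    and rel: "\<And>M N. D4_module M \<Longrightarrow> D4_module N \<Longrightarrow> P (split_relation M N)"
    and diff: "\<And>p q. P p \<Longrightarrow> P q \<Longrightarrow> P (p - q)"
  shows "P p"
  using assms(1) unfolding split_relations_def
proof (induction rule: generate.induct)
  case (inv h)
  then have "Poly_Mapping.keys h \<subseteq> iso_classes" "P h"
    using split_relation_in split_relations_keys rel by blast+
  then show ?case using diff [OF P0, of h] by simp
next
  case (eng h1 h2)
  then show ?case using diff [OF eng.IH(1) diff [OF P0 eng.IH(2)]] by simp
qed (use P0 rel in auto)

lemma split_relation_mult:
  assumes "D4_module L" "D4_module M" "D4_module N"
  shows "split_relation M N \<otimes>\<^bsub>free_class_ring\<^esub> frag_of (iso_class L)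
      = split_relation (tensor_rep M L) (tensor_rep N L)"
    and "frag_of (iso_class L) \<otimes>\<^bsub>free_class_ring\<^esub> split_relation M N
      = split_relation (tensor_rep L M) (tensor_rep L N)"
  using assms D4_iso_tensor_direct_sum [OF assms]
    iso_class_eq_iff [of "tensor_rep (direct_sum_rep M N) L" "direct_sum_rep (tensor_rep M L) (tensor_rep N L)"]
    iso_class_eq_iff [of "tensor_rep L (direct_sum_rep M N)" "direct_sum_rep (tensor_rep L M) (tensor_rep L N)"]
  by (simp_all add: free_class_mult_diff_left free_class_mult_diff_right free_class_mult_add_left free_class_mult_add_right)

text \<open>By bilinearity it suffices to multiply one relation by one class, where distributivity
  of the tensor product turns it into another relation. This is what makes the quotient a
  ring.\<close>

lemma split_relations_mult:
  assumes "p \<in> split_relations" "Poly_Mapping.keys q \<subseteq> iso_classes"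
  shows "p \<otimes>\<^bsub>free_class_ring\<^esub> q \<in> split_relations" "q \<otimes>\<^bsub>free_class_ring\<^esub> p \<in> split_relations"
proof -
  have "(p \<otimes>\<^bsub>free_class_ring\<^esub> q) \<in> split_relations \<and> (q \<otimes>\<^bsub>free_class_ring\<^esub> p) \<in> split_relations"
    using assms(2)
  proof (induction q rule: frag_induction)
    case (one U)
    then obtain L where L: "D4_module L" "U = iso_class L" by (rule iso_classesE)
    show ?case
      using assms(1)
    proof (induction p rule: split_relations_induct)
      case (relation M N)
      then show ?case
        using L split_relation_mult [OF L(1) relation] by (simp add: split_relation_in)
    qed (simp_all add: free_class_mult_diff_left free_class_mult_diff_right split_relations_diff)
  qed (simp_all add: free_class_mult_diff_left free_class_mult_diff_right split_relations_diff)
  then show "p \<otimes>\<^bsub>free_class_ring\<^esub> q \<in> split_relations" "q \<otimes>\<^bsub>free_class_ring\<^esub> p \<in> split_relations" by auto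
qed

lemma a_inv_free_class_ring:
  assumes "Poly_Mapping.keys p \<subseteq> iso_classes"
  shows "\<ominus>\<^bsub>free_class_ring\<^esub> p = - p"
proof -
  interpret ring "free_class_ring :: ('a rep set \<Rightarrow>\<^sub>0 int) ring" by (rule ring_free_class_ring)
  show ?thesis using assms minus_equality [of "- p" p] by (simp add: keys_minus)
qed

lemma ideal_split_relations: "ideal split_relations (free_class_ring :: ('k :: field rep set \<Rightarrow>\<^sub>0 int) ring)"
proof (rule idealI [OF ring_free_class_ring])
  interpret ring "free_class_ring :: ('k rep set \<Rightarrow>\<^sub>0 int) ring" by (rule ring_free_class_ring)
  show "subgroup split_relations (add_monoid (free_class_ring :: ('k rep set \<Rightarrow>\<^sub>0 int) ring))"
  proof (rule group.subgroupI)
    show "Group.group (add_monoid (free_class_ring :: ('k rep set \<Rightarrow>\<^sub>0 int) ring))" by (rule a_group)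
    fix p :: "'k rep set \<Rightarrow>\<^sub>0 int" assume p: "p \<in> split_relations"
    show "inv\<^bsub>add_monoid free_class_ring\<^esub> p \<in> split_relations"
      using p split_relations_uminus a_inv_free_class_ring [OF split_relations_keys [OF p]]
      by (simp add: a_inv_def)
  next
    show "split_relations \<noteq> ({} :: ('k rep set \<Rightarrow>\<^sub>0 int) set)" using split_relations_0 by blast
  qed (use split_relations_keys in \<open>auto intro: split_relations_add\<close>)
qed (simp_all add: split_relations_mult)

lemma ring_green_ring: "ring (green_ring :: ('k :: field rep set \<Rightarrow>\<^sub>0 int) set ring)"
  unfolding green_ring_def by (rule ideal.quotient_is_ring [OF ideal_split_relations])

lemma split_coset_eq_zero_iff:
  assumes "Poly_Mapping.keys p \<subseteq> iso_classes"
  shows "split_relations +>\<^bsub>free_class_ring\<^esub> p = \<zero>\<^bsub>green_ring\<^esub> \<longleftrightarrow> p \<in> split_relations"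
proof -
  interpret ideal split_relations "free_class_ring :: ('a rep set \<Rightarrow>\<^sub>0 int) ring" by (rule ideal_split_relations)
  show ?thesis
    using assms a_coset_join1 a_coset_join2 a_subgroup
    by (auto simp: green_ring_def FactRing_def)
qed

text \<open>Every monomial is a product of variables, so differences and multiplication by a single
  variable reach all polynomials. Later inductions treat each variable by its own relation.\<close>

lemma int_poly4_induct [case_names zero one diff mult]:
  fixes p :: int_poly4
  assumes "P 0" "P 1" and diff: "\<And>p q. P p \<Longrightarrow> P q \<Longrightarrow> P (p - q)" and mult: "\<And>i p. P p \<Longrightarrow> P (pvar i * p)"
  shows "P p"
  using subset_UNIV
proof (induction p rule: frag_induction)
  case (one m)
  have pow: "pvar i ^ n = Poly_Mapping.single (Poly_Mapping.single i n) 1" for i n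
    by (induction n) (simp_all add: pvar_def mult_single flip: single_add)
  have mult_pow: "P (pvar i ^ n * q)" if "P q" for i n q
    by (induction n) (simp_all add: that mult mult.assoc)
  have "m = Poly_Mapping.single Var_g (Poly_Mapping.lookup m Var_g) + (Poly_Mapping.single Var_x (Poly_Mapping.lookup m Var_x)
      + (Poly_Mapping.single Var_y (Poly_Mapping.lookup m Var_y) + Poly_Mapping.single Var_z (Poly_Mapping.lookup m Var_z)))" (is "_ = ?m")
  proof (rule poly_mapping_eqI)
    fix i show "Poly_Mapping.lookup m i = Poly_Mapping.lookup ?m i"
      by (cases i) (simp_all add: lookup_add lookup_single)
  qed
  then have "frag_of m = g1 ^ Poly_Mapping.lookup m Var_g * (x1 ^ Poly_Mapping.lookup m Var_x
      * (y1 ^ Poly_Mapping.lookup m Var_y * (z1 ^ Poly_Mapping.lookup m Var_z * 1)))"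
    by (simp add: pow mult_single)
  then show ?case
    using mult_pow [OF mult_pow [OF mult_pow [OF mult_pow [OF assms(2)]]]] by metis
qed (use assms in auto)

lemma ring_int_poly4_ring: "ring int_poly4_ring"
  unfolding int_poly4_ring_def by (rule ring_from_type_algebra)

lemma int_poly4_ring_simps [simp]:
  "carrier int_poly4_ring = UNIV" "monoid.mult int_poly4_ring = (*)" "add int_poly4_ring = (+)"
  "one int_poly4_ring = 1" "ring.zero int_poly4_ring = 0"
  by (simp_all add: int_poly4_ring_def ring_of_type_algebra_def)

section \<open>Evaluation of polynomials at four commuting classes\<close>

locale commuting_classes =
  fixes c :: "poly_var \<Rightarrow> 'k :: field rep set"
  assumes c_closed [simp]: "c i \<in> iso_classes"
    and c_comm: "tensor_class (c i) (c j) = tensor_class (c j) (c i)"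
begin

sublocale C: Group.monoid "class_monoid :: 'k rep set monoid"
  by (rule monoid_class_monoid)

text \<open>A fixed order of the factors turns an exponent vector into a definite word in the monoid
  of classes; \<open>mon_add\<close> then has to merge two such words.\<close>

definition mon :: "(poly_var \<Rightarrow>\<^sub>0 nat) \<Rightarrow> 'k rep set" where
  "mon m = (let e = (\<lambda>i. c i [^]\<^bsub>class_monoid\<^esub> Poly_Mapping.lookup m i) in
    tensor_class (e Var_g) (tensor_class (e Var_x) (tensor_class (e Var_y) (e Var_z))))"

lemma pow_comm:
  "tensor_class (c i [^]\<^bsub>class_monoid\<^esub> (m :: nat)) (c j [^]\<^bsub>class_monoid\<^esub> (n :: nat))
    = tensor_class (c j [^]\<^bsub>class_monoid\<^esub> n) (c i [^]\<^bsub>class_monoid\<^esub> m)"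
proof -
  have comm_pow: "tensor_class U (W [^]\<^bsub>class_monoid\<^esub> (k :: nat)) = tensor_class (W [^]\<^bsub>class_monoid\<^esub> k) U"
    if U: "U \<in> iso_classes" and W: "W \<in> iso_classes" and UW: "tensor_class U W = tensor_class W U"
    for U W :: "'k rep set" and k
  proof (induction k)
    case (Suc k)
    let ?P = "W [^]\<^bsub>class_monoid\<^esub> k"
    have P: "?P \<in> iso_classes" using C.nat_pow_closed [of W k] W by simp
    have "tensor_class U (tensor_class ?P W) = tensor_class (tensor_class ?P U) W"
      using tensor_class_assoc [OF U P W] Suc by simp
    also have "\<dots> = tensor_class (tensor_class ?P W) U"
      using tensor_class_assoc [OF P U W] tensor_class_assoc [OF P W U] UW by simp
    finally show ?case by simp
  qed (use U in simp)
  have "c i [^]\<^bsub>class_monoid\<^esub> m \<in> iso_classes" using C.nat_pow_closed [of "c i" m] by simp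
  then show ?thesis
    by (intro comm_pow) (simp_all add: comm_pow [symmetric] c_comm)
qed

lemma pow_closed [simp]: "c i [^]\<^bsub>class_monoid\<^esub> (n :: nat) \<in> iso_classes"
  using C.nat_pow_closed [of "c i" n] by simp

lemma mon_closed [simp]: "mon m \<in> iso_classes"
  by (simp add: mon_def)

lemma mon_0: "mon 0 = iso_class (V1 0)"
  by (simp add: mon_def)

lemma mon_single: "mon (Poly_Mapping.single i 1) = c i"
  by (cases i) (simp_all add: mon_def lookup_single)

lemma mon_add: "mon (m + m') = tensor_class (mon m) (mon m')"
proof -
  define e where "e = (\<lambda>i. c i [^]\<^bsub>class_monoid\<^esub> Poly_Mapping.lookup m i)"
  define e' where "e' = (\<lambda>i. c i [^]\<^bsub>class_monoid\<^esub> Poly_Mapping.lookup m' i)"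
  have [simp]: "e i \<in> iso_classes" "e' i \<in> iso_classes" for i by (simp_all add: e_def e'_def)
  have comm: "tensor_class (e i) (e' j) = tensor_class (e' j) (e i)" for i j
    unfolding e_def e'_def by (rule pow_comm)
  have comm_mult: "tensor_class (tensor_class U W) Z = tensor_class Z (tensor_class U W)"
    if U: "U \<in> iso_classes" and W: "W \<in> iso_classes" and Z: "Z \<in> iso_classes"
      and "tensor_class U Z = tensor_class Z U" "tensor_class W Z = tensor_class Z W" for U W Z :: "'k rep set"
    using that(4,5) tensor_class_assoc [OF U W Z] tensor_class_assoc [OF U Z W] tensor_class_assoc [OF Z U W] by simp
  \<comment> \<open>Exchange of the two middle factors. Applied at each of the three nesting levels
    of \<open>mon\<close>, it brings powers of equal variables together.\<close>
  have swap: "tensor_class (tensor_class U P) (tensor_class W Q) = tensor_class (tensor_class U W) (tensor_class P Q)"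
    if "U \<in> iso_classes" "P \<in> iso_classes" "W \<in> iso_classes" "Q \<in> iso_classes"
      and "tensor_class P W = tensor_class W P" for U P W Q :: "'k rep set"
  proof -
    have "tensor_class P (tensor_class W Q) = tensor_class W (tensor_class P Q)"
      using that by (simp flip: tensor_class_assoc)
    then show ?thesis using that(1-4) by (simp add: tensor_class_assoc)
  qed
  have pow_add: "c i [^]\<^bsub>class_monoid\<^esub> Poly_Mapping.lookup (m + m') i = tensor_class (e i) (e' i)" for i
    using C.nat_pow_mult [of "c i" "Poly_Mapping.lookup m i" "Poly_Mapping.lookup m' i"]
    by (simp add: e_def e'_def lookup_add)
  have "mon m = tensor_class (e Var_g) (tensor_class (e Var_x) (tensor_class (e Var_y) (e Var_z)))"
    "mon m' = tensor_class (e' Var_g) (tensor_class (e' Var_x) (tensor_class (e' Var_y) (e' Var_z)))"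
    by (simp_all add: mon_def e_def e'_def)
  moreover have "tensor_class (tensor_class (e i) (tensor_class (e j) (e k))) (e' l)
      = tensor_class (e' l) (tensor_class (e i) (tensor_class (e j) (e k)))"
    "tensor_class (tensor_class (e i) (e j)) (e' l) = tensor_class (e' l) (tensor_class (e i) (e j))" for i j k l
    by (intro comm_mult comm; simp)+
  ultimately show ?thesis
    unfolding mon_def [of "m + m'"] Let_def pow_add
    using swap [of "e Var_g" "tensor_class (e Var_x) (tensor_class (e Var_y) (e Var_z))" "e' Var_g"
        "tensor_class (e' Var_x) (tensor_class (e' Var_y) (e' Var_z))"]
      swap [of "e Var_x" "tensor_class (e Var_y) (e Var_z)" "e' Var_x" "tensor_class (e' Var_y) (e' Var_z)"]
      swap [of "e Var_y" "e Var_z" "e' Var_y" "e' Var_z"] comm [of Var_z Var_y]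
    by simp
qed

text \<open>Evaluation takes place in the free group on classes, before passing to the quotient, so
  that additive functionals can be applied directly to its values.\<close>

definition poly_class :: "int_poly4 \<Rightarrow> ('k rep set \<Rightarrow>\<^sub>0 int)" where
  "poly_class p = frag_extend (\<lambda>m. frag_of (mon m)) p"

lemma poly_class_keys: "Poly_Mapping.keys (poly_class p) \<subseteq> iso_classes"
  unfolding poly_class_def using subset_UNIV
  by (induction p rule: frag_induction) (use keys_diff in \<open>fastforce simp: frag_extend_diff\<close>)+

lemma poly_class_simps:
  "poly_class 0 = 0" "poly_class 1 = frag_of (iso_class (V1 0))" "poly_class (pvar i) = frag_of (c i)"
  "poly_class (p + q) = poly_class p + poly_class q" "poly_class (p - q) = poly_class p - poly_class q"
  "poly_class (- p) = - poly_class p"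
  by (simp_all add: poly_class_def frag_extend_add frag_extend_diff frag_extend_minus pvar_def mon_single [unfolded One_nat_def]
      mon_0 flip: single_one)

lemma poly_class_mult: "poly_class (p * q) = poly_class p \<otimes>\<^bsub>free_class_ring\<^esub> poly_class q"
  using subset_UNIV
proof (induction p rule: frag_induction)
  case (one m)
  show ?case
    using subset_UNIV
  proof (induction q rule: frag_induction)
    case (one m')
    then show ?case by (simp add: poly_class_def mult_single mon_add)
  qed (simp_all add: poly_class_simps right_diff_distrib free_class_mult_diff_right)
qed (simp_all add: poly_class_simps left_diff_distrib free_class_mult_diff_left)

definition poly_green :: "int_poly4 \<Rightarrow> ('k rep set \<Rightarrow>\<^sub>0 int) set" where
  "poly_green p = split_relations +>\<^bsub>free_class_ring\<^esub> poly_class p"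

lemma poly_green_hom: "poly_green \<in> Ring.ring_hom int_poly4_ring green_ring"
proof -
  have "poly_class \<in> Ring.ring_hom int_poly4_ring free_class_ring"
    by (rule ring_hom_memI) (simp_all add: poly_class_keys poly_class_mult poly_class_simps)
  from ring_hom_trans [OF this ideal.rcos_ring_hom [OF ideal_split_relations]]
  show ?thesis by (simp add: green_ring_def poly_green_def [abs_def] o_def)
qed

lemma poly_green_eq_zero_iff: "poly_green p = \<zero>\<^bsub>green_ring\<^esub> \<longleftrightarrow> poly_class p \<in> split_relations"
  unfolding poly_green_def by (rule split_coset_eq_zero_iff [OF poly_class_keys])

text \<open>Surjectivity of the presentation onto \<open>R\<close>: polynomials are built from the
  variables just as elements of \<open>generate_ring\<close> are built from the generators.\<close>

lemma poly_green_image: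
  "range poly_green = generate_ring green_ring (range (\<lambda>i. split_relations +>\<^bsub>free_class_ring\<^esub> frag_of (c i)))"
    (is "_ = generate_ring _ ?G")
proof -
  interpret h: ring_hom_ring int_poly4_ring "green_ring :: ('k rep set \<Rightarrow>\<^sub>0 int) set ring" poly_green
    using ring_int_poly4_ring ring_green_ring poly_green_hom by (rule ring_hom_ringI2)
  have sub: "?G \<subseteq> range poly_green"
  proof (rule image_subsetI)
    fix i show "split_relations +>\<^bsub>free_class_ring\<^esub> frag_of (c i) \<in> range poly_green"
      using poly_class_simps(3) [of i, symmetric] by (simp add: poly_green_def)
  qed
  have uminus: "\<ominus>\<^bsub>int_poly4_ring\<^esub> p = - p" for p
    by (rule h.R.minus_equality) simp_all
  have pone: "poly_green 1 = \<one>\<^bsub>green_ring\<^esub>" using h.hom_one by simp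
  have pmult: "poly_green (p * q) = poly_green p \<otimes>\<^bsub>green_ring\<^esub> poly_green q" for p q
    using h.hom_mult [of p q] by simp
  have add: "poly_green (p + q) = poly_green p \<oplus>\<^bsub>green_ring\<^esub> poly_green q" for p q
    using h.hom_add [of p q] by simp
  have neg: "poly_green (- p) = \<ominus>\<^bsub>green_ring\<^esub> poly_green p" for p
    using h.hom_a_inv [of p] uminus by simp
  show ?thesis
  proof
    show "range poly_green \<subseteq> generate_ring green_ring ?G"
    proof (rule image_subsetI)
      fix p :: int_poly4
      show "poly_green p \<in> generate_ring green_ring ?G"
      proof (induction p rule: int_poly4_induct)
        case zero
        have "poly_green 0 = \<one>\<^bsub>green_ring\<^esub> \<oplus>\<^bsub>green_ring\<^esub> (\<ominus>\<^bsub>green_ring\<^esub> \<one>\<^bsub>green_ring\<^esub>)"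
          using add [of 1 "- 1"] neg [of 1] pone by simp
        then show ?case by (simp add: generate_ring.intros)
      next
        case one
        then show ?case using pone by (simp add: generate_ring.one)
      next
        case (diff p q)
        then show ?case using add [of p "- q"] neg [of q] by (simp add: generate_ring.intros)
      next
        case (mult i p)
        have "poly_green (pvar i) \<in> generate_ring green_ring ?G"
          by (rule generate_ring.incl) (simp add: poly_green_def poly_class_simps)
        then show ?case using mult by (simp add: pmult generate_ring.eng_mult)
      qed
    qed
    show "generate_ring green_ring ?G \<subseteq> range poly_green"
    proof
      fix r assume "r \<in> generate_ring green_ring ?G"
      then have "\<exists>p. r = poly_green p"
      proof (induction rule: generate_ring.induct)
        case one show ?case by (rule exI [of _ 1]) (simp add: pone)
      next
        case (incl h) then show ?case using sub by blast
      next
        case (a_inv h) then show ?case using neg by metis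
      next
        case (eng_add h1 h2) then show ?case using add by metis
      next
        case (eng_mult h1 h2) then show ?case using pmult by metis
      qed
      then show "r \<in> range poly_green" by blast
    qed
  qed
qed

end

section \<open>Additive functionals on the Green ring\<close>

text \<open>Vectors of all lengths are extended by zero into the single space of functions on
  \<open>nat\<close>, so that one notion of dimension covers subspaces of all modules.\<close>

definition fun_scale :: "'k :: field \<Rightarrow> (nat \<Rightarrow> 'k) \<Rightarrow> nat \<Rightarrow> 'k" where
  "fun_scale c x = (\<lambda>i. c * x i)"

global_interpretation fun_vs: vector_space "fun_scale :: 'k :: field \<Rightarrow> _"
  by unfold_locales (auto simp: fun_scale_def algebra_simps)

text \<open>The union of bases of \<open>S\<close> and \<open>T\<close> is a basis of the sum. The
  ambient space may have infinite dimension; the finite spanning sets \<open>G\<close> and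
  \<open>H\<close> guarantee finite bases, whose cardinalities can be added.\<close>

lemma (in vector_space) dim_direct_sum:
  assumes S: "subspace S" "S \<subseteq> span G" "finite G" and T: "subspace T" "T \<subseteq> span H" "finite H"
    and ST: "S \<inter> T \<subseteq> {0}"
  shows "dim {x + y | x y. x \<in> S \<and> y \<in> T} = dim S + dim T"
proof -
  obtain B where B: "B \<subseteq> S" "independent B" "S \<subseteq> span B" "card B = dim S" using basis_exists .
  obtain C where C: "C \<subseteq> T" "independent C" "T \<subseteq> span C" "card C = dim T" using basis_exists .
  have spans: "span B = S" "span C = T"
    using B C S T by (auto simp: span_minimal subset_antisym)
  have fin: "finite B" "finite C"
    using independent_span_bound [OF S(3) B(2)] independent_span_bound [OF T(3) C(2)] B(1) C(1) S(2) T(2) by auto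
  \<comment> \<open>If \<open>a\<close> were a combination of both parts, its component in the span
    of \<open>C'\<close> would lie in both spans and vanish. It is applied to \<open>B\<close> and
    \<open>C\<close> in both orders.\<close>
  have part: "a \<notin> span (B' \<union> C')"
    if "a \<in> span B\<^sub>1" "a \<notin> span B'" "B' \<subseteq> B\<^sub>1" "span B\<^sub>1 \<inter> span C' \<subseteq> {0}" for a B\<^sub>1 B' C'
  proof
    assume "a \<in> span (B' \<union> C')"
    then obtain x y where xy: "x \<in> span B'" "y \<in> span C'" "a = x + y" by (auto simp: span_Un)
    have "y = a - x" using xy by simp
    then have "y \<in> span B\<^sub>1" using that(1) xy(1) span_mono [OF that(3)] by (auto intro: span_diff)
    then have "y = 0" using xy(2) that(4) by auto
    then show False using xy that(2) by simp
  qed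
  have "independent (B \<union> C)"
    unfolding dependent_def
  proof safe
    fix a assume "a \<in> span (B \<union> C - {a})" "a \<in> B"
    moreover have "a \<notin> span (B - {a})" using B(2) \<open>a \<in> B\<close> unfolding dependent_def by blast
    moreover have "span (B \<union> C - {a}) \<subseteq> span ((B - {a}) \<union> C)" by (rule span_mono) auto
    ultimately show False
      using part [of a B "B - {a}" C] span_base [of a B] spans ST by auto
  next
    fix a assume "a \<in> span (B \<union> C - {a})" "a \<in> C"
    moreover have "a \<notin> span (C - {a})" using C(2) \<open>a \<in> C\<close> unfolding dependent_def by blast
    moreover have "span (B \<union> C - {a}) \<subseteq> span ((C - {a}) \<union> B)" by (rule span_mono) auto
    ultimately show False
      using part [of a C "C - {a}" B] span_base [of a C] spans ST by auto
  qed
  moreover have "0 \<notin> B" using B(2) dependent_zero by blast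
  then have "B \<inter> C = {}" using ST B(1) C(1) by blast
  then have "card (B \<union> C) = dim S + dim T" using fin B(4) C(4) by (simp add: card_Un_disjoint)
  moreover have "span (B \<union> C) = {x + y | x y. x \<in> S \<and> y \<in> T}"
    using spans by (simp add: span_Un)
  ultimately show ?thesis by (metis dim_span_eq_card_independent)
qed

definition vec_fun :: "'k :: field vec \<Rightarrow> nat \<Rightarrow> 'k" where
  "vec_fun v = (\<lambda>i. if i < dim_vec v then v $ i else 0)"

definition mat_fun :: "'k :: field mat \<Rightarrow> (nat \<Rightarrow> 'k) \<Rightarrow> nat \<Rightarrow> 'k" where
  "mat_fun A x = (\<lambda>i. if i < dim_row A then \<Sum>j<dim_col A. A $$ (i, j) * x j else 0)"

lemma vec_fun_mult: "A \<in> carrier_mat m n \<Longrightarrow> v \<in> carrier_vec n \<Longrightarrow> vec_fun (A *\<^sub>v v) = mat_fun A (vec_fun v)"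
  by (rule ext) (auto simp: vec_fun_def mat_fun_def scalar_prod_def atLeast0LessThan)

lemma linear_mat_fun: "Vector_Spaces.linear fun_scale fun_scale (mat_fun A)"
  by unfold_locales
    (auto simp: fun_scale_def mat_fun_def fun_eq_iff algebra_simps sum.distrib sum_distrib_left)

lemma vec_fun_add: "v \<in> carrier_vec n \<Longrightarrow> w \<in> carrier_vec n \<Longrightarrow> vec_fun (v + w) = vec_fun v + vec_fun w"
  by (rule ext) (auto simp: vec_fun_def)

lemma vec_fun_smult: "vec_fun (c \<cdot>\<^sub>v v) = fun_scale c (vec_fun v)"
  by (rule ext) (auto simp: vec_fun_def fun_scale_def)

lemma vec_fun_zero [simp]: "vec_fun (0\<^sub>v n) = 0"
  by (rule ext) (auto simp: vec_fun_def)

lemma vec_fun_eq_iff: "v \<in> carrier_vec n \<Longrightarrow> w \<in> carrier_vec n \<Longrightarrow> vec_fun v = vec_fun w \<longleftrightarrow> v = w"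
  by (auto simp: vec_fun_def fun_eq_iff intro!: eq_vecI split: if_splits)

definition is_subspace :: "nat \<Rightarrow> 'k :: field vec set \<Rightarrow> bool" where
  "is_subspace n U \<longleftrightarrow> U \<subseteq> carrier_vec n \<and> 0\<^sub>v n \<in> U \<and> (\<forall>v \<in> U. \<forall>w \<in> U. v + w \<in> U) \<and> (\<forall>c. \<forall>v \<in> U. c \<cdot>\<^sub>v v \<in> U)"

definition vec_dim :: "'k :: field vec set \<Rightarrow> nat" where
  "vec_dim U = fun_vs.dim (vec_fun ` U)"

lemma subspace_vec_fun:
  assumes "is_subspace n U"
  shows "fun_vs.subspace (vec_fun ` U)"
  unfolding fun_vs.subspace_def
proof (intro conjI ballI allI)
  show "0 \<in> vec_fun ` U" using assms vec_fun_zero [of n] unfolding is_subspace_def by (metis image_eqI)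
  show "x + y \<in> vec_fun ` U" if "x \<in> vec_fun ` U" "y \<in> vec_fun ` U" for x y
  proof -
    obtain v w where vw: "x = vec_fun v" "y = vec_fun w" "v \<in> U" "w \<in> U" using \<open>x \<in> _\<close> \<open>y \<in> _\<close> by blast
    then have "vec_fun (v + w) = x + y" using assms vec_fun_add [of v n w] by (auto simp: is_subspace_def)
    then show ?thesis using vw assms unfolding is_subspace_def by (metis imageI)
  qed
  show "fun_scale c x \<in> vec_fun ` U" if "x \<in> vec_fun ` U" for c x
    using that assms by (auto simp: is_subspace_def simp flip: vec_fun_smult)
qed

lemma sum_apply: "(\<Sum>i\<in>S. f i) x = (\<Sum>i\<in>S. f i x :: 'a :: comm_monoid_add)"
  by (induction S rule: infinite_finite_induct) auto

lemma vec_fun_in_span: "v \<in> carrier_vec n \<Longrightarrow> vec_fun v \<in> fun_vs.span ((\<lambda>i. vec_fun (unit_vec n i)) ` {..<n})"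
proof -
  assume v: "v \<in> carrier_vec n"
  have "vec_fun v = (\<Sum>i<n. fun_scale (v $ i) (vec_fun (unit_vec n i)))"
  proof
    fix k
    have "(\<Sum>i<n. fun_scale (v $ i) (vec_fun (unit_vec n i))) k = (\<Sum>i<n. if k = i then v $ i else 0)"
      unfolding sum_apply by (rule sum.cong) (auto simp: fun_scale_def vec_fun_def)
    then show "vec_fun v k = (\<Sum>i<n. fun_scale (v $ i) (vec_fun (unit_vec n i))) k"
      using v by (simp add: vec_fun_def)
  qed
  also have "\<dots> \<in> fun_vs.span ((\<lambda>i. vec_fun (unit_vec n i)) ` {..<n})"
    by (intro fun_vs.span_sum fun_vs.span_scale fun_vs.span_base) auto
  finally show ?thesis .
qed

lemma vec_dim_eq_0_iff:
  assumes "is_subspace n U"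
  shows "vec_dim U = 0 \<longleftrightarrow> U = {0\<^sub>v n}"
proof
  assume "vec_dim U = 0"
  obtain B where B: "B \<subseteq> vec_fun ` U" "fun_vs.independent B" "vec_fun ` U \<subseteq> fun_vs.span B" "card B = vec_dim U"
    using fun_vs.basis_exists unfolding vec_dim_def by blast
  have "vec_fun ` U \<subseteq> fun_vs.span ((\<lambda>i. vec_fun (unit_vec n i)) ` {..<n})"
    using vec_fun_in_span assms by (auto simp: is_subspace_def)
  then have "B \<subseteq> fun_vs.span ((\<lambda>i. vec_fun (unit_vec n i)) ` {..<n})" using B(1) by blast
  \<comment> \<open>An infinite set also has \<open>card\<close> equal to 0, so finiteness is what
    turns dimension zero into an empty basis.\<close>
  then have "finite B" using fun_vs.independent_span_bound [OF _ B(2)] by blast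
  then have "B = {}" using B \<open>vec_dim U = 0\<close> by simp
  then have "vec_fun v = vec_fun (0\<^sub>v n)" if "v \<in> U" for v using B(3) that by auto
  then have "v = 0\<^sub>v n" if "v \<in> U" for v
    using that assms vec_fun_eq_iff [of v n "0\<^sub>v n"] unfolding is_subspace_def by blast
  then show "U = {0\<^sub>v n}" using assms by (auto simp: is_subspace_def)
next
  assume "U = {0\<^sub>v n}"
  then have "fun_vs.span (vec_fun ` U) = fun_vs.span {}" by simp
  then show "vec_dim U = 0" unfolding vec_dim_def by (metis card.empty fun_vs.dim_eq_card fun_vs.independent_empty)
qed

lemma vec_dim_image:
  assumes U: "is_subspace n U" and A: "A \<in> carrier_mat m n" "B \<in> carrier_mat n m" "B * A = 1\<^sub>m n"
  shows "vec_dim ((\<lambda>v. A *\<^sub>v v) ` U) = vec_dim U"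
proof -
  interpret l: Vector_Spaces.linear fun_scale fun_scale "mat_fun A" by (rule linear_mat_fun)
  have Uc: "U \<subseteq> carrier_vec n" using U by (simp add: is_subspace_def)
  obtain S where S: "S \<subseteq> vec_fun ` U" "fun_vs.independent S" "vec_fun ` U \<subseteq> fun_vs.span S" "card S = vec_dim U"
    using fun_vs.basis_exists unfolding vec_dim_def by blast
  have span: "fun_vs.span S = vec_fun ` U"
    using S subspace_vec_fun [OF U] fun_vs.span_minimal by blast
  have inj: "inj_on (mat_fun A) (vec_fun ` U)"
  proof (rule inj_onI, clarify)
    fix v w assume vw: "v \<in> U" "w \<in> U" and "mat_fun A (vec_fun v) = mat_fun A (vec_fun w)"
    moreover have vwc: "v \<in> carrier_vec n" "w \<in> carrier_vec n" using vw Uc by auto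
    ultimately have "vec_fun (A *\<^sub>v v) = vec_fun (A *\<^sub>v w)" by (simp add: vec_fun_mult [OF A(1)])
    then have "A *\<^sub>v v = A *\<^sub>v w"
      using vec_fun_eq_iff [OF vwc [THEN mult_mat_vec_carrier [OF A(1)]]] by (rule iffD1 [rotated])
    with vwc have "v = w" using mult_mat_vec_eq_iff_inj [OF mat_injI [OF A] A(1)] by blast
    then show "vec_fun v = vec_fun w" by simp
  qed
  have "fun_vs.independent (mat_fun A ` S)"
    using l.independent_injective_image [OF S(2)] inj span by simp
  moreover have "card (mat_fun A ` S) = card S"
    using inj S(1) by (intro card_image) (rule inj_on_subset)
  moreover have "vec_fun ` (\<lambda>v. A *\<^sub>v v) ` U = mat_fun A ` vec_fun ` U"
    using vec_fun_mult [OF A(1)] Uc by (force simp: image_image intro!: image_cong)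
  then have "fun_vs.span (mat_fun A ` S) = fun_vs.span (vec_fun ` (\<lambda>v. A *\<^sub>v v) ` U)"
    by (metis l.span_image span fun_vs.span_span)
  ultimately show ?thesis using S(4) unfolding vec_dim_def by (metis fun_vs.dim_eq_card)
qed

lemma vec_dim_sum:
  assumes U: "is_subspace n U" and W: "is_subspace n W" and "U \<inter> W \<subseteq> {0\<^sub>v n}"
  shows "vec_dim {v + w | v w. v \<in> U \<and> w \<in> W} = vec_dim U + vec_dim W"
proof -
  let ?E = "(\<lambda>i. vec_fun (unit_vec n i)) ` {..<n}"
  have c: "U \<subseteq> carrier_vec n" "W \<subseteq> carrier_vec n" using U W by (simp_all add: is_subspace_def)
  have "vec_fun ` U \<inter> vec_fun ` W \<subseteq> {0}"
    using assms(3) vec_fun_eq_iff c by (fastforce simp: subset_iff)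
  then have "fun_vs.dim {x + y | x y. x \<in> vec_fun ` U \<and> y \<in> vec_fun ` W} = vec_dim U + vec_dim W"
    unfolding vec_dim_def using c vec_fun_in_span [of _ n]
    by (intro fun_vs.dim_direct_sum [of _ ?E _ ?E] subspace_vec_fun [OF U] subspace_vec_fun [OF W])
      (blast | simp)+
  moreover have "vec_fun ` {v + w | v w. v \<in> U \<and> w \<in> W} = {x + y | x y. x \<in> vec_fun ` U \<and> y \<in> vec_fun ` W}"
    using c vec_fun_add [of _ n] by (fastforce simp: subset_iff image_iff)
  ultimately show ?thesis by (simp add: vec_dim_def)
qed

lemma is_subspaceD:
  assumes "is_subspace n U"
  shows "U \<subseteq> carrier_vec n" "0\<^sub>v n \<in> U" "\<And>v w. v \<in> U \<Longrightarrow> w \<in> U \<Longrightarrow> v + w \<in> U" "\<And>c v. v \<in> U \<Longrightarrow> c \<cdot>\<^sub>v v \<in> U"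
  using assms by (auto simp: is_subspace_def)

lemma is_subspace_mat_image:
  assumes "is_subspace n T" "h \<in> carrier_mat m n"
  shows "is_subspace m ((\<lambda>v. h *\<^sub>v v) ` T)"
proof -
  note T = is_subspaceD [OF assms(1)]
  have "0\<^sub>v m = h *\<^sub>v 0\<^sub>v n" using assms(2) by (intro eq_vecI) auto
  moreover have "h *\<^sub>v v + h *\<^sub>v w = h *\<^sub>v (v + w)" if "v \<in> T" "w \<in> T" for v w
    using that T(1) by (intro mult_add_distrib_mat_vec [OF assms(2), symmetric]) auto
  moreover have "a \<cdot>\<^sub>v (h *\<^sub>v v) = h *\<^sub>v (a \<cdot>\<^sub>v v)" if "v \<in> T" for a v
    using that T(1) by (intro mult_mat_vec [OF assms(2), symmetric]) auto
  ultimately show ?thesis using T assms(2)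
    unfolding is_subspace_def by (auto intro!: imageI mult_mat_vec_carrier)
qed

text \<open>A subfunctor of the forgetful functor from modules to vector spaces. Compatibility with
  the injections and projections of a direct sum is what makes its dimension additive.\<close>

definition natural_subspace :: "('k :: field rep \<Rightarrow> 'k vec set) \<Rightarrow> bool" where
  "natural_subspace F \<longleftrightarrow>
     (\<forall>M. D4_module M \<longrightarrow> is_subspace (rdim M) (F M)) \<and>
     (\<forall>M N. \<forall>f \<in> D4_hom M N. D4_module M \<longrightarrow> D4_module N \<longrightarrow> (\<forall>v \<in> F M. f *\<^sub>v v \<in> F N))"

lemma vec_dim_iso:
  assumes F: "natural_subspace F" and "D4_iso M N" and M: "D4_module M" and N: "D4_module N"
  shows "vec_dim (F M) = vec_dim (F N)"
proof -
  obtain f g where fg: "f \<in> D4_hom M N" "g \<in> D4_hom N M" "g * f = 1\<^sub>m (rdim M)" "f * g = 1\<^sub>m (rdim N)"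
    using D4_iso_inverse [OF assms(2-4)] .
  note c = D4_homD(1) [OF fg(1)] D4_homD(1) [OF fg(2)]
  have "F N \<subseteq> (\<lambda>v. f *\<^sub>v v) ` F M"
  proof
    fix v assume v: "v \<in> F N"
    then have vc: "v \<in> carrier_vec (rdim N)" using F N by (auto simp: natural_subspace_def is_subspace_def)
    have "v = f *\<^sub>v (g *\<^sub>v v)" unfolding assoc_mult_mat_vec [OF c vc, symmetric] using fg vc by simp
    moreover have "g *\<^sub>v v \<in> F M" using F fg(2) M N v by (auto simp: natural_subspace_def)
    ultimately show "v \<in> (\<lambda>v. f *\<^sub>v v) ` F M" by blast
  qed
  then have "F N = (\<lambda>v. f *\<^sub>v v) ` F M" using F fg(1) M N by (auto simp: natural_subspace_def)
  then show ?thesis using vec_dim_image [OF _ c fg(3)] F M by (simp add: natural_subspace_def)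
qed

text \<open>For \<open>v\<close> in \<open>F M\<close> naturality puts \<open>p v\<close> into
  \<open>F A\<close> and \<open>q v\<close> into \<open>F B\<close>, and
  \<open>v = i p v + j q v\<close>. So \<open>F M\<close> is the direct sum of the images of
  \<open>F A\<close> and \<open>F B\<close>.\<close>

lemma vec_dim_biproduct:
  assumes F: "natural_subspace F" and bp: "is_biproduct A B M i j p q"
    and mods: "D4_module A" "D4_module B" "D4_module M"
  shows "vec_dim (F M) = vec_dim (F A) + vec_dim (F B)"
proof -
  note b = is_biproductD [OF bp]
  note c = b(1-4) [THEN D4_homD(1)]
  have sub: "is_subspace (rdim N) (F N)" if "D4_module N" for N using F that by (simp add: natural_subspace_def)
  have Fc: "v \<in> carrier_vec (rdim N)" if "D4_module N" "v \<in> F N" for v N using sub [OF that(1)] that(2) by (auto simp: is_subspace_def)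
  have nat: "f *\<^sub>v v \<in> F N'" if "f \<in> D4_hom N N'" "v \<in> F N" "D4_module N" "D4_module N'" for f v N N'
    using F that by (simp add: natural_subspace_def)
  let ?U = "(\<lambda>v. i *\<^sub>v v) ` F A" and ?W = "(\<lambda>v. j *\<^sub>v v) ` F B"
  have FM: "F M = {v + w | v w. v \<in> ?U \<and> w \<in> ?W}"
  proof (intro equalityI subsetI)
    fix v assume v: "v \<in> F M"
    note vc = Fc [OF mods(3) v]
    have "v = (i * p + j * q) *\<^sub>v v" using b(9) vc by simp
    also have "\<dots> = i *\<^sub>v (p *\<^sub>v v) + j *\<^sub>v (q *\<^sub>v v)"
      using c vc by (simp add: add_mult_distrib_mat_vec [of _ "rdim M" "rdim M"] assoc_mult_mat_vec [OF c(1,3) vc] assoc_mult_mat_vec [OF c(2,4) vc])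
    finally show "v \<in> {v + w | v w. v \<in> ?U \<and> w \<in> ?W}"
      using nat [OF b(3) v] nat [OF b(4) v] mods by blast
  next
    fix v assume "v \<in> {v + w | v w. v \<in> ?U \<and> w \<in> ?W}"
    then show "v \<in> F M" using nat [OF b(1)] nat [OF b(2)] mods sub [OF mods(3)] by (auto simp: is_subspace_def)
  qed
  have "?U \<inter> ?W \<subseteq> {0\<^sub>v (rdim M)}"
  proof safe
    fix v w assume vw: "v \<in> F A" "w \<in> F B" "i *\<^sub>v v = j *\<^sub>v w"
    note vc = Fc [OF mods(1) vw(1)] and wc = Fc [OF mods(2) vw(2)]
    have "v = p *\<^sub>v (i *\<^sub>v v)" using assoc_mult_mat_vec [OF c(3,1) vc] b(5) vc by simp
    also have "\<dots> = 0\<^sub>m (rdim A) (rdim B) *\<^sub>v w" using assoc_mult_mat_vec [OF c(3,2) wc] b(7) vw(3) by simp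
    also have "\<dots> = 0\<^sub>v (rdim A)" using wc by (intro eq_vecI) auto
    finally have "j *\<^sub>v w = i *\<^sub>v 0\<^sub>v (rdim A)" using vw(3) by simp
    then show "i *\<^sub>v v = 0\<^sub>v (rdim M)" using c(1) vw(3) by (auto intro!: eq_vecI)
  qed
  then show ?thesis
    unfolding FM using vec_dim_sum [OF is_subspace_mat_image [OF sub c(1)] is_subspace_mat_image [OF sub c(2)]] mods
      vec_dim_image [OF sub c(1,3) b(5)] vec_dim_image [OF sub c(2,4) b(6)] by simp
qed

text \<open>Such a functional induces a homomorphism from the additive group of the Green ring to
  the integers; on the free group it is evaluated at representatives instead of cosets.\<close>

definition additive_functional :: "(('k :: field rep set \<Rightarrow>\<^sub>0 int) \<Rightarrow> int) \<Rightarrow> bool" where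
  "additive_functional \<Phi> \<longleftrightarrow> (\<forall>p q. \<Phi> (p - q) = \<Phi> p - \<Phi> q) \<and> (\<forall>p \<in> split_relations. \<Phi> p = 0)"

lemma additive_functionalD:
  assumes "additive_functional \<Phi>"
  shows "\<Phi> (p - q) = \<Phi> p - \<Phi> q" "p \<in> split_relations \<Longrightarrow> \<Phi> p = 0" "\<Phi> 0 = 0" "\<Phi> (p + q) = \<Phi> p + \<Phi> q"
proof -
  show diff: "\<Phi> (p - q) = \<Phi> p - \<Phi> q" and "p \<in> split_relations \<Longrightarrow> \<Phi> p = 0" for p q
    using assms by (auto simp: additive_functional_def)
  show zero: "\<Phi> 0 = 0" using diff [of 0 0] by simp
  show "\<Phi> (p + q) = \<Phi> p + \<Phi> q" using diff [of p "0 - q"] diff [of 0 q] zero by simp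
qed

lemma natural_subspace_functional:
  fixes F :: "'k :: field rep \<Rightarrow> 'k vec set"
  assumes F: "natural_subspace F"
  obtains \<Phi> :: "('k rep set \<Rightarrow>\<^sub>0 int) \<Rightarrow> int"
  where "additive_functional \<Phi>" "\<And>M. D4_module M \<Longrightarrow> \<Phi> (frag_of (iso_class M)) = int (vec_dim (F M))"
proof -
  \<comment> \<open>The free abelian group on \<open>()\<close> is a copy of the integers, so this
    is the linear extension of the dimension, read off by \<open>lookup\<close> at
    \<open>()\<close>. By \<open>vec_dim_iso\<close> the value is independent of the representative
    picked by \<open>SOME\<close>.\<close>
  define \<Phi> :: "('k rep set \<Rightarrow>\<^sub>0 int) \<Rightarrow> int" where
    "\<Phi> p = Poly_Mapping.lookup (frag_extend (\<lambda>U. frag_cmul (int (vec_dim (F (SOME M. M \<in> U)))) (frag_of ())) p) ()" for p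
  have diff: "\<Phi> (p - q) = \<Phi> p - \<Phi> q" for p q by (simp add: \<Phi>_def frag_extend_diff lookup_minus)
  have iso: "\<Phi> (frag_of (iso_class M)) = int (vec_dim (F M))" if M: "D4_module M" for M
  proof -
    have "M \<in> iso_class M" using M by (simp add: iso_class_def)
    then have "(SOME N. N \<in> iso_class M) \<in> iso_class M" by (metis someI_ex)
    then have "vec_dim (F (SOME N. N \<in> iso_class M)) = vec_dim (F M)"
      using vec_dim_iso [OF F] M by (auto simp: iso_class_def)
    then show ?thesis by (simp add: \<Phi>_def)
  qed
  have zero: "\<Phi> 0 = 0" using diff [of 0 0] by simp
  have add: "\<Phi> (p + q) = \<Phi> p + \<Phi> q" for p q using diff [of p "0 - q"] diff [of 0 q] zero by simp
  have "\<Phi> p = 0" if "p \<in> split_relations" for p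
    using that
  proof (induction p rule: split_relations_induct)
    case (relation M N)
    obtain i j p q where "is_biproduct M N (direct_sum_rep M N) i j p q"
      using is_biproduct_direct_sum [OF relation] .
    then show ?case using vec_dim_biproduct [OF F] relation by (simp add: diff add iso)
  qed (simp_all add: zero diff)
  with diff iso show thesis by (intro that [of \<Phi>]) (simp_all add: additive_functional_def)
qed

section \<open>Explicit isomorphisms between small modules\<close>

definition tabulate :: "nat \<Rightarrow> nat \<Rightarrow> (nat \<Rightarrow> nat \<Rightarrow> int) \<Rightarrow> int list list" where
  "tabulate m n f = map (\<lambda>i. map (\<lambda>j. f i j) [0..<n]) [0..<m]"

text \<open>Identities between integer lists can be evaluated outright; \<open>int_mat\<close>
  carries them along the ring map from the integers to an arbitrary field.\<close>

definition int_mat :: "nat \<Rightarrow> nat \<Rightarrow> int list list \<Rightarrow> 'k :: field mat" where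
  "int_mat m n A = mat m n (\<lambda>(i, j). of_int (A ! i ! j))"

lemma nth_tabulate: "i < m \<Longrightarrow> j < n \<Longrightarrow> tabulate m n f ! i ! j = f i j"
  by (simp add: tabulate_def)

definition int_mult :: "nat \<Rightarrow> int list list \<Rightarrow> int list list \<Rightarrow> int list list" where
  "int_mult n A B = tabulate n n (\<lambda>i j. \<Sum>k\<leftarrow>[0..<n]. A ! i ! k * B ! k ! j)"

definition int_add :: "nat \<Rightarrow> int list list \<Rightarrow> int list list \<Rightarrow> int list list" where
  "int_add n A B = tabulate n n (\<lambda>i j. A ! i ! j + B ! i ! j)"

definition int_diag :: "nat \<Rightarrow> int \<Rightarrow> int list list" where
  "int_diag n c = tabulate n n (\<lambda>i j. if i = j then c else 0)"

definition int_kron :: "nat \<Rightarrow> nat \<Rightarrow> int list list \<Rightarrow> int list list \<Rightarrow> int list list" where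
  "int_kron m n A B = tabulate (m * n) (m * n) (\<lambda>i j. A ! (i div n) ! (j div n) * B ! (i mod n) ! (j mod n))"

definition int_block :: "nat \<Rightarrow> nat \<Rightarrow> int list list \<Rightarrow> int list list \<Rightarrow> int list list" where
  "int_block m n A B = tabulate (m + n) (m + n) (\<lambda>i j.
     if i < m then if j < m then A ! i ! j else 0 else if j < m then 0 else B ! (i - m) ! (j - m))"

definition int_rep :: "nat \<Rightarrow> (D4_gen \<Rightarrow> int list list) \<Rightarrow> 'k :: field rep" where
  "int_rep n R = Rep n (\<lambda>s. int_mat n n (R s))"

fun int_tensor :: "nat \<Rightarrow> nat \<Rightarrow> (D4_gen \<Rightarrow> int list list) \<Rightarrow> (D4_gen \<Rightarrow> int list list) \<Rightarrow> D4_gen \<Rightarrow> int list list" where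
  "int_tensor m n R S Gen_a = int_add (m * n) (int_kron m n (R Gen_a) (S Gen_b)) (int_kron m n (int_diag m 1) (S Gen_a))"
| "int_tensor m n R S Gen_b = int_kron m n (R Gen_b) (S Gen_b)"
| "int_tensor m n R S Gen_c = int_kron m n (R Gen_c) (S Gen_c)"
| "int_tensor m n R S Gen_d = int_add (m * n) (int_kron m n (R Gen_d) (S Gen_c)) (int_kron m n (int_diag m 1) (S Gen_d))"

definition int_sum :: "nat \<Rightarrow> nat \<Rightarrow> (D4_gen \<Rightarrow> int list list) \<Rightarrow> (D4_gen \<Rightarrow> int list list) \<Rightarrow> D4_gen \<Rightarrow> int list list" where
  "int_sum m n R S s = int_block m n (R s) (S s)"

text \<open>
  A certificate consists of integer matrices \<open>F\<close> and \<open>G\<close> such that, over any field of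
  characteristic other than 2, \<open>F\<close> and \<open>2\<^bsup>-e\<^esup> G\<close> are mutually inverse isomorphisms.  The concrete
  matrices below were found by solving the linear system that defines a homomorphism.
\<close>

definition iso_certificate :: "nat \<Rightarrow> (D4_gen \<Rightarrow> int list list) \<Rightarrow> (D4_gen \<Rightarrow> int list list) \<Rightarrow> int list list \<Rightarrow> int list list \<Rightarrow> nat \<Rightarrow> bool" where
  "iso_certificate n R S F G e \<longleftrightarrow>
     (\<forall>s \<in> set [Gen_a, Gen_b, Gen_c, Gen_d]. int_mult n F (R s) = int_mult n (S s) F) \<and>
     int_mult n G F = int_diag n (2 ^ e) \<and> int_mult n F G = int_diag n (2 ^ e)"

lemma int_mat_carrier [simp]: "int_mat m n A \<in> carrier_mat m n"
  by (simp add: int_mat_def)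

lemma dim_int_mat [simp]: "dim_row (int_mat m n A) = m" "dim_col (int_mat m n A) = n"
  by (simp_all add: int_mat_def)

lemma int_mat_mult: "int_mat n n (int_mult n A B) = (int_mat n n A * int_mat n n B :: 'k :: field mat)"
  by (intro eq_matI)
    (auto simp: int_mat_def int_mult_def nth_tabulate scalar_prod_def atLeast0LessThan interv_sum_list_conv_sum_set_nat intro!: sum.cong)

lemma int_mat_add: "int_mat n n (int_add n A B) = (int_mat n n A + int_mat n n B :: 'k :: field mat)"
  by (intro eq_matI) (auto simp: int_mat_def int_add_def nth_tabulate)

lemma int_mat_diag: "int_mat n n (int_diag n c) = (of_int c \<cdot>\<^sub>m 1\<^sub>m n :: 'k :: field mat)"
  by (intro eq_matI) (auto simp: int_mat_def int_diag_def nth_tabulate)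

lemma int_mat_kron:
  "int_mat (m * n) (m * n) (int_kron m n A B) = (kronecker (int_mat m m A) (int_mat n n B) :: 'k :: field mat)"
  by (intro eq_matI) (auto simp: int_mat_def int_kron_def nth_tabulate index_kronecker div_mod_bounds)

lemma int_mat_block:
  "int_mat (m + n) (m + n) (int_block m n A B)
    = (four_block_mat (int_mat m m A) (0\<^sub>m m n) (0\<^sub>m n m) (int_mat n n B) :: 'k :: field mat)"
  by (intro eq_matI) (auto simp: int_mat_def int_block_def nth_tabulate)

lemma rdim_int_rep [simp]: "rdim (int_rep n R) = n" and act_int_rep [simp]: "act (int_rep n R) s = int_mat n n (R s)"
  by (simp_all add: int_rep_def)

lemma int_rep_tensor: "tensor_rep (int_rep m R) (int_rep n S) = int_rep (m * n) (int_tensor m n R S)"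
proof (rule rep_eqI)
  fix s show "act (tensor_rep (int_rep m R) (int_rep n S)) s = (act (int_rep (m * n) (int_tensor m n R S)) s :: 'a mat)"
    by (cases s) (simp_all add: int_mat_add int_mat_kron int_mat_diag)
qed simp

lemma int_rep_sum: "direct_sum_rep (int_rep m R) (int_rep n S) = int_rep (m + n) (int_sum m n R S)"
  by (rule rep_eqI) (simp_all add: act_direct_sum_rep int_sum_def int_mat_block)

lemma iso_certificate:
  assumes "iso_certificate n R S F G e" "(2 :: 'k :: field) \<noteq> 0"
  shows "D4_iso (int_rep n R) (int_rep n S :: 'k rep)"
proof (rule D4_isoI)
  have R: "int_mult n F (R s) = int_mult n (S s) F" for s
    using assms(1) by (cases s) (auto simp: iso_certificate_def)
  show "int_mat n n F \<in> D4_hom (int_rep n R) (int_rep n S :: 'k rep)"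
    by (rule D4_homI) (simp_all add: R flip: int_mat_mult)
  have "int_mat n n G * int_mat n n F = ((2 :: 'k) ^ e \<cdot>\<^sub>m 1\<^sub>m n :: 'k mat)" "int_mat n n F * int_mat n n G = ((2 :: 'k) ^ e \<cdot>\<^sub>m 1\<^sub>m n :: 'k mat)"
    using assms(1) by (simp_all add: iso_certificate_def int_mat_diag flip: int_mat_mult)
  then show "(1 / 2 ^ e) \<cdot>\<^sub>m int_mat n n G * int_mat n n F = (1\<^sub>m (rdim (int_rep n R :: 'k rep)) :: 'k mat)"
    "int_mat n n F * ((1 / 2 ^ e) \<cdot>\<^sub>m int_mat n n G) = (1\<^sub>m (rdim (int_rep n S :: 'k rep)) :: 'k mat)"
    using assms(2) by (simp_all add: mult_smult_assoc_mat [OF int_mat_carrier int_mat_carrier]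
        mult_smult_distrib [OF int_mat_carrier int_mat_carrier]) (auto intro!: eq_matI)
qed simp_all

fun int_V1 :: "nat \<Rightarrow> D4_gen \<Rightarrow> int list list" where
  "int_V1 r Gen_a = [[0]]"
| "int_V1 r Gen_b = [[(- 1) ^ r]]"
| "int_V1 r Gen_c = [[(- 1) ^ r]]"
| "int_V1 r Gen_d = [[0]]"

fun int_V2 :: "D4_gen \<Rightarrow> int list list" where
  "int_V2 Gen_a = [[0, 0], [1, 0]]"
| "int_V2 Gen_b = [[1, 0], [0, - 1]]"
| "int_V2 Gen_c = [[- 1, 0], [0, 1]]"
| "int_V2 Gen_d = [[0, 2], [0, 0]]"

text \<open>The submodule of \<open>P0\<close> with basis \<open>a e\<close>, \<open>d e\<close>,
  \<open>a d e\<close>, where \<open>e\<close> is the generator of \<open>P0\<close>. The sign in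
  \<open>Gen_d\<close> is that of \<open>d a e = - a d e\<close>.\<close>

fun int_Y :: "D4_gen \<Rightarrow> int list list" where
  "int_Y Gen_a = [[0, 0, 0], [0, 0, 0], [0, 1, 0]]"
| "int_Y Gen_b = [[- 1, 0, 0], [0, - 1, 0], [0, 0, 1]]"
| "int_Y Gen_c = [[- 1, 0, 0], [0, - 1, 0], [0, 0, 1]]"
| "int_Y Gen_d = [[0, 0, 0], [0, 0, 0], [- 1, 0, 0]]"

text \<open>The quotient of \<open>P0\<close> by the line of \<open>a d e\<close>, with basis the
  images of \<open>e\<close>, \<open>a e\<close>, \<open>d e\<close>. The link to the dual of
  \<open>int_Y\<close> is \<open>dual_Y_iso_Z\<close>.\<close>

fun int_Z :: "D4_gen \<Rightarrow> int list list" where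
  "int_Z Gen_a = [[0, 0, 0], [1, 0, 0], [0, 0, 0]]"
| "int_Z Gen_b = [[1, 0, 0], [0, - 1, 0], [0, 0, - 1]]"
| "int_Z Gen_c = [[1, 0, 0], [0, - 1, 0], [0, 0, - 1]]"
| "int_Z Gen_d = [[0, 0, 0], [0, 0, 0], [1, 0, 0]]"

text \<open>The module form of \<open>x^3 = 2 x + 2 x g\<close>. V(2,1) appears, up to isomorphism,
  as \<open>V2 0\<close> tensored with \<open>V1 1\<close>, so that all summands are monomials in
  the generators; the bracketing is that of the relations split off later.\<close>

lemma certificate_XXX:
  "iso_certificate 8 (int_tensor 4 2 (int_tensor 2 2 int_V2 int_V2) int_V2)
     (int_sum 4 4 (int_sum 2 2 int_V2 int_V2) (int_sum 2 2 (int_tensor 2 1 int_V2 (int_V1 1)) (int_tensor 2 1 int_V2 (int_V1 1))))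
     [[0, 0, 0, -1, 0, 1, -1, 0], [0, 0, 0, 0, 0, 0, 0, -1], [1, 0, 0, 0, 0, 0, 0, 0], [0, 1, -1, 0, 1, 0, 0, 0],
      [0, 1, -1, 0, 0, 0, 0, 0], [0, 0, 0, 0, 0, 1, -1, 0], [0, 0, 1, 0, -1, 0, 0, 0], [0, 0, 0, -1, 0, 1, 0, 0]]
     [[0, 0, 1, 0, 0, 0, 0, 0], [0, 0, 0, 1, 0, 0, 1, 0], [0, 0, 0, 1, -1, 0, 1, 0], [-1, 0, 0, 0, 0, 1, 0, 0], [0,
      0, 0, 1, -1, 0, 0, 0], [-1, 0, 0, 0, 0, 1, 0, 1], [-1, 0, 0, 0, 0, 0, 0, 1], [0, -1, 0, 0, 0, 0, 0, 0]] 0"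
  by code_simp

text \<open>This certificate and the next three share one target. They give
  \<open>x y = x + 2 x g = x z\<close> and, since both orders of the factors are treated, also that
  \<open>x\<close> commutes with \<open>y\<close> and \<open>z\<close>.\<close>

lemma certificate_XY:
  "iso_certificate 6 (int_tensor 2 3 int_V2 int_Y)
     (int_sum 2 4 int_V2 (int_sum 2 2 (int_tensor 2 1 int_V2 (int_V1 1)) (int_tensor 2 1 int_V2 (int_V1 1))))
     [[0, 0, 2, 0, 2, 0], [-1, 0, 0, 0, 0, 2], [0, 2, 0, 0, 0, 0], [0, 0, 0, 0, 2, 0], [2, 0, 0, 0, 0, 0], [0, 0,
      0, 2, 0, 0]]
     [[0, 0, 0, 0, 2, 0], [0, 0, 2, 0, 0, 0], [2, 0, 0, -2, 0, 0], [0, 0, 0, 0, 0, 2], [0, 0, 0, 2, 0, 0], [0, 2,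
      0, 0, 1, 0]] 2"
  by code_simp

lemma certificate_YX:
  "iso_certificate 6 (int_tensor 3 2 int_Y int_V2)
     (int_sum 2 4 int_V2 (int_sum 2 2 (int_tensor 2 1 int_V2 (int_V1 1)) (int_tensor 2 1 int_V2 (int_V1 1))))
     [[0, 0, 0, -2, 2, 0], [1, 0, 0, 0, 0, 2], [2, 0, 0, 0, 0, 0], [0, -2, 0, 0, 0, 0], [0, 0, 2, 0, 0, 0], [0, 0,
      0, -2, 0, 0]]
     [[0, 0, 2, 0, 0, 0], [0, 0, 0, -2, 0, 0], [0, 0, 0, 0, 2, 0], [0, 0, 0, 0, 0, -2], [2, 0, 0, 0, 0, -2], [0, 2,
      -1, 0, 0, 0]] 2"
  by code_simp

lemma certificate_XZ:
  "iso_certificate 6 (int_tensor 2 3 int_V2 int_Z)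
     (int_sum 2 4 int_V2 (int_sum 2 2 (int_tensor 2 1 int_V2 (int_V1 1)) (int_tensor 2 1 int_V2 (int_V1 1))))
     [[2, 0, 0, 0, 0, 0], [0, 0, 0, 2, 0, 0], [0, 0, 2, 0, 0, 0], [-1, 0, 0, 0, 0, 2], [0, 2, 0, -2, 0, 0], [0, 0,
      0, 0, 2, 0]]
     [[2, 0, 0, 0, 0, 0], [0, 2, 0, 0, 2, 0], [0, 0, 2, 0, 0, 0], [0, 2, 0, 0, 0, 0], [0, 0, 0, 0, 0, 2], [1, 0, 0,
      2, 0, 0]] 2"
  by code_simp

lemma certificate_ZX:
  "iso_certificate 6 (int_tensor 3 2 int_Z int_V2)
     (int_sum 2 4 int_V2 (int_sum 2 2 (int_tensor 2 1 int_V2 (int_V1 1)) (int_tensor 2 1 int_V2 (int_V1 1))))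
     [[2, 0, 0, 0, 0, 0], [0, 2, 0, 0, 0, 0], [0, -2, 2, 0, 0, 0], [0, 0, 0, -2, 0, 0], [0, 0, 0, 0, 2, 0], [1, 0,
      0, 0, 0, -2]]
     [[2, 0, 0, 0, 0, 0], [0, 2, 0, 0, 0, 0], [0, 2, 2, 0, 0, 0], [0, 0, 0, -2, 0, 0], [0, 0, 0, 0, 2, 0], [1, 0,
      0, 0, 0, -2]] 2"
  by code_simp

text \<open>The module form of \<open>y z = 1 + 2 x^2\<close>. Together with
  \<open>certificate_ZY\<close>, which has the same target, it also gives
  \<open>y z = z y\<close>.\<close>

lemma certificate_YZ:
  "iso_certificate 9 (int_tensor 3 3 int_Y int_Z)
     (int_sum 1 8 (int_V1 0) (int_sum 4 4 (int_tensor 2 2 int_V2 int_V2) (int_tensor 2 2 int_V2 int_V2)))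
     [[0, 0, 1, 0, -1, 0, 1, 0, 0], [0, 0, 0, 0, 0, -2, 0, 0, 0], [0, 0, 0, -1, 0, 0, 0, 0, 2], [0, 0, 0, 0, 0, 0,
      0, 0, 2], [0, 0, 1, 0, 0, 0, 1, 0, 0], [0, 0, 0, 0, -2, 0, 2, 0, 0], [-1, 0, 0, 0, 0, 0, 0, 2, 0], [0, 0, 0,
      0, 0, 0, 0, 2, 0], [0, 1, 0, 0, 0, 0, 0, 0, 0]]
     [[0, 0, 0, 0, 0, 0, -2, 2, 0], [0, 0, 0, 0, 0, 0, 0, 0, 2], [2, 0, 0, 0, 0, -1, 0, 0, 0], [0, 0, -2, 2, 0, 0,
      0, 0, 0], [-2, 0, 0, 0, 2, 0, 0, 0, 0], [0, -1, 0, 0, 0, 0, 0, 0, 0], [-2, 0, 0, 0, 2, 1, 0, 0, 0], [0, 0, 0,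
      0, 0, 0, 0, 1, 0], [0, 0, 0, 1, 0, 0, 0, 0, 0]] 1"
  by code_simp

lemma certificate_ZY:
  "iso_certificate 9 (int_tensor 3 3 int_Z int_Y)
     (int_sum 1 8 (int_V1 0) (int_sum 4 4 (int_tensor 2 2 int_V2 int_V2) (int_tensor 2 2 int_V2 int_V2)))
     [[0, 0, -1, 0, -1, 0, 1, 0, 0], [0, 0, -2, 0, -2, 0, 0, 0, 0], [0, 0, 0, 0, 0, -2, 0, 0, 0], [-1, 0, 0, 0, 0,
      -2, 0, 0, 0], [0, 0, 0, 1, 0, 0, 0, 0, 0], [0, 0, 0, 0, 0, 0, 0, -2, 0], [0, 0, 0, 0, 0, 0, 0, 0, -2], [0, -1,
      0, 0, 0, 0, 0, 0, -2], [0, 0, -1, 0, 0, 0, 1, 0, 0]]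
     [[0, 0, 2, -2, 0, 0, 0, 0, 0], [0, 0, 0, 0, 0, 0, 2, -2, 0], [2, -1, 0, 0, 0, 0, 0, 0, -2], [0, 0, 0, 0, 2, 0,
      0, 0, 0], [-2, 0, 0, 0, 0, 0, 0, 0, 2], [0, 0, -1, 0, 0, 0, 0, 0, 0], [2, -1, 0, 0, 0, 0, 0, 0, 0], [0, 0, 0,
      0, 0, -1, 0, 0, 0], [0, 0, 0, 0, 0, 0, -1, 0, 0]] 1"
  by code_simp

text \<open>List arithmetic offers only sums and products, so the relations of
  \<open>D4_module\<close> are rewritten without subtraction.\<close>

definition module_certificate :: "nat \<Rightarrow> (D4_gen \<Rightarrow> int list list) \<Rightarrow> bool" where
  "module_certificate n R \<longleftrightarrow>
     (let p = int_mult n; a = R Gen_a; b = R Gen_b; c = R Gen_c; d = R Gen_d;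
        zero = int_diag n 0; one = int_diag n 1 in
      int_add n (p b a) (p a b) = zero \<and> int_add n (p d b) (p b d) = zero \<and>
      int_add n (p c a) (p a c) = zero \<and> int_add n (p d c) (p c d) = zero \<and>
      p b c = p c b \<and> p a a = zero \<and> p b b = one \<and> p c c = one \<and> p d d = zero \<and>
      int_add n (int_add n (p d a) (p a d)) (p b c) = one)"

lemma module_certificate:
  assumes "module_certificate n R"
  shows "D4_module (int_rep n R :: 'k :: field rep)"
proof -
  let ?m = "\<lambda>s. int_mat n n (R s) :: 'k mat"
  have zero: "int_mat n n (int_diag n 0) = (0\<^sub>m n n :: 'k mat)" and one: "int_mat n n (int_diag n 1) = (1\<^sub>m n :: 'k mat)"
    by (auto simp: int_mat_diag)
  have neg: "A = - B" if "A + B = 0\<^sub>m n n" "A \<in> carrier_mat n n" "B \<in> carrier_mat n n" for A B :: "'k mat"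
  proof (rule eq_matI)
    fix i j assume ij: "i < dim_row (- B)" "j < dim_col (- B)"
    then have "A $$ (i, j) + B $$ (i, j) = 0"
      using arg_cong [OF that(1), of "\<lambda>C. C $$ (i, j)"] that(3) by simp
    then show "A $$ (i, j) = (- B) $$ (i, j)" using that(3) ij by (simp add: eq_neg_iff_add_eq_0)
  qed (use that in auto)
  have minus: "A = 1\<^sub>m n - B" if "A + B = 1\<^sub>m n" "A \<in> carrier_mat n n" "B \<in> carrier_mat n n" for A B :: "'k mat"
    unfolding that(1) [symmetric] using that(2,3) by (intro eq_matI) auto
  have "?m s * ?m t = - (?m t * ?m s)"
    if "int_add n (int_mult n (R s) (R t)) (int_mult n (R t) (R s)) = int_diag n 0" for s t
    by (rule neg) (simp_all add: that zero mult_carrier_mat [OF int_mat_carrier int_mat_carrier]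
        flip: int_mat_add int_mat_mult)
  moreover have "int_add n (int_add n (int_mult n (R Gen_d) (R Gen_a)) (int_mult n (R Gen_a) (R Gen_d)))
      (int_mult n (R Gen_b) (R Gen_c)) = int_diag n 1"
    using assms unfolding module_certificate_def Let_def by blast
  then have "?m Gen_d * ?m Gen_a + ?m Gen_a * ?m Gen_d = 1\<^sub>m n - ?m Gen_b * ?m Gen_c"
    by (intro minus) (simp_all add: one mult_carrier_mat [OF int_mat_carrier int_mat_carrier] flip: int_mat_add int_mat_mult)
  ultimately show ?thesis
    using assms unfolding D4_module_def module_certificate_def Let_def rdim_int_rep act_int_rep
    by (simp add: zero one flip: int_mat_mult)
qed

lemma V1_eq_int_rep: "V1 r = int_rep 1 (int_V1 r)"
proof (rule rep_eqI)
  fix s show "act (V1 r) s = (act (int_rep 1 (int_V1 r)) s :: 'a mat)"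
    by (cases s) (auto simp: act_V1 int_mat_def intro!: eq_matI)
qed simp

lemma V2_eq_int_rep: "V2 0 = int_rep 2 int_V2"
proof (rule rep_eqI)
  fix s show "act (V2 0) s = (act (int_rep 2 int_V2) s :: 'a mat)"
    by (cases s) (auto simp: V2_def int_mat_def mat_of_rows_list_def less_2_cases_iff intro!: eq_matI)
qed (simp add: V2_def)

lemma D4_module_V2_0 [simp]: "D4_module (V2 0 :: 'k :: field rep)"
  unfolding V2_eq_int_rep by (rule module_certificate) code_simp

lemma D4_module_Y [simp]: "D4_module (int_rep 3 int_Y :: 'k :: field rep)"
  by (rule module_certificate) code_simp

lemma D4_module_Z [simp]: "D4_module (int_rep 3 int_Z :: 'k :: field rep)"
  by (rule module_certificate) code_simp

text \<open>The action of \<open>b\<close> is the isomorphism. On \<open>M \<otimes> V(1)\<close>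
  every generator acts by its negative, on \<open>V(1) \<otimes> M\<close> only \<open>b\<close> and
  \<open>c\<close> change sign; conjugation by \<open>b\<close> accounts for the difference, as
  \<open>b\<close> commutes with \<open>c\<close> and anticommutes with \<open>a\<close> and
  \<open>d\<close>.\<close>

lemma tensor_V1_1_comm:
  assumes M: "D4_module (M :: 'k :: field rep)"
  shows "D4_iso (tensor_rep M (V1 1)) (tensor_rep (V1 1) M)"
proof (rule D4_isoI [of "act M Gen_b" _ _ "act M Gen_b"])
  note ac = act_carrier [OF M] and m = D4_moduleD [OF M]
  have neg: "- 1 \<cdot>\<^sub>m A = - A" for A :: "'k mat" by (intro eq_matI) auto
  have prod: "act M s * act M t \<in> carrier_mat (rdim M) (rdim M)" for s t by (rule mult_carrier_mat [OF ac ac])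
  show "act M Gen_b \<in> D4_hom (tensor_rep M (V1 1)) (tensor_rep (V1 1) M)"
  proof (rule D4_homI)
    fix s
    have "act M Gen_b * - act M s = act (tensor_rep (V1 1) M) s * act M Gen_b"
      using m(1,2,5)
      by (cases s) (simp_all add: tensor_V1_left [OF M] neg uminus_mult_left_mat uminus_mult_right_mat
          carrier_matD [OF ac] carrier_matD [OF prod] del: act_tensor_rep)
    then show "act M Gen_b * act (tensor_rep M (V1 1)) s = act (tensor_rep (V1 1) M) s * act M Gen_b"
      by (simp only: tensor_V1_right [OF M] power_one_right neg)
  qed (simp add: ac)
qed (use act_carrier [OF M, of Gen_b] D4_moduleD(7) [OF M] in simp_all)

locale char_not_2 =
  fixes field_type :: "'k :: field itself"
  assumes two_nonzero: "(2 :: 'k) \<noteq> 0"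
begin

fun gen_rep :: "poly_var \<Rightarrow> 'k rep" where
  "gen_rep Var_g = V1 1"
| "gen_rep Var_x = V2 0"
| "gen_rep Var_y = int_rep 3 int_Y"
| "gen_rep Var_z = int_rep 3 int_Z"

lemma D4_module_gen_rep [simp]: "D4_module (gen_rep i)"
  by (cases i) simp_all

lemmas gen_simps = gen_rep.simps V1_eq_int_rep V2_eq_int_rep int_rep_tensor int_rep_sum

lemma tensor_gen_isos:
  shows "D4_iso (tensor_rep (V1 1) (V1 1)) (V1 0 :: 'k rep)"
    and "D4_iso (tensor_rep (tensor_rep (V2 0) (V2 0)) (V2 0)) (direct_sum_rep (direct_sum_rep (V2 0) (V2 0))
      (direct_sum_rep (tensor_rep (V2 0) (V1 1)) (tensor_rep (V2 0) (V1 1))) :: 'k rep)"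
    and "\<And>i. i \<in> {Var_y, Var_z} \<Longrightarrow> D4_iso (tensor_rep (V2 0) (gen_rep i)) (direct_sum_rep (V2 0)
      (direct_sum_rep (tensor_rep (V2 0) (V1 1)) (tensor_rep (V2 0) (V1 1))) :: 'k rep)"
    and "\<And>i. i \<in> {Var_y, Var_z} \<Longrightarrow> D4_iso (tensor_rep (gen_rep i) (V2 0)) (direct_sum_rep (V2 0)
      (direct_sum_rep (tensor_rep (V2 0) (V1 1)) (tensor_rep (V2 0) (V1 1))) :: 'k rep)"
    and "D4_iso (tensor_rep (int_rep 3 int_Y) (int_rep 3 int_Z)) (direct_sum_rep (V1 0)
      (direct_sum_rep (tensor_rep (V2 0) (V2 0)) (tensor_rep (V2 0) (V2 0))) :: 'k rep)"
    and "D4_iso (tensor_rep (int_rep 3 int_Z) (int_rep 3 int_Y)) (direct_sum_rep (V1 0)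
      (direct_sum_rep (tensor_rep (V2 0) (V2 0)) (tensor_rep (V2 0) (V2 0))) :: 'k rep)"
proof -
  have "iso_certificate 1 (int_tensor 1 1 (int_V1 1) (int_V1 1)) (int_V1 0) [[1]] [[1]] 0" by code_simp
  note c = this certificate_XXX certificate_YZ certificate_ZY
  note c' = certificate_XY certificate_XZ and c'' = certificate_YX certificate_ZX
  note [simp] = gen_simps and iso = iso_certificate [OF _ two_nonzero]
  show "D4_iso (tensor_rep (V1 1) (V1 1)) (V1 0 :: 'k rep)" using iso [OF c(1)] by simp
  show "D4_iso (tensor_rep (tensor_rep (V2 0) (V2 0)) (V2 0)) (direct_sum_rep (direct_sum_rep (V2 0) (V2 0))
      (direct_sum_rep (tensor_rep (V2 0) (V1 1)) (tensor_rep (V2 0) (V1 1))) :: 'k rep)" using iso [OF c(2)] by simp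
  show "D4_iso (tensor_rep (int_rep 3 int_Y) (int_rep 3 int_Z)) (direct_sum_rep (V1 0)
      (direct_sum_rep (tensor_rep (V2 0) (V2 0)) (tensor_rep (V2 0) (V2 0))) :: 'k rep)" using iso [OF c(3)] by simp
  show "D4_iso (tensor_rep (int_rep 3 int_Z) (int_rep 3 int_Y)) (direct_sum_rep (V1 0)
      (direct_sum_rep (tensor_rep (V2 0) (V2 0)) (tensor_rep (V2 0) (V2 0))) :: 'k rep)" using iso [OF c(4)] by simp
  fix i assume "i \<in> {Var_y, Var_z}"
  then show "D4_iso (tensor_rep (V2 0) (gen_rep i)) (direct_sum_rep (V2 0)
      (direct_sum_rep (tensor_rep (V2 0) (V1 1)) (tensor_rep (V2 0) (V1 1))) :: 'k rep)"
    "D4_iso (tensor_rep (gen_rep i) (V2 0)) (direct_sum_rep (V2 0)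
      (direct_sum_rep (tensor_rep (V2 0) (V1 1)) (tensor_rep (V2 0) (V1 1))) :: 'k rep)"
    using c' [THEN iso] c'' [THEN iso] by auto
qed

definition gen_class :: "poly_var \<Rightarrow> 'k rep set" where
  "gen_class i = iso_class (gen_rep i)"

lemma tensor_gen_class:
  shows "tensor_class (gen_class Var_g) (gen_class Var_g) = iso_class (V1 0)"
    and "tensor_class (tensor_class (gen_class Var_x) (gen_class Var_x)) (gen_class Var_x)
      = iso_class (direct_sum_rep (direct_sum_rep (V2 0) (V2 0))
      (direct_sum_rep (tensor_rep (V2 0) (V1 1)) (tensor_rep (V2 0) (V1 1))))"
    and "\<And>i. i \<in> {Var_y, Var_z} \<Longrightarrow> tensor_class (gen_class Var_x) (gen_class i)
      = iso_class (direct_sum_rep (V2 0) (direct_sum_rep (tensor_rep (V2 0) (V1 1)) (tensor_rep (V2 0) (V1 1))))"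
    and "\<And>i. i \<in> {Var_y, Var_z} \<Longrightarrow> tensor_class (gen_class i) (gen_class Var_x)
      = iso_class (direct_sum_rep (V2 0) (direct_sum_rep (tensor_rep (V2 0) (V1 1)) (tensor_rep (V2 0) (V1 1))))"
    and "tensor_class (gen_class Var_y) (gen_class Var_z)
      = iso_class (direct_sum_rep (V1 0) (direct_sum_rep (tensor_rep (V2 0) (V2 0)) (tensor_rep (V2 0) (V2 0))))"
    and "tensor_class (gen_class Var_z) (gen_class Var_y)
      = iso_class (direct_sum_rep (V1 0) (direct_sum_rep (tensor_rep (V2 0) (V2 0)) (tensor_rep (V2 0) (V2 0))))"
  using tensor_gen_isos unfolding gen_class_def
  by (simp_all add: iso_class_eq_iff del: gen_rep.simps(3,4)) (simp_all add: iso_class_eq_iff)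

text \<open>\<open>g\<close> commutes with all classes through the action of \<open>b\<close>; for
  the pairs among \<open>x\<close>, \<open>y\<close>, \<open>z\<close> both products were identified
  with one explicit module.\<close>

sublocale commuting_classes gen_class
proof
  fix i j
  show "gen_class i \<in> iso_classes" by (simp add: gen_class_def)
  have g: "tensor_class (gen_class i) (gen_class Var_g) = tensor_class (gen_class Var_g) (gen_class i)" for i
    using tensor_V1_1_comm [of "gen_rep i"] by (simp add: gen_class_def iso_class_eq_iff)
  show "tensor_class (gen_class i) (gen_class j) = tensor_class (gen_class j) (gen_class i)"
  proof -
    have x: "tensor_class (gen_class Var_x) (gen_class i) = tensor_class (gen_class i) (gen_class Var_x)"
      if "i \<in> {Var_y, Var_z}" for i
      by (simp only: tensor_gen_class(3,4) [OF that])
    have yz: "tensor_class (gen_class Var_y) (gen_class Var_z) = tensor_class (gen_class Var_z) (gen_class Var_y)"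
      by (simp only: tensor_gen_class(5,6))
    show ?thesis
      by (cases i; cases j; hypsubst) (rule refl g g [symmetric] x x [symmetric] yz yz [symmetric]; simp)+
  qed
qed

end

section \<open>Syzygies of the trivial module\<close>

text \<open>A linear left inverse exists on the space of functions; its values at the unit vectors,
  cut to the first \<open>n\<close> coordinates, form the columns of \<open>L\<close>.\<close>

lemma inj_left_inverse:
  fixes A :: "'k :: field mat"
  assumes "mat_inj A" "A \<in> carrier_mat m n"
  obtains L where "L \<in> carrier_mat n m" "L * A = 1\<^sub>m n"
proof -
  interpret vector_space_pair "fun_scale :: 'k \<Rightarrow> _" "fun_scale :: 'k \<Rightarrow> _" ..
  let ?S = "vec_fun ` (carrier_vec n :: 'k vec set)"
  have "is_subspace n (carrier_vec n :: 'k vec set)" by (auto simp: is_subspace_def)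
  then have span: "fun_vs.span ?S = ?S" by (simp add: fun_vs.span_eq_iff subspace_vec_fun)
  have "inj_on (mat_fun A) (fun_vs.span ?S)"
    unfolding span
  proof (rule inj_onI, clarify)
    fix v w :: "'k vec" assume vw: "v \<in> carrier_vec n" "w \<in> carrier_vec n"
      and "mat_fun A (vec_fun v) = mat_fun A (vec_fun w)"
    then have "vec_fun (A *\<^sub>v v) = vec_fun (A *\<^sub>v w)" by (simp add: vec_fun_mult [OF assms(2)])
    then have "A *\<^sub>v v = A *\<^sub>v w"
      using vec_fun_eq_iff [OF vw [THEN mult_mat_vec_carrier [OF assms(2)]]] by (rule iffD1 [rotated])
    then show "vec_fun v = vec_fun w" using mult_mat_vec_eq_iff_inj [OF assms vw] by simp
  qed
  then obtain g where g: "Vector_Spaces.linear fun_scale fun_scale g" "\<And>x. x \<in> ?S \<Longrightarrow> g (mat_fun A x) = x"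
    using linear_inj_on_left_inverse [OF linear_mat_fun, of A ?S] unfolding span by blast
  interpret g: Vector_Spaces.linear fun_scale fun_scale g by (rule g(1))
  define L where "L = mat n m (\<lambda>(i, j). g (vec_fun (unit_vec m j)) i)"
  have L: "L \<in> carrier_mat n m" by (simp add: L_def)
  have "L * A = 1\<^sub>m n"
  proof (rule eq_matI)
    fix i j assume "i < dim_row (1\<^sub>m n :: 'k mat)" "j < dim_col (1\<^sub>m n :: 'k mat)"
    then have ij: "i < n" "j < n" by auto
    have "mat_fun A (vec_fun (unit_vec n j)) = (\<Sum>k<m. fun_scale (A $$ (k, j)) (vec_fun (unit_vec m k)))"
    proof
      fix l
      have "mat_fun A (vec_fun (unit_vec n j)) l = (if l < m then A $$ (l, j) else 0)"
        using vec_fun_mult [OF assms(2) unit_vec_carrier, of j, symmetric] assms(2) ij by (simp add: vec_fun_def)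
      also have "\<dots> = (\<Sum>k<m. if l = k then A $$ (k, j) else 0)" by simp
      also have "\<dots> = (\<Sum>k<m. fun_scale (A $$ (k, j)) (vec_fun (unit_vec m k))) l"
        unfolding sum_apply by (rule sum.cong) (auto simp: fun_scale_def vec_fun_def)
      finally show "mat_fun A (vec_fun (unit_vec n j)) l = (\<Sum>k<m. fun_scale (A $$ (k, j)) (vec_fun (unit_vec m k))) l" .
    qed
    then have "vec_fun (unit_vec n j) = (\<Sum>k<m. fun_scale (A $$ (k, j)) (g (vec_fun (unit_vec m k))))"
      using g(2) [of "vec_fun (unit_vec n j)"] by (simp add: g.sum g.scale)
    then have "vec_fun (unit_vec n j) i = (\<Sum>k<m. A $$ (k, j) * g (vec_fun (unit_vec m k)) i)"
      by (simp add: sum_apply fun_scale_def)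
    also have "\<dots> = (L * A) $$ (i, j)"
      using assms(2) ij by (auto simp: L_def scalar_prod_def atLeast0LessThan mult.commute intro!: sum.cong)
    finally show "(L * A) $$ (i, j) = 1\<^sub>m n $$ (i, j)" using ij by (simp add: vec_fun_def)
  qed (use L assms in auto)
  with L show thesis by (rule that)
qed

text \<open>Injectivity is the existence of a left inverse, surjectivity that of a right inverse,
  and transposition exchanges the two.\<close>

lemma mat_inj_transpose_iff [simp]: "mat_inj (transpose_mat A) \<longleftrightarrow> mat_surj (A :: 'k :: field mat)"
proof
  have c: "A \<in> carrier_mat (dim_row A) (dim_col A)" by auto
  assume "mat_inj (transpose_mat A)"
  then obtain L where L: "L \<in> carrier_mat (dim_row A) (dim_col A)" "L * transpose_mat A = 1\<^sub>m (dim_row A)"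
    by (rule inj_left_inverse) auto
  then have "A * transpose_mat L = 1\<^sub>m (dim_row A)"
    using transpose_mult [OF L(1), of "transpose_mat A" "dim_row A"] by simp
  then show "mat_surj A" using mat_surjI [OF c, of "transpose_mat L"] L by simp
next
  have c: "A \<in> carrier_mat (dim_row A) (dim_col A)" by auto
  assume "mat_surj A"
  then obtain g where g: "g \<in> carrier_mat (dim_col A) (dim_row A)" "A * g = 1\<^sub>m (dim_row A)"
    using c by (rule mat_surj_right_inverse)
  then have "transpose_mat g * transpose_mat A = 1\<^sub>m (dim_row A)"
    using transpose_mult [OF c g(1)] by simp
  then show "mat_inj (transpose_mat A)" using mat_injI [of "transpose_mat A" "dim_col A" "dim_row A" "transpose_mat g"] g by simp
qed

lemma mat_surj_transpose_iff [simp]: "mat_surj (transpose_mat A) \<longleftrightarrow> mat_inj (A :: 'k :: field mat)"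
  using mat_inj_transpose_iff [of "transpose_mat A"] by simp

text \<open>Transposition preserves exactness. If \<open>x\<close> vanishes on the image of
  \<open>j\<close>, hence on the kernel of \<open>p\<close>, and \<open>r\<close> is a right inverse
  of \<open>p\<close>, then \<open>x = p\<^sup>T r\<^sup>T x\<close>, because
  \<open>r p u - u\<close> lies in that kernel for every \<open>u\<close>.\<close>

lemma mat_kernel_transpose:
  fixes p :: "'k :: field mat"
  assumes p: "mat_surj p" "p \<in> carrier_mat m n" and j: "j \<in> carrier_mat n l" and ex: "mat_image j = mat_kernel p"
  shows "mat_kernel (transpose_mat j) = mat_image (transpose_mat p)"
proof -
  obtain r where r: "r \<in> carrier_mat n m" "p * r = 1\<^sub>m m" using mat_surj_right_inverse [OF p] .
  have pj: "p * j = 0\<^sub>m m l"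
  proof (rule mat_eqI_vec)
    fix v :: "'k vec" assume v: "v \<in> carrier_vec l"
    then have "j *\<^sub>v v \<in> mat_kernel p" using j by (auto simp: mat_image_def simp flip: ex)
    then have "p *\<^sub>v (j *\<^sub>v v) = 0\<^sub>v m" using p(2) by (auto simp: mat_kernel_def)
    then show "p * j *\<^sub>v v = 0\<^sub>m m l *\<^sub>v v"
      using v p j by (simp add: assoc_mult_mat_vec [OF p(2) j v]) (auto intro!: eq_vecI)
  qed (use p j in auto)
  show ?thesis
  proof (intro equalityI subsetI)
    fix x assume "x \<in> mat_kernel (transpose_mat j)"
    then have x: "x \<in> carrier_vec n" "transpose_mat j *\<^sub>v x = 0\<^sub>v l" using j by (auto simp: mat_kernel_def)
    have vanish: "x \<bullet> (j *\<^sub>v v) = 0" if "v \<in> carrier_vec l" for v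
    proof -
      have "x \<bullet> (j *\<^sub>v v) = (transpose_mat j *\<^sub>v x) \<bullet> v"
        using x(1) j that by (metis transpose_vec_mult_scalar carrier_matD)
      then show ?thesis using x(2) that by simp
    qed
    have "transpose_mat p *\<^sub>v (transpose_mat r *\<^sub>v x) = x"
    proof (rule eq_vecI)
      fix i assume "i < dim_vec x"
      then have i: "i < n" using x by auto
      let ?w = "r *\<^sub>v (p *\<^sub>v unit_vec n i) - unit_vec n i"
      have pu: "p *\<^sub>v unit_vec n i \<in> carrier_vec m" using p(2) by auto
      have "p *\<^sub>v ?w = p *\<^sub>v (r *\<^sub>v (p *\<^sub>v unit_vec n i)) - p *\<^sub>v unit_vec n i"
        using p r by (intro mult_minus_distrib_mat_vec) auto
      also have "\<dots> = 0\<^sub>v m"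
        unfolding assoc_mult_mat_vec [OF p(2) r(1) pu, symmetric] r(2) using pu by simp
      finally have "?w \<in> mat_kernel p" using p r by (auto simp: mat_kernel_def)
      then obtain v where v: "v \<in> carrier_vec l" "?w = j *\<^sub>v v" using j by (auto simp: mat_image_def simp flip: ex)
      have "x \<bullet> ?w = 0" unfolding v(2) by (rule vanish [OF v(1)])
      then have "x \<bullet> (r *\<^sub>v (p *\<^sub>v unit_vec n i)) = x \<bullet> unit_vec n i"
        using scalar_prod_minus_distrib [OF x(1), of "r *\<^sub>v (p *\<^sub>v unit_vec n i)" "unit_vec n i"] r pu by auto
      also have "x \<bullet> (r *\<^sub>v (p *\<^sub>v unit_vec n i)) = (transpose_mat p *\<^sub>v (transpose_mat r *\<^sub>v x)) \<bullet> unit_vec n i"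
        using x(1) p(2) r(1) pu transpose_vec_mult_scalar [OF r(1) pu x(1)]
          transpose_vec_mult_scalar [OF p(2), of "unit_vec n i" "transpose_mat r *\<^sub>v x"] by auto
      finally show "(transpose_mat p *\<^sub>v (transpose_mat r *\<^sub>v x)) $ i = x $ i"
        using i x(1) p(2) r(1) by (simp add: scalar_prod_right_unit)
    qed (use p x in auto)
    then show "x \<in> mat_image (transpose_mat p)"
      using p(2) r(1) x(1) by (auto simp: mat_image_def intro!: rev_image_eqI [of "transpose_mat r *\<^sub>v x"])
  next
    fix x assume "x \<in> mat_image (transpose_mat p)"
    then obtain y where y: "y \<in> carrier_vec m" "x = transpose_mat p *\<^sub>v y" using p by (auto simp: mat_image_def)
    have "transpose_mat j *\<^sub>v x = transpose_mat (p * j) *\<^sub>v y"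
      unfolding y(2) transpose_mult [OF p(2) j] using p j y by (intro assoc_mult_mat_vec [symmetric]) auto
    also have "\<dots> = 0\<^sub>v l" unfolding pj using y by (intro eq_vecI) auto
    finally show "x \<in> mat_kernel (transpose_mat j)" using y p j by (auto simp: mat_kernel_def)
  qed
qed

section \<open>Duality by transposed matrices\<close>

definition dual_rep :: "'k :: field rep \<Rightarrow> 'k rep" where
  "dual_rep M = Rep (rdim M) (\<lambda>s. transpose_mat (act M s))"

lemma rdim_dual_rep [simp]: "rdim (dual_rep M) = rdim M"
  and act_dual_rep [simp]: "act (dual_rep M) s = transpose_mat (act M s)"
  by (simp_all add: dual_rep_def)

lemma dual_dual_rep [simp]: "dual_rep (dual_rep M) = M"
  by (rule rep_eqI) simp_all

text \<open>The defining relations are invariant under reversing products, so no antipode is needed.\<close>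

lemma D4_module_dual_rep [simp]:
  assumes M: "D4_module M"
  shows "D4_module (dual_rep M)"
proof -
  note ac = act_carrier [OF M] and m = D4_moduleD [OF M]
  note prod = mult_carrier_mat [OF ac ac]
  have t: "transpose_mat (act M s) * transpose_mat (act M t) = transpose_mat (act M t * act M s)" for s t
    by (rule transpose_mult [OF ac ac, symmetric])
  have neg: "transpose_mat (- A) = - transpose_mat A" for A :: "'a mat" by (intro eq_matI) auto
  have minus: "transpose_mat (A - B) = transpose_mat A - transpose_mat B"
    if "A \<in> carrier_mat k k" "B \<in> carrier_mat k k" for A B :: "'a mat" and k using that by (intro eq_matI) auto
  have one: "transpose_mat (1\<^sub>m k) = 1\<^sub>m k" and zero: "transpose_mat (0\<^sub>m k k) = 0\<^sub>m k k" for k by auto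
  have "transpose_mat (act M Gen_d) * transpose_mat (act M Gen_a) + transpose_mat (act M Gen_a) * transpose_mat (act M Gen_d)
      = transpose_mat (act M Gen_d * act M Gen_a + act M Gen_a * act M Gen_d)"
    unfolding t transpose_add [OF prod prod] by (rule comm_add_mat [of _ "rdim M" "rdim M"]) (simp_all add: prod)
  also have "\<dots> = 1\<^sub>m (rdim M) - transpose_mat (act M Gen_b * act M Gen_c)"
    unfolding m(10) using minus [OF one_carrier_mat prod] one by simp
  finally have 1: "transpose_mat (act M Gen_d) * transpose_mat (act M Gen_a) + transpose_mat (act M Gen_a) * transpose_mat (act M Gen_d)
      = 1\<^sub>m (rdim M) - transpose_mat (act M Gen_b) * transpose_mat (act M Gen_c)"
    using m(5) t by metis
  have neg': "- (- transpose_mat A) = transpose_mat A" for A :: "'a mat" by (intro eq_matI) auto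
  show ?thesis
    unfolding D4_module_def Let_def rdim_dual_rep act_dual_rep
    using m(1-9) 1 ac by (simp add: t neg neg' one zero)
qed

lemma D4_hom_transpose:
  assumes "f \<in> D4_hom M N" "D4_module M" "D4_module N"
  shows "transpose_mat f \<in> D4_hom (dual_rep N) (dual_rep M)"
proof (rule D4_homI)
  note f = D4_homD [OF assms(1)]
  show "transpose_mat f \<in> carrier_mat (rdim (dual_rep M)) (rdim (dual_rep N))" using f(1) by simp
  fix s show "transpose_mat f * act (dual_rep N) s = act (dual_rep M) s * transpose_mat f"
    using transpose_mult [OF f(1) act_carrier [OF assms(2)], of s]
      transpose_mult [OF act_carrier [OF assms(3)] f(1), of s] f(2) [of s] by simp
qed

text \<open>Transposition reverses arrows and exchanges injective with surjective maps, so the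
  extension problem becomes the lifting problem that \<open>P\<close> solves. The three lemmas that
  follow translate in the same way.\<close>

lemma D4_injective_dual:
  assumes "D4_projective P"
  shows "D4_injective (dual_rep P)"
  unfolding D4_injective_def
proof (intro conjI allI ballI impI)
  have P: "D4_module P" using assms by (simp add: D4_projective_def)
  show "D4_module (dual_rep P)" using P by simp
  fix M N f g
  assume f: "f \<in> D4_hom M N" and g: "g \<in> D4_hom M (dual_rep P)" and "D4_module M \<and> D4_module N \<and> mat_inj f"
  then have M: "D4_module M" and N: "D4_module N" and inj: "mat_inj f" by auto
  have "transpose_mat g \<in> D4_hom P (dual_rep M)" using D4_hom_transpose [OF g M] P by simp
  moreover have "transpose_mat f \<in> D4_hom (dual_rep N) (dual_rep M)" using D4_hom_transpose [OF f M N] .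
  ultimately obtain h where h: "h \<in> D4_hom P (dual_rep N)" "transpose_mat f * h = transpose_mat g"
    using assms M N inj unfolding D4_projective_def by (metis D4_module_dual_rep mat_surj_transpose_iff)
  have "transpose_mat h * f = g"
    using transpose_mult [of "transpose_mat f" "rdim M" "rdim N" h "rdim P"] h D4_homD(1) [OF f] D4_homD(1) [OF h(1)] by simp
  moreover have "transpose_mat h \<in> D4_hom N (dual_rep P)" using D4_hom_transpose [OF h(1) P] N by simp
  ultimately show "\<exists>h \<in> D4_hom N (dual_rep P). h * f = g" by blast
qed

lemma D4_projective_dual:
  assumes "D4_injective I"
  shows "D4_projective (dual_rep I)"
  unfolding D4_projective_def
proof (intro conjI allI ballI impI)
  have I: "D4_module I" using assms by (simp add: D4_injective_def)
  show "D4_module (dual_rep I)" using I by simp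
  fix M N f g
  assume f: "f \<in> D4_hom M N" and g: "g \<in> D4_hom (dual_rep I) N" and "D4_module M \<and> D4_module N \<and> mat_surj f"
  then have M: "D4_module M" and N: "D4_module N" and surj: "mat_surj f" by auto
  have "transpose_mat g \<in> D4_hom (dual_rep N) I" using D4_hom_transpose [OF g _ N] I by simp
  moreover have "transpose_mat f \<in> D4_hom (dual_rep N) (dual_rep M)" using D4_hom_transpose [OF f M N] .
  ultimately obtain h where h: "h \<in> D4_hom (dual_rep M) I" "h * transpose_mat f = transpose_mat g"
    using assms M N surj unfolding D4_injective_def by (metis D4_module_dual_rep mat_inj_transpose_iff)
  have "f * transpose_mat h = g"
    using transpose_mult [of h "rdim I" "rdim M" "transpose_mat f" "rdim N"] h D4_homD(1) [OF f] D4_homD(1) [OF h(1)] by simp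
  moreover have "transpose_mat h \<in> D4_hom (dual_rep I) M" using D4_hom_transpose [OF h(1) _ I] M by simp
  ultimately show "\<exists>h \<in> D4_hom (dual_rep I) M. f * h = g" by blast
qed

lemma projective_cover_dual:
  assumes "injective_envelope M I i" and M: "D4_module M"
  shows "projective_cover (dual_rep M) (dual_rep I) (transpose_mat i)"
  unfolding projective_cover_def
proof (intro conjI allI ballI impI)
  have inj: "D4_injective I" and i: "i \<in> D4_hom M I" "mat_inj i"
    and ess: "\<And>T h. h \<in> D4_hom I T \<Longrightarrow> D4_module T \<Longrightarrow> mat_inj (h * i) \<Longrightarrow> mat_inj h"
    using assms by (auto simp: injective_envelope_def)
  have I: "D4_module I" using inj by (simp add: D4_injective_def)
  show "D4_projective (dual_rep I)" using inj by (rule D4_projective_dual)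
  show "transpose_mat i \<in> D4_hom (dual_rep I) (dual_rep M)" by (rule D4_hom_transpose [OF i(1) M I])
  show "mat_surj (transpose_mat i)" using i by simp
  fix T h assume h: "h \<in> D4_hom T (dual_rep I)" and "D4_module T \<and> mat_surj (transpose_mat i * h)"
  then have T: "D4_module T" and surj: "mat_surj (transpose_mat i * h)" by auto
  have "transpose_mat (transpose_mat h * i) = transpose_mat i * h"
    using transpose_mult [of "transpose_mat h" "rdim T" "rdim I" i "rdim M"] D4_homD(1) [OF h] D4_homD(1) [OF i(1)] by simp
  then have "mat_inj (transpose_mat h * i)" using surj by (metis mat_surj_transpose_iff)
  then have "mat_inj (transpose_mat h)"
    using ess [of "transpose_mat h" "dual_rep T"] D4_hom_transpose [OF h T] I T by simp
  then show "mat_surj h" by simp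
qed

lemma injective_envelope_dual:
  assumes "projective_cover M P p" and M: "D4_module M"
  shows "injective_envelope (dual_rep M) (dual_rep P) (transpose_mat p)"
  unfolding injective_envelope_def
proof (intro conjI allI ballI impI)
  have proj: "D4_projective P" and p: "p \<in> D4_hom P M" "mat_surj p"
    and ess: "\<And>T h. h \<in> D4_hom T P \<Longrightarrow> D4_module T \<Longrightarrow> mat_surj (p * h) \<Longrightarrow> mat_surj h"
    using assms by (auto simp: projective_cover_def)
  have P: "D4_module P" using proj by (simp add: D4_projective_def)
  show "D4_injective (dual_rep P)" using proj by (rule D4_injective_dual)
  show "transpose_mat p \<in> D4_hom (dual_rep M) (dual_rep P)" by (rule D4_hom_transpose [OF p(1) P M])
  show "mat_inj (transpose_mat p)" using p by simp
  fix T h assume h: "h \<in> D4_hom (dual_rep P) T" and "D4_module T \<and> mat_inj (h * transpose_mat p)"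
  then have T: "D4_module T" and inj: "mat_inj (h * transpose_mat p)" by auto
  have "transpose_mat (p * transpose_mat h) = h * transpose_mat p"
    using transpose_mult [of p "rdim M" "rdim P" "transpose_mat h" "rdim T"] D4_homD(1) [OF h] D4_homD(1) [OF p(1)] by simp
  then have "mat_surj (p * transpose_mat h)" using inj by (metis mat_inj_transpose_iff)
  then have "mat_surj (transpose_mat h)"
    using ess [of "transpose_mat h" "dual_rep T"] D4_hom_transpose [OF h _ T] P T by simp
  then show "mat_inj h" by simp
qed

lemma is_syzygy_dual:
  assumes "is_cosyzygy M C" and M: "D4_module M"
  shows "is_syzygy (dual_rep M) (dual_rep C)"
proof -
  obtain I i q where C: "D4_module C" and I: "injective_envelope M I i"
    and q: "q \<in> D4_hom I C" "mat_surj q" "mat_kernel q = mat_image i"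
    using assms by (auto simp: is_cosyzygy_def)
  have "D4_module I" "i \<in> D4_hom M I" using I by (auto simp: injective_envelope_def D4_injective_def)
  then show ?thesis
    unfolding is_syzygy_def
    using C projective_cover_dual [OF I M] D4_hom_transpose [OF q(1)]  q(2)
      mat_kernel_transpose [OF q(2) D4_homD(1) [OF q(1)] D4_homD(1) [of i M I]] q(3)
    by (metis D4_module_dual_rep mat_inj_transpose_iff)
qed

lemma is_cosyzygy_dual:
  assumes "is_syzygy M K" and M: "D4_module M"
  shows "is_cosyzygy (dual_rep M) (dual_rep K)"
proof -
  obtain P p j where K: "D4_module K" and P: "projective_cover M P p"
    and j: "j \<in> D4_hom K P" "mat_inj j" "mat_image j = mat_kernel p"
    using assms by (auto simp: is_syzygy_def)
  have "D4_module P" "p \<in> D4_hom P M" "mat_surj p" using P by (auto simp: projective_cover_def D4_projective_def)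
  then show ?thesis
    unfolding is_cosyzygy_def
    using K injective_envelope_dual [OF P M] D4_hom_transpose [OF j(1)] j(2)
      mat_kernel_transpose [OF _ D4_homD(1) [of p P M] D4_homD(1) [OF j(1)] j(3)]
    by (metis D4_module_dual_rep mat_surj_transpose_iff)
qed

lemma mat_factor:
  fixes A B :: "'k :: field mat"
  assumes A: "A \<in> carrier_mat m n" and B: "B \<in> carrier_mat m l"
    and im: "\<And>v. v \<in> carrier_vec n \<Longrightarrow> A *\<^sub>v v \<in> mat_image B"
  obtains C where "C \<in> carrier_mat l n" "A = B * C"
proof -
  have "\<exists>w \<in> carrier_vec l. B *\<^sub>v w = A *\<^sub>v unit_vec n j" for j
    using im [of "unit_vec n j"] B by (force simp: mat_image_def)
  then obtain h where h: "\<And>j. h j \<in> carrier_vec l" "\<And>j. B *\<^sub>v h j = A *\<^sub>v unit_vec n j" by metis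
  define C where "C = mat l n (\<lambda>(i, j). h j $ i)"
  have C: "C \<in> carrier_mat l n" by (simp add: C_def)
  have "A = B * C"
  proof (rule eq_matI)
    fix i j assume "i < dim_row (B * C)" "j < dim_col (B * C)"
    then have ij: "i < m" "j < n" using B C by auto
    have "col C j = h j" using h(1) [of j] ij by (intro eq_vecI) (auto simp: C_def)
    then have "(B * C) $$ (i, j) = (B *\<^sub>v h j) $ i" using B C ij by simp
    then show "A $$ (i, j) = (B * C) $$ (i, j)" using h(2) A ij by simp
  qed (use A B C in auto)
  with C show thesis by (rule that)
qed

lemma mat_inj_cancel:
  fixes A B C :: "'k :: field mat"
  assumes "mat_inj A" "A \<in> carrier_mat m n" "B \<in> carrier_mat n l" "C \<in> carrier_mat n l" "A * B = A * C"
  shows "B = C"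
proof -
  obtain L where L: "L \<in> carrier_mat n m" "L * A = 1\<^sub>m n" using inj_left_inverse [OF assms(1,2)] .
  have "L * (A * B) = B" "L * (A * C) = C"
    using assoc_mult_mat [OF L(1) assms(2,3)] assoc_mult_mat [OF L(1) assms(2,4)] L(2) assms(3,4) by auto
  then show ?thesis unfolding assms(5) by metis
qed

text \<open>Both sides of the intertwining equation agree after composition with the injective
  \<open>j\<close>, so a factor found by linear algebra alone is a homomorphism.\<close>

lemma D4_homI_cancel:
  assumes j: "j \<in> D4_hom K P" "mat_inj j" and f: "f \<in> carrier_mat (rdim K) (rdim L)" "j * f \<in> D4_hom L P"
    and mods: "D4_module K" "D4_module L" "D4_module P"
  shows "f \<in> D4_hom L K"
proof (rule D4_homI [OF f(1)])
  note jc = D4_homD [OF j(1)] and jf = D4_homD [OF f(2)]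
  note ak = act_carrier [OF mods(1)] and al = act_carrier [OF mods(2)] and ap = act_carrier [OF mods(3)]
  fix s
  have "j * (f * act L s) = act P s * (j * f)"
    using assoc_mult_mat [OF jc(1) f(1) al] jf(2) by simp
  also have "\<dots> = j * (act K s * f)"
    using assoc_mult_mat [OF ap jc(1) f(1), of s] jc(2) [of s] assoc_mult_mat [OF jc(1) ak f(1), of s] by simp
  finally show "f * act L s = act K s * f"
    by (rule mat_inj_cancel [OF j(2) jc(1) mult_carrier_mat [OF f(1) al] mult_carrier_mat [OF ak f(1)]])
qed

text \<open>Projectivity of \<open>P\<close> lifts \<open>p\<close> through \<open>q\<close> to
  \<open>h\<close>. Essentiality of \<open>q\<close> makes \<open>h\<close> surjective, so it has a
  section \<open>s\<close> as \<open>Q\<close> is projective, and essentiality of \<open>p\<close>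
  makes \<open>s\<close> surjective too.\<close>

lemma projective_cover_unique:
  assumes P: "projective_cover M P p" and Q: "projective_cover M Q q" and M: "D4_module M"
  obtains h s where "h \<in> D4_hom P Q" "s \<in> D4_hom Q P" "q * h = p" "p * s = q"
    "h * s = 1\<^sub>m (rdim Q)" "s * h = 1\<^sub>m (rdim P)"
proof -
  have Pm: "D4_projective P" "D4_module P" "p \<in> D4_hom P M" "mat_surj p" and Qm: "D4_projective Q" "D4_module Q" "q \<in> D4_hom Q M" "mat_surj q"
    using P Q by (auto simp: projective_cover_def D4_projective_def)
  obtain h where h: "h \<in> D4_hom P Q" "q * h = p"
    using Pm Qm M unfolding D4_projective_def by blast
  have "mat_surj h" using Q h Pm unfolding projective_cover_def by blast
  then obtain s where s: "s \<in> D4_hom Q P" "h * s = 1\<^sub>m (rdim Q)"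
    using Qm(1) h(1) Pm(2) Qm(2) unfolding D4_projective_def by (metis D4_hom_one)
  note c = D4_homD(1) [OF h(1)] D4_homD(1) [OF s(1)] D4_homD(1) [OF Pm(3)] D4_homD(1) [OF Qm(3)]
  have ps: "p * s = q" using assoc_mult_mat [OF c(4,1,2)] h(2) s(2) c(4) by simp
  then have "mat_surj s" using P s(1) Qm unfolding projective_cover_def by metis
  then obtain r where r: "r \<in> carrier_mat (rdim Q) (rdim P)" "s * r = 1\<^sub>m (rdim P)"
    using c(2) by (rule mat_surj_right_inverse)
  \<comment> \<open>A right inverse \<open>r\<close> of \<open>s\<close> must be \<open>h\<close>
    itself, which turns the section into a two-sided inverse.\<close>
  have "h = h * (s * r)" using r c by simp
  also have "\<dots> = r" using assoc_mult_mat [OF c(1,2) r(1)] s(2) r(1) by simp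
  finally have "s * h = 1\<^sub>m (rdim P)" using r(2) by simp
  with h s ps show thesis by (intro that)
qed

lemma syzygy_unique:
  assumes "is_syzygy M K" "is_syzygy M L" "D4_module M"
  shows "D4_iso K L"
proof -
  obtain P p j where K: "D4_module K" and P: "projective_cover M P p"
    and j: "j \<in> D4_hom K P" "mat_inj j" "mat_image j = mat_kernel p"
    using assms(1) by (auto simp: is_syzygy_def)
  obtain Q q k where L: "D4_module L" and Q: "projective_cover M Q q"
    and k: "k \<in> D4_hom L Q" "mat_inj k" "mat_image k = mat_kernel q"
    using assms(2) by (auto simp: is_syzygy_def)
  have Pm: "D4_module P" "p \<in> D4_hom P M" and Qm: "D4_module Q" "q \<in> D4_hom Q M"
    using P Q by (auto simp: projective_cover_def D4_projective_def)
  obtain h s where hs: "h \<in> D4_hom P Q" "s \<in> D4_hom Q P" "q * h = p" "p * s = q"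
    "h * s = 1\<^sub>m (rdim Q)" "s * h = 1\<^sub>m (rdim P)"
    using projective_cover_unique [OF P Q assms(3)] .
  \<comment> \<open>A map of covers that respects the maps to \<open>M\<close> restricts to the
    kernels. The general form serves for \<open>h\<close> and for \<open>s\<close>.\<close>
  have lift: "\<exists>f \<in> D4_hom A B. j' * f = h' * i'"
    if "D4_module A" "D4_module B" "D4_module A'" "D4_module B'" "i' \<in> D4_hom A A'" "j' \<in> D4_hom B B'" "mat_inj j'"
      "mat_image j' = mat_kernel q'" "h' \<in> D4_hom A' B'" "q' \<in> D4_hom B' M" "mat_image i' = mat_kernel (q' * h')"
    for A B A' B' i' j' q' h'
  proof -
    note c = that(5,6,9,10) [THEN D4_homD(1)]
    have "h' * i' *\<^sub>v v \<in> mat_image j'" if v: "v \<in> carrier_vec (rdim A)" for v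
    proof -
      have iv: "i' *\<^sub>v v \<in> carrier_vec (rdim A')" using c(1) v by auto
      have "i' *\<^sub>v v \<in> mat_kernel (q' * h')" unfolding \<open>mat_image i' = _\<close> [symmetric] using c(1) v by (auto simp: mat_image_def)
      then have "q' *\<^sub>v (h' *\<^sub>v (i' *\<^sub>v v)) = 0\<^sub>v (rdim M)"
        using c assoc_mult_mat_vec [OF c(4,3) iv] by (simp add: mat_kernel_def)
      then show ?thesis unfolding \<open>mat_image j' = _\<close> assoc_mult_mat_vec [OF c(3,1) v]
        using c iv by (auto simp: mat_kernel_def)
    qed
    then obtain f where f: "f \<in> carrier_mat (rdim B) (rdim A)" "h' * i' = j' * f"
      using mat_factor [OF mult_carrier_mat [OF c(3,1)] c(2)] by metis
    have "f \<in> D4_hom A B"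
      using D4_homI_cancel [OF that(6,7) f(1)] f(2) D4_hom_comp [OF that(5,9)] that(1-4) by simp
    with f(2) show ?thesis by auto
  qed
  obtain f where f: "f \<in> D4_hom K L" "k * f = h * j"
    using lift [OF K L Pm(1) Qm(1) j(1) k(1,2,3) hs(1) Qm(2)] j(3) hs(3) by auto
  obtain g where g: "g \<in> D4_hom L K" "j * g = s * k"
    using lift [OF L K Qm(1) Pm(1) k(1) j(1,2,3) hs(2) Pm(2)] k(3) hs(4) by auto
  note c = f(1) [THEN D4_homD(1)] g(1) [THEN D4_homD(1)] hs(1,2) [THEN D4_homD(1)] j(1) [THEN D4_homD(1)] k(1) [THEN D4_homD(1)]
  have "j * (g * f) = j * 1\<^sub>m (rdim K)"
  proof -
    have "j * (g * f) = s * (k * f)"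
      using assoc_mult_mat [OF c(5,2,1)] assoc_mult_mat [OF c(4,6,1)] g(2) by simp
    also have "\<dots> = s * h * j" using assoc_mult_mat [OF c(4,3,5)] f(2) by simp
    finally show ?thesis using hs(6) c by simp
  qed
  then have gf: "g * f = 1\<^sub>m (rdim K)" by (rule mat_inj_cancel [OF j(2) c(5) mult_carrier_mat [OF c(2,1)] one_carrier_mat])
  have "k * (f * g) = k * 1\<^sub>m (rdim L)"
  proof -
    have "k * (f * g) = h * (j * g)"
      using assoc_mult_mat [OF c(6,1,2)] assoc_mult_mat [OF c(3,5,2)] f(2) by simp
    also have "\<dots> = h * s * k" using assoc_mult_mat [OF c(3,4,6)] g(2) by simp
    finally show ?thesis using hs(5) c by simp
  qed
  then have fg: "f * g = 1\<^sub>m (rdim L)" by (rule mat_inj_cancel [OF k(2) c(6) mult_carrier_mat [OF c(1,2)] one_carrier_mat])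
  show ?thesis by (rule D4_isoI [OF f(1) c(2) gf fg])
qed

text \<open>Left multiplication on the basis \<open>e\<close>, \<open>a e\<close>,
  \<open>d e\<close>, \<open>a d e\<close>, where \<open>b e = c e = e\<close>. The entry -1 in
  \<open>Gen_d\<close> arises because \<open>1 - b c\<close> kills \<open>e\<close>, so that
  \<open>d a e = - a d e\<close>.\<close>

fun int_P :: "D4_gen \<Rightarrow> int list list" where
  "int_P Gen_a = [[0, 0, 0, 0], [1, 0, 0, 0], [0, 0, 0, 0], [0, 0, 1, 0]]"
| "int_P Gen_b = [[1, 0, 0, 0], [0, - 1, 0, 0], [0, 0, - 1, 0], [0, 0, 0, 1]]"
| "int_P Gen_c = [[1, 0, 0, 0], [0, - 1, 0, 0], [0, 0, - 1, 0], [0, 0, 0, 1]]"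
| "int_P Gen_d = [[0, 0, 0, 0], [0, 0, 0, 0], [1, 0, 0, 0], [0, - 1, 0, 0]]"

abbreviation P0 :: "'k :: field rep" where "P0 \<equiv> int_rep 4 int_P"

lemma D4_module_P0 [simp]: "D4_module (P0 :: 'k :: field rep)"
  by (rule module_certificate) code_simp

lemma less_4_cases: "(i :: nat) < 4 \<longleftrightarrow> i = 0 \<or> i = 1 \<or> i = 2 \<or> i = 3"
  by auto

lemma sum_lessThan_4: "(\<Sum>i<4. f i) = f 0 + f 1 + f 2 + (f (3 :: nat) :: 'a :: comm_monoid_add)"
  by (simp add: eval_nat_numeral)

text \<open>\<open>P0\<close> is \<open>D\<^sub>4 e\<close> for the idempotent \<open>e = (1 + b) (1 + c) / 4\<close>, in the basis \<open>e, a e, d e, a d e\<close>.\<close>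

definition from_P0 :: "'k :: field rep \<Rightarrow> 'k vec \<Rightarrow> 'k mat" where
  "from_P0 N v = mat_of_cols (rdim N)
     [v, act N Gen_a *\<^sub>v v, act N Gen_d *\<^sub>v v, act N Gen_a *\<^sub>v (act N Gen_d *\<^sub>v v)]"

lemma act_vec:
  assumes N: "D4_module N" and v: "v \<in> carrier_vec (rdim N)"
  shows "act N Gen_b *\<^sub>v (act N Gen_a *\<^sub>v v) = - (act N Gen_a *\<^sub>v (act N Gen_b *\<^sub>v v))"
    "act N Gen_b *\<^sub>v (act N Gen_d *\<^sub>v v) = - (act N Gen_d *\<^sub>v (act N Gen_b *\<^sub>v v))"
    "act N Gen_c *\<^sub>v (act N Gen_a *\<^sub>v v) = - (act N Gen_a *\<^sub>v (act N Gen_c *\<^sub>v v))"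
    "act N Gen_c *\<^sub>v (act N Gen_d *\<^sub>v v) = - (act N Gen_d *\<^sub>v (act N Gen_c *\<^sub>v v))"
    "act N Gen_b *\<^sub>v (act N Gen_c *\<^sub>v v) = act N Gen_c *\<^sub>v (act N Gen_b *\<^sub>v v)"
    "act N Gen_a *\<^sub>v (act N Gen_a *\<^sub>v v) = 0\<^sub>v (rdim N)"
    "act N Gen_b *\<^sub>v (act N Gen_b *\<^sub>v v) = v"
    "act N Gen_c *\<^sub>v (act N Gen_c *\<^sub>v v) = v"
    "act N Gen_d *\<^sub>v (act N Gen_d *\<^sub>v v) = 0\<^sub>v (rdim N)"
    "act N Gen_d *\<^sub>v (act N Gen_a *\<^sub>v v) + act N Gen_a *\<^sub>v (act N Gen_d *\<^sub>v v)
      = v - act N Gen_b *\<^sub>v (act N Gen_c *\<^sub>v v)"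
proof -
  note ac = act_carrier [OF N] and n = D4_moduleD [OF N]
  note prod = mult_carrier_mat [OF ac ac]
  have assoc: "act N s *\<^sub>v (act N t *\<^sub>v v) = act N s * act N t *\<^sub>v v" for s t
    by (rule assoc_mult_mat_vec [OF ac ac v, symmetric])
  have neg: "- A *\<^sub>v v = - (A *\<^sub>v v)" if "A \<in> carrier_mat (rdim N) (rdim N)" for A
    using that v by (intro eq_vecI) auto
  have zero: "0\<^sub>m (rdim N) (rdim N) *\<^sub>v v = 0\<^sub>v (rdim N)" using v by (intro eq_vecI) auto
  have db: "act N Gen_b * act N Gen_d = - (act N Gen_d * act N Gen_b)"
    "act N Gen_c * act N Gen_d = - (act N Gen_d * act N Gen_c)"
    unfolding n(2,4) by (intro eq_matI; simp)+
  show "act N Gen_b *\<^sub>v (act N Gen_a *\<^sub>v v) = - (act N Gen_a *\<^sub>v (act N Gen_b *\<^sub>v v))"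
    "act N Gen_b *\<^sub>v (act N Gen_d *\<^sub>v v) = - (act N Gen_d *\<^sub>v (act N Gen_b *\<^sub>v v))"
    "act N Gen_c *\<^sub>v (act N Gen_a *\<^sub>v v) = - (act N Gen_a *\<^sub>v (act N Gen_c *\<^sub>v v))"
    "act N Gen_c *\<^sub>v (act N Gen_d *\<^sub>v v) = - (act N Gen_d *\<^sub>v (act N Gen_c *\<^sub>v v))"
    unfolding assoc n(1,3) db by (rule neg [OF prod])+
  show "act N Gen_b *\<^sub>v (act N Gen_c *\<^sub>v v) = act N Gen_c *\<^sub>v (act N Gen_b *\<^sub>v v)"
    unfolding assoc n(5) ..
  show "act N Gen_a *\<^sub>v (act N Gen_a *\<^sub>v v) = 0\<^sub>v (rdim N)" "act N Gen_d *\<^sub>v (act N Gen_d *\<^sub>v v) = 0\<^sub>v (rdim N)"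
    unfolding assoc n by (rule zero)+
  show "act N Gen_b *\<^sub>v (act N Gen_b *\<^sub>v v) = v" "act N Gen_c *\<^sub>v (act N Gen_c *\<^sub>v v) = v"
    unfolding assoc n using v by simp_all
  show "act N Gen_d *\<^sub>v (act N Gen_a *\<^sub>v v) + act N Gen_a *\<^sub>v (act N Gen_d *\<^sub>v v)
      = v - act N Gen_b *\<^sub>v (act N Gen_c *\<^sub>v v)"
    unfolding assoc add_mult_distrib_mat_vec [OF prod prod v, symmetric] n(10)
    unfolding minus_mult_distrib_mat_vec [OF one_carrier_mat prod v] one_mult_mat_vec [OF v] ..
qed

lemma from_P0_carrier [simp]: "from_P0 N v \<in> carrier_mat (rdim N) 4"
  by (rule carrier_matI) (simp_all add: from_P0_def)

lemma index_from_P0: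
  assumes "i < rdim N"
  shows "from_P0 N v $$ (i, 0) = v $ i" "from_P0 N v $$ (i, 1) = (act N Gen_a *\<^sub>v v) $ i"
    "from_P0 N v $$ (i, 2) = (act N Gen_d *\<^sub>v v) $ i" "from_P0 N v $$ (i, 3) = (act N Gen_a *\<^sub>v (act N Gen_d *\<^sub>v v)) $ i"
  using assms by (simp_all add: from_P0_def mat_of_cols_index)

text \<open>Existence half of the universal property of \<open>P0\<close>: a vector fixed by
  \<open>b\<close> and \<open>c\<close> is the image of \<open>e\<close> under a homomorphism.
  Anticommutation determines \<open>b\<close> and \<open>c\<close> on all four columns;
  \<open>d a v\<close> and \<open>d a d v\<close> come from the last defining relation.\<close>

lemma from_P0_hom:
  assumes N: "D4_module N" and v: "v \<in> carrier_vec (rdim N)"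
    and b: "act N Gen_b *\<^sub>v v = v" and c: "act N Gen_c *\<^sub>v v = v"
  shows "from_P0 N v \<in> D4_hom P0 N"
proof (rule D4_homI)
  show "from_P0 N v \<in> carrier_mat (rdim N) (rdim P0)" by simp
  note ac = act_carrier [OF N]
  let ?n = "rdim N" and ?a = "\<lambda>v. act N Gen_a *\<^sub>v v" and ?b = "\<lambda>v. act N Gen_b *\<^sub>v v"
    and ?c = "\<lambda>v. act N Gen_c *\<^sub>v v" and ?d = "\<lambda>v. act N Gen_d *\<^sub>v v"
  have dv: "?d v \<in> carrier_vec ?n" and av: "?a v \<in> carrier_vec ?n" and adv: "?a (?d v) \<in> carrier_vec ?n"
    using mult_mat_vec_carrier [OF ac v] mult_mat_vec_carrier [OF ac mult_mat_vec_carrier [OF ac v]] by blast+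
  have neg: "act N s *\<^sub>v (- w) = - (act N s *\<^sub>v w)" if "w \<in> carrier_vec ?n" for s w
    using that ac [of s] by (intro eq_vecI) auto
  \<comment> \<open>The form in which the last relation is used: when \<open>b c\<close> fixes
    \<open>u\<close>, its right-hand side is \<open>u - u\<close>.\<close>
  have solve: "w = - w'" if "w + w' = u - u" "w \<in> carrier_vec ?n" "w' \<in> carrier_vec ?n" "u \<in> carrier_vec ?n" for u w w' :: "'a vec"
  proof (rule eq_vecI)
    fix i assume i: "i < dim_vec (- w')"
    then have "w $ i + w' $ i = 0" using arg_cong [OF that(1), of "\<lambda>v. vec_index v i"] that(2-4) by simp
    then show "w $ i = (- w') $ i" using i by (simp add: eq_neg_iff_add_eq_0)
  qed (use that in auto)
  have bd: "?b (?d v) = - ?d v" and cd: "?c (?d v) = - ?d v" using act_vec(2,4) [OF N v] b c by auto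
  have nn: "- (- w) = w" for w :: "'a vec" by (intro eq_vecI) auto
  have ba: "?b (?a v) = - ?a v" and ca: "?c (?a v) = - ?a v" using act_vec(1,3) [OF N v] b c by auto
  have aa: "?a (?a v) = 0\<^sub>v ?n" "?d (?d v) = 0\<^sub>v ?n" "?a (?a (?d v)) = 0\<^sub>v ?n"
    using act_vec(6,9) [OF N v] act_vec(6) [OF N dv] .
  have da: "?d (?a v) = - ?a (?d v)"
    using act_vec(10) [OF N v] b c av adv v by (intro solve [of _ _ v]) (use mult_mat_vec_carrier [OF ac] in auto)
  \<comment> \<open>Both \<open>b\<close> and \<open>c\<close> negate \<open>d v\<close>, so
    \<open>b c\<close> fixes it and the last relation can be applied to \<open>d v\<close> in place
    of \<open>v\<close>.\<close>
  have dad: "?d (?a (?d v)) = 0\<^sub>v ?n"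
  proof -
    have "?d (?a (?d v)) + ?a (?d (?d v)) = ?d v - ?b (?c (?d v))" by (rule act_vec(10) [OF N dv])
    also have "?b (?c (?d v)) = ?d v" unfolding cd neg [OF dv] bd nn ..
    finally have "?d (?a (?d v)) = - ?a (?d (?d v))"
      using dv adv by (intro solve [of _ _ "?d v"]) (use mult_mat_vec_carrier [OF ac] in auto)
    also have "\<dots> = 0\<^sub>v ?n" unfolding act_vec(9) [OF N v] using ac [of Gen_a] by (intro eq_vecI) auto
    finally show ?thesis .
  qed
  have bad: "?b (?a (?d v)) = ?a (?d v)" and cad: "?c (?a (?d v)) = ?a (?d v)"
    unfolding act_vec(1,3) [OF N dv] bd cd neg [OF dv] nn by (rule refl)+
  have col: "col (from_P0 N v) 0 = v" "col (from_P0 N v) 1 = ?a v" "col (from_P0 N v) 2 = ?d v" "col (from_P0 N v) 3 = ?a (?d v)"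
    unfolding from_P0_def using v av dv adv by (simp_all add: col_mat_of_cols del: carrier_vec_dim_vec)
  fix s
  show "from_P0 N v * act P0 s = act N s * from_P0 N v"
  proof (rule eq_matI)
    fix i j assume "i < dim_row (act N s * from_P0 N v)" "j < dim_col (act N s * from_P0 N v)"
    then have i: "i < ?n" and j: "j < 4" using ac [of s] from_P0_carrier [of N v] by auto
    have 1: "(from_P0 N v * act P0 s) $$ (i, j) = (\<Sum>k<4. from_P0 N v $$ (i, k) * of_int (int_P s ! k ! j))"
      using i j carrier_matD [OF from_P0_carrier, of N v]
      by (auto simp: scalar_prod_def int_mat_def atLeast0LessThan intro!: sum.cong)
    have 2: "(act N s * from_P0 N v) $$ (i, j) = (act N s *\<^sub>v col (from_P0 N v) j) $ i"
      using i j carrier_matD [OF ac, of s] carrier_matD [OF from_P0_carrier, of N v] by auto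
    have "j = 0 \<or> j = 1 \<or> j = 2 \<or> j = 3" using j by auto
    then show "(from_P0 N v * act P0 s) $$ (i, j) = (act N s * from_P0 N v) $$ (i, j)"
      unfolding 1 2 sum_lessThan_4 index_from_P0 [OF i]
      by (cases s; elim disjE)
        (simp_all add: i col [unfolded One_nat_def] b c ba ca bd cd da dad bad cad aa carrier_matD [OF ac])
  qed (use carrier_matD [OF ac, of s] carrier_matD [OF from_P0_carrier, of N v] in auto)
qed

text \<open>The unit vector of index 0 is \<open>e\<close>, and \<open>a\<close> and
  \<open>d\<close> produce the other basis vectors from it.\<close>

lemma P0_hom_eqI:
  assumes f: "f \<in> D4_hom P0 N" and g: "g \<in> D4_hom P0 N" and N: "D4_module N"
    and eq: "f *\<^sub>v unit_vec 4 0 = g *\<^sub>v unit_vec 4 0"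
  shows "f = g"
proof -
  note fc = D4_homD [OF f] and gc = D4_homD [OF g]
  have fc1: "f \<in> carrier_mat (rdim N) 4" and gc1: "g \<in> carrier_mat (rdim N) 4" using fc gc by auto
  have step: "f *\<^sub>v w' = g *\<^sub>v w'" if "f *\<^sub>v w = g *\<^sub>v w" "w' = act P0 s *\<^sub>v w" "w \<in> carrier_vec 4" for w w' s
  proof -
    have "h *\<^sub>v w' = act N s *\<^sub>v (h *\<^sub>v w)" if "h \<in> D4_hom P0 N" for h
      using assoc_mult_mat_vec [of h "rdim N" 4 "act P0 s" 4 w] assoc_mult_mat_vec [OF act_carrier [OF N], of h 4 w s]
        D4_homD [OF that] \<open>w' = _\<close> \<open>w \<in> _\<close> by simp
    then show ?thesis using f g that(1) by metis
  qed
  have "unit_vec 4 1 = act P0 Gen_a *\<^sub>v (unit_vec 4 0 :: 'a vec)" "unit_vec 4 2 = act P0 Gen_d *\<^sub>v (unit_vec 4 0 :: 'a vec)"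
    "unit_vec 4 3 = act P0 Gen_a *\<^sub>v (unit_vec 4 2 :: 'a vec)"
    by (auto intro!: eq_vecI simp: int_mat_def less_4_cases)
  then have units: "f *\<^sub>v unit_vec 4 j = g *\<^sub>v unit_vec 4 j" if "j < 4" for j
    using that eq step [of "unit_vec 4 0"] step [of "unit_vec 4 2"] unfolding less_4_cases by (metis unit_vec_carrier)
  show ?thesis
  proof (rule eq_matI)
    fix i j assume "i < dim_row g" "j < dim_col g"
    then have ij: "i < rdim N" "j < 4" using gc1 by auto
    have "(f *\<^sub>v unit_vec 4 j) $ i = (g *\<^sub>v unit_vec 4 j) $ i" using units [OF ij(2)] by simp
    then show "f $$ (i, j) = g $$ (i, j)" using ij fc1 gc1 by simp
  qed (use fc1 gc1 in auto)
qed

text \<open>\<open>w\<close> is the projection of \<open>v\<close> to the vectors fixed by the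
  involution \<open>A\<close>; a map with equal values at \<open>A v\<close> and \<open>v\<close>
  takes that value at \<open>w\<close> as well. The division by 2 is where the characteristic
  enters.\<close>

lemma half_sum:
  fixes A :: "'k :: field mat"
  assumes two: "(2 :: 'k) \<noteq> 0" and A: "A \<in> carrier_mat n n" "A * A = 1\<^sub>m n" and v: "v \<in> carrier_vec n"
  defines "w \<equiv> (1 / 2) \<cdot>\<^sub>v (v + A *\<^sub>v v)"
  shows "w \<in> carrier_vec n" "A *\<^sub>v w = w"
    and "B \<in> carrier_mat m n \<Longrightarrow> B *\<^sub>v (A *\<^sub>v v) = B *\<^sub>v v \<Longrightarrow> B *\<^sub>v w = B *\<^sub>v v"
proof -
  have Av: "A *\<^sub>v v \<in> carrier_vec n" and AAv: "A *\<^sub>v (A *\<^sub>v v) = v"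
    using A v assoc_mult_mat_vec [OF A(1) A(1) v] by auto
  show w: "w \<in> carrier_vec n" using v Av by (simp add: w_def)
  show "A *\<^sub>v w = w"
    unfolding w_def using v Av A(1) AAv
    by (simp add: mult_mat_vec [OF A(1)] mult_add_distrib_mat_vec [OF A(1)] comm_add_vec [OF v Av])
  show "B *\<^sub>v w = B *\<^sub>v v" if B: "B \<in> carrier_mat m n" and "B *\<^sub>v (A *\<^sub>v v) = B *\<^sub>v v"
  proof -
    have "(1 / 2) \<cdot>\<^sub>v (u + u) = u" for u :: "'k vec"
      using two by (intro eq_vecI) (auto simp: field_simps)
    then show ?thesis
      unfolding w_def using v Av that by (simp add: mult_mat_vec [OF B] mult_add_distrib_mat_vec [OF B])
  qed
qed

text \<open>Averaging over \<open>b\<close> and then over \<open>c\<close>. The second average stays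
  fixed by \<open>b\<close> because \<open>b\<close> and \<open>c\<close> commute, and the image
  under \<open>f\<close> is unchanged because it is already fixed by both.\<close>

lemma invariant_lift:
  assumes two: "(2 :: 'k :: field) \<noteq> 0" and M: "D4_module M" and N: "D4_module N"
    and f: "f \<in> D4_hom M (N :: 'k rep)" and v: "v \<in> carrier_vec (rdim M)"
    and b: "act N Gen_b *\<^sub>v (f *\<^sub>v v) = f *\<^sub>v v" and c: "act N Gen_c *\<^sub>v (f *\<^sub>v v) = f *\<^sub>v v"
  obtains w where "w \<in> carrier_vec (rdim M)" "act M Gen_b *\<^sub>v w = w" "act M Gen_c *\<^sub>v w = w" "f *\<^sub>v w = f *\<^sub>v v"
proof -
  note ac = act_carrier [OF M] and fc = D4_homD [OF f]
  have fs: "f *\<^sub>v (act M s *\<^sub>v u) = act N s *\<^sub>v (f *\<^sub>v u)" if "u \<in> carrier_vec (rdim M)" for s u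
    using assoc_mult_mat_vec [OF fc(1) ac that, of s] assoc_mult_mat_vec [OF act_carrier [OF N] fc(1) that, of s] fc(2) [of s] by simp
  define w\<^sub>1 where "w\<^sub>1 = (1 / 2) \<cdot>\<^sub>v (v + act M Gen_b *\<^sub>v v)"
  note h1 = half_sum [OF two ac D4_moduleD(7) [OF M] v, folded w\<^sub>1_def]
  have f1: "f *\<^sub>v w\<^sub>1 = f *\<^sub>v v" using h1(3) [OF fc(1)] fs [OF v] b by simp
  define w where "w = (1 / 2) \<cdot>\<^sub>v (w\<^sub>1 + act M Gen_c *\<^sub>v w\<^sub>1)"
  note h2 = half_sum [OF two ac D4_moduleD(8) [OF M] h1(1), folded w_def]
  have "f *\<^sub>v w = f *\<^sub>v w\<^sub>1" using h2(3) [OF fc(1)] fs [OF h1(1)] c f1 by simp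
  moreover have "act M Gen_b *\<^sub>v w = w"
  proof -
    have cw: "act M Gen_c *\<^sub>v w\<^sub>1 \<in> carrier_vec (rdim M)" by (rule mult_mat_vec_carrier [OF ac h1(1)])
    show ?thesis
      unfolding w_def mult_mat_vec [OF ac add_carrier_vec [OF h1(1) cw]] mult_add_distrib_mat_vec [OF ac h1(1) cw]
        act_vec(5) [OF M h1(1)] h1(2) ..
  qed
  ultimately show thesis using that h2(1,2) f1 by auto
qed

text \<open>A homomorphism from \<open>P0\<close> amounts to a vector fixed by \<open>b\<close> and
  \<open>c\<close>, and \<open>invariant_lift\<close> lifts such vectors along surjections.\<close>

lemma D4_projective_P0:
  assumes two: "(2 :: 'k :: field) \<noteq> 0"
  shows "D4_projective (P0 :: 'k rep)"
  unfolding D4_projective_def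
proof (intro conjI allI ballI impI)
  fix M N :: "'k rep" and f g
  assume f: "f \<in> D4_hom M N" and g: "g \<in> D4_hom P0 N" and "D4_module M \<and> D4_module N \<and> mat_surj f"
  then have M: "D4_module M" and N: "D4_module N" and surj: "mat_surj f" by auto
  note fc = D4_homD(1) [OF f] and gc = D4_homD [OF g]
  have gc1: "g \<in> carrier_mat (rdim N) 4" using gc(1) by simp
  let ?e = "unit_vec 4 0 :: 'k vec"
  have ge: "g *\<^sub>v ?e \<in> carrier_vec (rdim N)" using gc1 by auto
  have be: "act P0 Gen_b *\<^sub>v ?e = ?e" "act P0 Gen_c *\<^sub>v ?e = ?e" by (auto intro!: eq_vecI simp: int_mat_def less_4_cases)
  have act_ge: "act N s *\<^sub>v (g *\<^sub>v ?e) = g *\<^sub>v (act P0 s *\<^sub>v ?e)" for s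
    using assoc_mult_mat_vec [OF act_carrier [OF N] gc1 unit_vec_carrier, of s 0]
      assoc_mult_mat_vec [OF gc1, of "act P0 s" 4 ?e] gc(2) [of s] by simp
  have "g *\<^sub>v ?e \<in> mat_image f" using surj ge fc by (auto simp: mat_surj_def)
  then obtain v where v: "v \<in> carrier_vec (rdim M)" "f *\<^sub>v v = g *\<^sub>v ?e" using fc by (auto simp: mat_image_def)
  obtain w where w: "w \<in> carrier_vec (rdim M)" "act M Gen_b *\<^sub>v w = w" "act M Gen_c *\<^sub>v w = w" "f *\<^sub>v w = g *\<^sub>v ?e"
    using invariant_lift [OF two M N f v(1)] act_ge be unfolding v(2) by metis
  have hom: "from_P0 M w \<in> D4_hom P0 M" by (rule from_P0_hom [OF M w(1-3)])
  have "from_P0 M w *\<^sub>v ?e = w"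
    using w(1) carrier_matD [OF from_P0_carrier, of M w] by (intro eq_vecI) (auto simp: index_from_P0)
  then have "f * from_P0 M w *\<^sub>v ?e = g *\<^sub>v ?e"
    using assoc_mult_mat_vec [OF fc from_P0_carrier unit_vec_carrier, of w 0] w(4) by simp
  then have "f * from_P0 M w = g"
    by (intro P0_hom_eqI [OF D4_hom_comp [OF hom f _ M N] g N]) auto
  then show "\<exists>h \<in> D4_hom P0 M. f * h = g" using hom by blast
qed simp

definition P0_top :: "'k :: field mat" where
  "P0_top = mat 1 4 (\<lambda>(i, j). if j = 0 then 1 else 0)"

lemma P0_top_carrier [simp]: "P0_top \<in> carrier_mat 1 4" "P0_top \<in> carrier_mat (Suc 0) 4"
  by (simp_all add: P0_top_def)

lemma P0_top_hom: "P0_top \<in> D4_hom P0 (V1 0 :: 'k :: field rep)"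
proof (rule D4_homI)
  fix s show "P0_top * act P0 s = act (V1 0 :: 'k rep) s * P0_top"
    by (cases s; intro eq_matI)
      (auto simp: P0_top_def act_V1 int_mat_def scalar_prod_def less_4_cases atLeast0LessThan sum_lessThan_4)
qed simp

lemma P0_top_mult: "v \<in> carrier_vec 4 \<Longrightarrow> P0_top *\<^sub>v v = vec 1 (\<lambda>i. v $ 0)"
  by (intro eq_vecI) (auto simp: P0_top_def scalar_prod_def atLeast0LessThan sum_lessThan_4)

text \<open>For essentiality, the image of \<open>h\<close> contains a vector fixed by
  \<open>b\<close> and \<open>c\<close> whose coordinate at \<open>e\<close> is 1. As
  \<open>b\<close> negates \<open>a e\<close> and \<open>d e\<close>, this vector is
  \<open>e + t a d e\<close> for a scalar \<open>t\<close>, and such a vector generates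
  \<open>P0\<close>.\<close>

lemma projective_cover_P0:
  assumes two: "(2 :: 'k :: field) \<noteq> 0"
  shows "projective_cover (V1 0) (P0 :: 'k rep) P0_top"
  unfolding projective_cover_def
proof (intro conjI allI ballI impI)
  show "D4_projective (P0 :: 'k rep)" by (rule D4_projective_P0 [OF two])
  show "P0_top \<in> D4_hom P0 (V1 0 :: 'k rep)" by (rule P0_top_hom)
  show "mat_surj (P0_top :: 'k mat)"
  proof (rule mat_surjI)
    show "P0_top * mat 4 1 (\<lambda>(i, j). if i = 0 then 1 else 0) = (1\<^sub>m 1 :: 'k mat)"
      by (intro eq_matI) (auto simp: P0_top_def scalar_prod_def atLeast0LessThan sum_lessThan_4)
  qed auto
  fix T :: "'k rep" and h assume h: "h \<in> D4_hom T P0" and "D4_module T \<and> mat_surj (P0_top * h)"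
  then have T: "D4_module T" and surj: "mat_surj (P0_top * h)" by auto
  note hc = D4_homD [OF h]
  have hc1: "h \<in> carrier_mat 4 (rdim T)" using hc by simp
  have pc: "(P0_top :: 'k mat) \<in> carrier_mat 1 4" by simp
  have "unit_vec 1 0 \<in> mat_image (P0_top * h)" using surj by (auto simp: mat_surj_def P0_top_def)
  then obtain t where t: "t \<in> carrier_vec (rdim T)" "P0_top * h *\<^sub>v t = unit_vec 1 0"
    using hc1 by (auto simp: mat_image_def)
  have triv: "act (V1 0) s *\<^sub>v u = u" if "s = Gen_b \<or> s = Gen_c" "u \<in> carrier_vec 1" for s and u :: "'k vec"
    using that by (auto simp: act_V1)
  have u1: "unit_vec 1 0 \<in> carrier_vec 1" by simp
  obtain w where w: "w \<in> carrier_vec (rdim T)" "act T Gen_b *\<^sub>v w = w" "act T Gen_c *\<^sub>v w = w" "P0_top * h *\<^sub>v w = unit_vec 1 0"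
    using invariant_lift [OF two T D4_module_V1 D4_hom_comp [OF h P0_top_hom T D4_module_P0 D4_module_V1] t(1)]
      triv t(2) by (metis u1)
  define x where "x = h *\<^sub>v w"
  have x: "x \<in> carrier_vec 4" using hc1 w(1) by (simp add: x_def)
  have "P0_top *\<^sub>v x = unit_vec 1 0" unfolding x_def using w(4) assoc_mult_mat_vec [OF pc hc1 w(1)] by simp
  then have x0: "x $ 0 = 1" using P0_top_mult [OF x] by (metis index_unit_vec(1) index_vec less_numeral_extra(1))
  have bx: "act P0 Gen_b *\<^sub>v x = x"
    unfolding x_def using assoc_mult_mat_vec [OF _ hc1 w(1), of "act P0 Gen_b" 4] assoc_mult_mat_vec [OF hc1 act_carrier [OF T] w(1), of Gen_b]
      hc(2) [of Gen_b] w(2) by simp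
  moreover have "(act P0 Gen_b *\<^sub>v x) $ 1 = - x $ 1" "(act P0 Gen_b *\<^sub>v x) $ 2 = - x $ 2"
    using x by (simp_all add: int_mat_def scalar_prod_def atLeast0LessThan sum_lessThan_4)
  ultimately have "2 * x $ 1 = 0" "2 * x $ 2 = 0" by (simp_all add: eq_neg_iff_add_eq_0)
  then have x12: "x $ 1 = 0" "x $ 2 = 0" using two by auto
  let ?k = "from_P0 T w"
  have k: "?k \<in> D4_hom P0 T" by (rule from_P0_hom [OF T w(1-3)])
  have hk: "h * ?k \<in> D4_hom P0 P0" by (rule D4_hom_comp [OF k h]) (use T in auto)
  have e: "?k *\<^sub>v unit_vec 4 0 = w"
    using w(1) carrier_matD [OF from_P0_carrier, of T w] by (intro eq_vecI) (auto simp: index_from_P0)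
  have fx: "from_P0 P0 x \<in> D4_hom P0 P0"
  proof (rule from_P0_hom)
    show "act P0 Gen_b *\<^sub>v x = x" by (rule bx)
    then show "act P0 Gen_c *\<^sub>v x = x" by simp
  qed (use x in auto)
  have "h * ?k = from_P0 P0 x"
  proof (rule P0_hom_eqI [OF hk fx])
    show "h * ?k *\<^sub>v unit_vec 4 0 = from_P0 P0 x *\<^sub>v unit_vec 4 0"
      unfolding assoc_mult_mat_vec [OF hc1 from_P0_carrier unit_vec_carrier] e x_def [symmetric]
      using x carrier_matD [OF from_P0_carrier, of "P0 :: 'k rep" x] by (intro eq_vecI) (auto simp: index_from_P0)
  qed simp
  \<comment> \<open>For \<open>x = e + t a d e\<close> the images under \<open>a\<close>,
    \<open>d\<close> and \<open>a d\<close> are those of \<open>e\<close>, so the matrix is the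
    identity plus \<open>t\<close> at position (3, 0), which the inverse subtracts.\<close>
  moreover have "from_P0 P0 x * mat 4 4 (\<lambda>(i, j). if i = j then 1 else if i = 3 \<and> j = 0 then - x $ 3 else 0) = 1\<^sub>m 4"
    using x x0 x12 carrier_matD [OF from_P0_carrier, of "P0 :: 'k rep" x]
    by (intro eq_matI) (auto simp: less_4_cases scalar_prod_def atLeast0LessThan sum_lessThan_4 index_from_P0 index_from_P0(2) [unfolded One_nat_def] int_mat_def)
  ultimately have "h * (?k * mat 4 4 (\<lambda>(i, j). if i = j then 1 else if i = 3 \<and> j = 0 then - x $ 3 else 0)) = 1\<^sub>m 4"
    using assoc_mult_mat [OF hc1 from_P0_carrier, of "mat 4 4 _" 4 w] by simp
  then show "mat_surj h" using mat_surjI [OF hc1 mult_carrier_mat [OF from_P0_carrier mat_carrier]] by blast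
qed

lemma is_syzygy_V1_0:
  assumes two: "(2 :: 'k :: field) \<noteq> 0"
  shows "is_syzygy (V1 0) (int_rep 3 int_Y :: 'k rep)"
  unfolding is_syzygy_def
proof (intro conjI exI bexI)
  \<comment> \<open>A shift of indices by one: the kernel of \<open>P0_top\<close> is spanned by the
    last three basis vectors of \<open>P0\<close>.\<close>
  define j where "j = (mat 4 3 (\<lambda>(i, j). if i = Suc j then 1 else 0) :: 'k mat)"
  have jc: "j \<in> carrier_mat 4 3" by (simp add: j_def)
  show "projective_cover (V1 0) (P0 :: 'k rep) P0_top" by (rule projective_cover_P0 [OF two])
  have sum3: "(\<Sum>i<3. f i) = f 0 + f 1 + f 2" for f :: "nat \<Rightarrow> 'k" by (simp add: eval_nat_numeral)
  have less3: "i < 3 \<longleftrightarrow> i = 0 \<or> i = 1 \<or> i = 2" for i :: nat by auto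
  show "j \<in> D4_hom (int_rep 3 int_Y) P0"
  proof (rule D4_homI)
    fix s show "j * act (int_rep 3 int_Y) s = act P0 s * j"
      by (cases s; intro eq_matI)
        (auto simp: j_def int_mat_def scalar_prod_def less_4_cases less3 atLeast0LessThan sum_lessThan_4 sum3)
  qed (simp add: j_def)
  show "mat_inj j"
  proof (rule mat_injI [OF jc])
    show "mat 3 4 (\<lambda>(i, j). if j = Suc i then 1 else 0) * j = 1\<^sub>m 3"
      by (intro eq_matI) (auto simp: j_def scalar_prod_def less3 atLeast0LessThan sum_lessThan_4)
  qed simp
  show "mat_image j = mat_kernel P0_top"
  proof (intro equalityI subsetI)
    fix x assume "x \<in> mat_image j"
    then obtain v where v: "v \<in> carrier_vec 3" "x = j *\<^sub>v v" using jc by (auto simp: mat_image_def)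
    have x: "x \<in> carrier_vec 4" using v jc by simp
    have "x $ 0 = 0" using v by (simp add: j_def scalar_prod_def)
    then show "x \<in> mat_kernel P0_top" using x P0_top_mult [OF x] P0_top_carrier by (auto simp: mat_kernel_def P0_top_def intro!: eq_vecI)
  next
    fix x :: "'k vec" assume "x \<in> mat_kernel P0_top"
    then have x: "x \<in> carrier_vec 4" and 0: "P0_top *\<^sub>v x = 0\<^sub>v 1" by (auto simp: mat_kernel_def P0_top_def)
    have "x $ 0 = 0" using 0 P0_top_mult [OF x] by (metis index_vec index_zero_vec(1) less_numeral_extra(1))
    then have "x = j *\<^sub>v vec 3 (\<lambda>i. x $ Suc i)"
      using x by (intro eq_vecI) (auto simp: j_def scalar_prod_def less_4_cases atLeast0LessThan sum3 numeral_3_eq_3)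
    then show "x \<in> mat_image j" using jc unfolding mat_image_def by (metis carrier_matD(2) imageI vec_carrier)
  qed
qed simp

lemma dual_V1_0 [simp]: "dual_rep (V1 0) = (V1 0 :: 'k :: field rep)"
proof (rule rep_eqI)
  fix s show "act (dual_rep (V1 0)) s = act (V1 0 :: 'k rep) s"
    by (cases s) (auto simp: act_V1)
qed simp

lemma dual_int_rep: "dual_rep (int_rep n R) = int_rep n (\<lambda>s. tabulate n n (\<lambda>i j. R s ! j ! i))"
  by (rule rep_eqI) (auto simp: int_mat_def nth_tabulate)

lemma D4_iso_dual:
  assumes "D4_iso M N" "D4_module M" "D4_module N"
  shows "D4_iso (dual_rep M) (dual_rep N)"
proof -
  obtain f g where fg: "f \<in> D4_hom M N" "g \<in> D4_hom N M" "g * f = 1\<^sub>m (rdim M)" "f * g = 1\<^sub>m (rdim N)"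
    using D4_iso_inverse [OF assms] .
  note c = fg(1,2) [THEN D4_homD(1)]
  show ?thesis
    using D4_hom_transpose [OF fg(2) assms(3,2)] c fg(3,4) transpose_mult [OF c(1,2)] transpose_mult [OF c(2,1)]
    by (intro D4_isoI [of "transpose_mat g" _ _ "transpose_mat f"]) simp_all
qed

lemma dual_Y_iso_Z:
  assumes "(2 :: 'k :: field) \<noteq> 0"
  shows "D4_iso (dual_rep (int_rep 3 int_Y)) (int_rep 3 int_Z :: 'k rep)"
  unfolding dual_int_rep
  by (rule iso_certificate [of _ _ _ "[[0, 0, 1], [0, 1, 0], [- 1, 0, 0]]" "[[0, 0, - 1], [0, 1, 0], [1, 0, 0]]" 0, OF _ assms])
    code_simp

context char_not_2
begin

lemma iso_class_Omega: "iso_class (Omega (V1 0 :: 'k rep)) = gen_class Var_y"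
proof -
  have "is_syzygy (V1 0) (Omega (V1 0 :: 'k rep))"
    unfolding Omega_def using is_syzygy_V1_0 [OF two_nonzero] by (rule someI)
  then have "D4_iso (Omega (V1 0)) (int_rep 3 int_Y :: 'k rep)" "D4_module (Omega (V1 0 :: 'k rep))"
    using syzygy_unique [OF _ is_syzygy_V1_0 [OF two_nonzero]] by (auto simp: is_syzygy_def)
  then show ?thesis by (simp add: gen_class_def iso_class_eq_iff)
qed

text \<open>V(0) is its own dual, so a cosyzygy of V(0) dualises to a syzygy of V(0), whose
  uniqueness is known. Dualising back gives the dual of \<open>int_Y\<close>, which is isomorphic to
  \<open>int_Z\<close>.\<close>

lemma iso_class_Omega_inv: "iso_class (Omega_inv (V1 0 :: 'k rep)) = gen_class Var_z"
proof -
  have "is_cosyzygy (V1 0) (dual_rep (int_rep 3 int_Y) :: 'k rep)"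
    using is_cosyzygy_dual [OF is_syzygy_V1_0 [OF two_nonzero]] by simp
  then have *: "is_cosyzygy (V1 0) (Omega_inv (V1 0 :: 'k rep))"
    unfolding Omega_inv_def by (rule someI)
  then have "is_syzygy (V1 0) (dual_rep (Omega_inv (V1 0 :: 'k rep)))" using is_syzygy_dual by fastforce
  then have "D4_iso (dual_rep (Omega_inv (V1 0))) (int_rep 3 int_Y :: 'k rep)"
    using syzygy_unique [OF _ is_syzygy_V1_0 [OF two_nonzero]] by simp
  moreover have m: "D4_module (Omega_inv (V1 0 :: 'k rep))" using * by (simp add: is_cosyzygy_def)
  ultimately have "D4_iso (Omega_inv (V1 0)) (dual_rep (int_rep 3 int_Y) :: 'k rep)"
    using D4_iso_dual [of "dual_rep (Omega_inv (V1 0))" "int_rep 3 int_Y :: 'k rep"] by simp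
  then have "D4_iso (Omega_inv (V1 0)) (int_rep 3 int_Z :: 'k rep)"
    by (rule D4_iso_trans [OF _ dual_Y_iso_Z [OF two_nonzero] m]) simp_all
  then show ?thesis using m by (simp add: gen_class_def iso_class_eq_iff)
qed

end

section \<open>Radical, invariants and weight spaces\<close>

declare act_tensor_rep [simp del]

lemma rdim_V2 [simp]: "rdim (V2 r) = 2"
  by (simp add: V2_def)

lemma is_subspace_carrier: "is_subspace n (carrier_vec n)"
  by (auto simp: is_subspace_def)

lemma is_subspace_Int: "is_subspace n U \<Longrightarrow> is_subspace n W \<Longrightarrow> is_subspace n (U \<inter> W)"
  by (auto simp: is_subspace_def)

definition vec_sum :: "'k :: field vec set \<Rightarrow> 'k vec set \<Rightarrow> 'k vec set" where
  "vec_sum U W = {v + w | v w. v \<in> U \<and> w \<in> W}"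

lemma is_subspace_sum:
  assumes "is_subspace n U" "is_subspace n W"
  shows "is_subspace n (vec_sum U W)"
proof -
  note u = is_subspaceD [OF assms(1)] and w = is_subspaceD [OF assms(2)]
  show ?thesis
    unfolding is_subspace_def
  proof (intro conjI ballI allI)
    show "vec_sum U W \<subseteq> carrier_vec n" using u(1) w(1) by (auto simp: vec_sum_def intro!: add_carrier_vec)
    have "0\<^sub>v n = 0\<^sub>v n + (0\<^sub>v n :: 'a vec)" by (rule right_zero_vec [OF zero_carrier_vec, symmetric])
    then show "0\<^sub>v n \<in> vec_sum U W" unfolding vec_sum_def using u(2) w(2) by blast
  next
    fix x y assume "x \<in> vec_sum U W" "y \<in> vec_sum U W"
    then obtain v v' z z' where x: "x = v + z" "y = v' + z'" "v \<in> U" "v' \<in> U" "z \<in> W" "z' \<in> W"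
      by (auto simp: vec_sum_def)
    moreover from this have "v \<in> carrier_vec n" "v' \<in> carrier_vec n" "z \<in> carrier_vec n" "z' \<in> carrier_vec n"
      using u(1) w(1) by auto
    ultimately have "x + y = (v + v') + (z + z')" by (intro eq_vecI) auto
    then show "x + y \<in> vec_sum U W" unfolding vec_sum_def using u(3) w(3) x by blast
  next
    fix c x assume "x \<in> vec_sum U W"
    then obtain v z where x: "x = v + z" "v \<in> U" "z \<in> W" by (auto simp: vec_sum_def)
    then have "c \<cdot>\<^sub>v x = c \<cdot>\<^sub>v v + c \<cdot>\<^sub>v z" using u(1) w(1) smult_add_distrib_vec by blast
    then show "c \<cdot>\<^sub>v x \<in> vec_sum U W" unfolding vec_sum_def using u(4) w(4) x by blast
  qed
qed

definition mat_eigenspace :: "'k :: field mat \<Rightarrow> 'k \<Rightarrow> 'k vec set" where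
  "mat_eigenspace A c = {v \<in> carrier_vec (dim_col A). A *\<^sub>v v = c \<cdot>\<^sub>v v}"

lemma is_subspace_eigenspace:
  assumes "A \<in> carrier_mat n n"
  shows "is_subspace n (mat_eigenspace A c)"
  unfolding is_subspace_def mat_eigenspace_def
  using assms
  by (auto simp: mult_add_distrib_mat_vec [OF assms] mult_mat_vec [OF assms] smult_add_distrib_vec [of _ n]
      smult_smult_assoc mult.commute intro!: eq_vecI)

section \<open>Constructions of natural subspaces\<close>

lemma natural_subspaceI:
  assumes "\<And>M. D4_module M \<Longrightarrow> is_subspace (rdim M) (F M)"
    and "\<And>M N f v. f \<in> D4_hom M N \<Longrightarrow> D4_module M \<Longrightarrow> D4_module N \<Longrightarrow> v \<in> F M \<Longrightarrow> f *\<^sub>v v \<in> F N"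
  shows "natural_subspace F"
  using assms by (auto simp: natural_subspace_def)

lemma natural_subspaceD:
  assumes "natural_subspace F"
  shows "D4_module M \<Longrightarrow> is_subspace (rdim M) (F M)"
    and "f \<in> D4_hom M N \<Longrightarrow> D4_module M \<Longrightarrow> D4_module N \<Longrightarrow> v \<in> F M \<Longrightarrow> f *\<^sub>v v \<in> F N"
  using assms by (auto simp: natural_subspace_def)

lemma D4_hom_mult_act:
  assumes "f \<in> D4_hom M N" "D4_module M" "D4_module N" "v \<in> carrier_vec (rdim M)"
  shows "f *\<^sub>v (act M s *\<^sub>v v) = act N s *\<^sub>v (f *\<^sub>v v)"
  using assoc_mult_mat_vec [OF D4_homD(1) [OF assms(1)] act_carrier [OF assms(2)] assms(4), of s]
    assoc_mult_mat_vec [OF act_carrier [OF assms(3)] D4_homD(1) [OF assms(1)] assms(4), of s]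
    D4_homD(2) [OF assms(1), of s] by simp

lemma natural_carrier: "natural_subspace (\<lambda>M. carrier_vec (rdim M))"
  by (rule natural_subspaceI) (auto simp: is_subspace_carrier dest: D4_homD(1))

lemma natural_Int: "natural_subspace F \<Longrightarrow> natural_subspace G \<Longrightarrow> natural_subspace (\<lambda>M. F M \<inter> G M)"
  unfolding natural_subspace_def using is_subspace_Int by blast

lemma natural_eigenspace: "natural_subspace (\<lambda>M. mat_eigenspace (act M s) c)"
proof (rule natural_subspaceI)
  fix M N :: "'a rep" and f v
  assume f: "f \<in> D4_hom M N" and M: "D4_module M" and N: "D4_module N" and "v \<in> mat_eigenspace (act M s) c"
  then have v: "v \<in> carrier_vec (rdim M)" "act M s *\<^sub>v v = c \<cdot>\<^sub>v v"
    using carrier_matD [OF act_carrier [OF M]] by (auto simp: mat_eigenspace_def)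
  note fc = D4_homD(1) [OF f]
  have "act N s *\<^sub>v (f *\<^sub>v v) = c \<cdot>\<^sub>v (f *\<^sub>v v)"
    unfolding D4_hom_mult_act [OF f M N v(1), symmetric] v(2) by (rule mult_mat_vec [OF fc v(1)])
  then show "f *\<^sub>v v \<in> mat_eigenspace (act N s) c"
    using fc v(1) carrier_matD [OF act_carrier [OF N]] by (auto simp: mat_eigenspace_def)
qed (simp add: is_subspace_eigenspace)

lemma natural_image: 
  assumes F: "natural_subspace F"
  shows "natural_subspace (\<lambda>M. (\<lambda>v. act M s *\<^sub>v v) ` F M)"
proof (rule natural_subspaceI)
  fix M N :: "'a rep" and f x
  assume f: "f \<in> D4_hom M N" and M: "D4_module M" and N: "D4_module N" and "x \<in> (\<lambda>v. act M s *\<^sub>v v) ` F M"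
  then obtain v where v: "v \<in> F M" "x = act M s *\<^sub>v v" by auto
  then have "v \<in> carrier_vec (rdim M)" using is_subspaceD(1) [OF natural_subspaceD(1) [OF F M]] by auto
  then show "f *\<^sub>v x \<in> (\<lambda>v. act N s *\<^sub>v v) ` F N"
    using natural_subspaceD(2) [OF F f M N v(1)] v(2) D4_hom_mult_act [OF f M N] by auto
qed (use natural_subspaceD(1) [OF F] in \<open>auto intro!: is_subspace_mat_image\<close>)

lemma natural_sum:
  assumes F: "natural_subspace F" and G: "natural_subspace G"
  shows "natural_subspace (\<lambda>M. vec_sum (F M) (G M))"
proof (rule natural_subspaceI)
  fix M N :: "'a rep" and f x
  assume f: "f \<in> D4_hom M N" and M: "D4_module M" and N: "D4_module N" and "x \<in> vec_sum (F M) (G M)"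
  then obtain v w where x: "x = v + w" "v \<in> F M" "w \<in> G M" by (auto simp: vec_sum_def)
  then have "v \<in> carrier_vec (rdim M)" "w \<in> carrier_vec (rdim M)"
    using is_subspaceD(1) [OF natural_subspaceD(1) [OF F M]] is_subspaceD(1) [OF natural_subspaceD(1) [OF G M]] by auto
  then have "f *\<^sub>v x = f *\<^sub>v v + f *\<^sub>v w" unfolding x by (rule mult_add_distrib_mat_vec [OF D4_homD(1) [OF f]])
  then show "f *\<^sub>v x \<in> vec_sum (F N) (G N)"
    using natural_subspaceD(2) [OF F f M N x(2)] natural_subspaceD(2) [OF G f M N x(3)] unfolding vec_sum_def by blast
qed (intro is_subspace_sum natural_subspaceD(1) [OF F] natural_subspaceD(1) [OF G])

text \<open>Not the Jacobson radical in general: in characteristic other than 2 it is all of the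
  simple module \<open>V2 0\<close>. It vanishes on V(0) and contains the invariants of every other
  module to which the count of trivial summands is applied.\<close>

definition rad :: "'k :: field rep \<Rightarrow> 'k vec set" where
  "rad M = vec_sum ((\<lambda>v. act M Gen_a *\<^sub>v v) ` carrier_vec (rdim M)) ((\<lambda>v. act M Gen_d *\<^sub>v v) ` carrier_vec (rdim M))"

definition weight_space :: "'k :: field rep \<Rightarrow> 'k \<Rightarrow> 'k \<Rightarrow> 'k vec set" where
  "weight_space M e e' = mat_eigenspace (act M Gen_b) e \<inter> mat_eigenspace (act M Gen_c) e'"

definition invs :: "'k :: field rep \<Rightarrow> 'k vec set" where
  "invs M = weight_space M 1 1 \<inter> (mat_eigenspace (act M Gen_a) 0 \<inter> mat_eigenspace (act M Gen_d) 0)"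

text \<open>A vector \<open>v\<close> of weight (1, 1) with \<open>a d v\<close> nonzero generates a
  copy of \<open>P0\<close> whose socle is spanned by \<open>a d v\<close>; this is why the
  dimension counts summands P(V(0)).\<close>

definition ad_image :: "'k :: field rep \<Rightarrow> 'k vec set" where
  "ad_image M = (\<lambda>v. act M Gen_a *\<^sub>v v) ` (\<lambda>v. act M Gen_d *\<^sub>v v) ` weight_space M 1 1"

text \<open>In V(2,0) the basis vector of weight (1, -1) is \<open>v_1\<close>, with
  \<open>a v_1 = v_2\<close>; in V(2,1) it is \<open>v_2\<close>, which \<open>a\<close> kills. So
  the two simple modules are told apart.\<close>

definition a_image :: "'k :: field rep \<Rightarrow> 'k vec set" where
  "a_image M = (\<lambda>v. act M Gen_a *\<^sub>v v) ` weight_space M 1 (- 1)"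

lemma natural_weight_space: "natural_subspace (\<lambda>M. weight_space M e e')"
  unfolding weight_space_def by (intro natural_Int natural_eigenspace)

lemma natural_rad: "natural_subspace rad"
  unfolding rad_def [abs_def] by (intro natural_sum natural_image natural_carrier)

lemma natural_invs: "natural_subspace invs"
  unfolding invs_def [abs_def] by (intro natural_Int natural_weight_space natural_eigenspace)

lemma natural_invs_rad: "natural_subspace (\<lambda>M. vec_sum (invs M) (rad M))"
  by (intro natural_sum natural_rad natural_invs)

lemma natural_ad_image: "natural_subspace ad_image"
  unfolding ad_image_def [abs_def] by (intro natural_image natural_weight_space)

lemma natural_a_image: "natural_subspace a_image"
  unfolding a_image_def [abs_def] by (intro natural_image natural_weight_space)

lemma in_weight_space_iff:
  "D4_module M \<Longrightarrow> v \<in> weight_space M e e' \<longleftrightarrow>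
    v \<in> carrier_vec (rdim M) \<and> act M Gen_b *\<^sub>v v = e \<cdot>\<^sub>v v \<and> act M Gen_c *\<^sub>v v = e' \<cdot>\<^sub>v v"
  using carrier_matD(2) [OF act_carrier, of M] by (auto simp: weight_space_def mat_eigenspace_def)

lemma zero_smult_vec: "v \<in> carrier_vec n \<Longrightarrow> (0 :: 'k :: field) \<cdot>\<^sub>v v = 0\<^sub>v n"
  by (intro eq_vecI) auto

lemma in_invs_iff:
  "D4_module M \<Longrightarrow> v \<in> invs M \<longleftrightarrow> v \<in> carrier_vec (rdim M) \<and> act M Gen_b *\<^sub>v v = v \<and> act M Gen_c *\<^sub>v v = v \<and>
    act M Gen_a *\<^sub>v v = 0\<^sub>v (rdim M) \<and> act M Gen_d *\<^sub>v v = 0\<^sub>v (rdim M)"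
  using carrier_matD(2) [OF act_carrier, of M]
  by (auto simp: invs_def in_weight_space_iff mat_eigenspace_def zero_smult_vec)

lemma vec_sum_invs_rad:
  assumes M: "D4_module M" and sub: "invs M \<subseteq> rad M"
  shows "vec_sum (invs M) (rad M) = rad M"
proof
  note r = is_subspaceD [OF natural_subspaceD(1) [OF natural_rad M]]
  have "0\<^sub>v (rdim M) \<in> invs M" using is_subspaceD(2) [OF natural_subspaceD(1) [OF natural_invs M]] .
  moreover have "v = 0\<^sub>v (rdim M) + v" if "v \<in> rad M" for v using that r(1) by auto
  ultimately show "rad M \<subseteq> vec_sum (invs M) (rad M)" unfolding vec_sum_def by blast
  show "vec_sum (invs M) (rad M) \<subseteq> rad M" unfolding vec_sum_def using sub r(3) by blast
qed

lemma in_radI: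
  assumes "v \<in> carrier_vec (rdim M)" "w \<in> carrier_vec (rdim M)" "x = act M Gen_a *\<^sub>v v + act M Gen_d *\<^sub>v w"
  shows "x \<in> rad M"
  using assms unfolding rad_def vec_sum_def by blast

text \<open>Coordinates with respect to a basis of the second tensor factor: if that factor has
  dimension \<open>k\<close>, a vector of the tensor product becomes \<open>k\<close> vectors of the
  first one. The index \<open>i * k + j\<close> is the one used in \<open>kronecker\<close>.\<close>

definition vcomp :: "nat \<Rightarrow> nat \<Rightarrow> 'k vec \<Rightarrow> 'k vec" where
  "vcomp k j v = vec (dim_vec v div k) (\<lambda>i. v $ (i * k + j))"

lemma vcomp_carrier: "v \<in> carrier_vec (n * k) \<Longrightarrow> k > 0 \<Longrightarrow> vcomp k j v \<in> carrier_vec n"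
  by (auto simp: vcomp_def)

lemma vcomp_index_bound: "i < n \<Longrightarrow> j < k \<Longrightarrow> i * k + j < n * (k :: nat)"
  using mult_le_mono1 [of "Suc i" n k] by auto

lemma vcomp_eqI:
  assumes "v \<in> carrier_vec (n * k)" "w \<in> carrier_vec (n * k)" "\<And>j. j < k \<Longrightarrow> vcomp k j v = vcomp k j w"
  shows "v = w"
proof (rule eq_vecI)
  fix i assume "i < dim_vec w"
  then have i: "i < n * k" using assms by auto
  note b = div_mod_bounds [OF i]
  have "vcomp k (i mod k) v $ (i div k) = vcomp k (i mod k) w $ (i div k)" using assms(3) [OF b(2)] by simp
  then show "v $ i = w $ i" using b assms(1,2) by (cases "k = 0") (auto simp: vcomp_def)
qed (use assms in auto)

lemma vcomp_add:
  assumes "v \<in> carrier_vec (n * k)" "w \<in> carrier_vec (n * k)" "j < k"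
  shows "vcomp k j (v + w) = vcomp k j v + vcomp k j w"
  using assms vcomp_index_bound by (intro eq_vecI) (auto simp: vcomp_def)

lemma vcomp_zero: "j < k \<Longrightarrow> vcomp k j (0\<^sub>v (n * k)) = 0\<^sub>v n"
  using vcomp_index_bound by (intro eq_vecI) (auto simp: vcomp_def)

lemma vcomp_kronecker:
  fixes A B :: "'k :: field mat"
  assumes A: "A \<in> carrier_mat n n" and B: "B \<in> carrier_mat k k" and v: "v \<in> carrier_vec (n * k)" and j: "j < k"
  shows "vcomp k j (kronecker A B *\<^sub>v v) = vec n (\<lambda>i. \<Sum>l<k. B $$ (j, l) * (A *\<^sub>v vcomp k l v) $ i)"
proof (rule eq_vecI)
  fix i assume "i < dim_vec (vec n (\<lambda>i. \<Sum>l<k. B $$ (j, l) * (A *\<^sub>v vcomp k l v) $ i))"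
  then have i: "i < n" by simp
  have ij: "i * k + j < n * k" "(i * k + j) div k = i" "(i * k + j) mod k = j" using vcomp_index_bound [OF i j] j by auto
  have "vcomp k j (kronecker A B *\<^sub>v v) $ i = (kronecker A B *\<^sub>v v) $ (i * k + j)"
    using A B i j by (simp add: vcomp_def)
  also have "\<dots> = (\<Sum>x<n * k. A $$ (i, x div k) * B $$ (j, x mod k) * v $ (x div k * k + x mod k))"
    using A B v ij by (auto simp: scalar_prod_def atLeast0LessThan index_kronecker intro!: sum.cong)
  also have "\<dots> = (\<Sum>x<n. \<Sum>l<k. A $$ (i, x) * B $$ (j, l) * v $ (x * k + l))"
    by (rule sum_div_mod [of "\<lambda>x l. A $$ (i, x) * B $$ (j, l) * v $ (x * k + l)"])
  also have "\<dots> = (\<Sum>l<k. B $$ (j, l) * (\<Sum>x<n. A $$ (i, x) * v $ (x * k + l)))"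
    by (subst sum.swap) (simp add: sum_distrib_left mult_ac)
  also have "\<dots> = (\<Sum>l<k. B $$ (j, l) * (A *\<^sub>v vcomp k l v) $ i)"
    using A v i j by (auto simp: vcomp_def scalar_prod_def atLeast0LessThan intro!: sum.cong)
  finally show "vcomp k j (kronecker A B *\<^sub>v v) $ i = vec n (\<lambda>i. \<Sum>l<k. B $$ (j, l) * (A *\<^sub>v vcomp k l v) $ i) $ i"
    using i by simp
qed (use A B j in \<open>auto simp: vcomp_def\<close>)

lemma vcomp_tensor_int_rep:
  assumes M: "D4_module M" and v: "v \<in> carrier_vec (rdim M * k)" and j: "j < k"
  shows "vcomp k j (act (tensor_rep M (int_rep k S)) Gen_a *\<^sub>v v) = vec (rdim M) (\<lambda>i.
      (\<Sum>l<k. of_int (S Gen_b ! j ! l) * (act M Gen_a *\<^sub>v vcomp k l v) $ i) + (\<Sum>l<k. of_int (S Gen_a ! j ! l) * vcomp k l v $ i))"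
    and "vcomp k j (act (tensor_rep M (int_rep k S)) Gen_d *\<^sub>v v) = vec (rdim M) (\<lambda>i.
      (\<Sum>l<k. of_int (S Gen_c ! j ! l) * (act M Gen_d *\<^sub>v vcomp k l v) $ i) + (\<Sum>l<k. of_int (S Gen_d ! j ! l) * vcomp k l v $ i))"
proof -
  note ac = act_carrier [OF M]
  have 1: "vcomp k j ((kronecker (act M s) (int_mat k k B) + kronecker (1\<^sub>m (rdim M)) (int_mat k k A)) *\<^sub>v v)
     = vec (rdim M) (\<lambda>i. (\<Sum>l<k. of_int (B ! j ! l) * (act M s *\<^sub>v vcomp k l v) $ i) + (\<Sum>l<k. of_int (A ! j ! l) * vcomp k l v $ i))"
    for s A B
  proof -
    have K: "kronecker (act M s) (int_mat k k B) \<in> carrier_mat (rdim M * k) (rdim M * k)"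
      "kronecker (1\<^sub>m (rdim M)) (int_mat k k A) \<in> carrier_mat (rdim M * k) (rdim M * k)" using ac by auto
    have [simp]: "1\<^sub>m (rdim M) *\<^sub>v vcomp k l v = vcomp k l v" for l
      using vcomp_carrier [OF v] j by simp
    show ?thesis
      unfolding add_mult_distrib_mat_vec [OF K v] vcomp_add [OF mult_mat_vec_carrier [OF K(1) v] mult_mat_vec_carrier [OF K(2) v] j]
        vcomp_kronecker [OF ac int_mat_carrier v j] vcomp_kronecker [OF one_carrier_mat int_mat_carrier v j]
      using j by (intro eq_vecI) (auto simp: int_mat_def)
  qed
  show "vcomp k j (act (tensor_rep M (int_rep k S)) Gen_a *\<^sub>v v) = vec (rdim M) (\<lambda>i.
      (\<Sum>l<k. of_int (S Gen_b ! j ! l) * (act M Gen_a *\<^sub>v vcomp k l v) $ i) + (\<Sum>l<k. of_int (S Gen_a ! j ! l) * vcomp k l v $ i))"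
    "vcomp k j (act (tensor_rep M (int_rep k S)) Gen_d *\<^sub>v v) = vec (rdim M) (\<lambda>i.
      (\<Sum>l<k. of_int (S Gen_c ! j ! l) * (act M Gen_d *\<^sub>v vcomp k l v) $ i) + (\<Sum>l<k. of_int (S Gen_d ! j ! l) * vcomp k l v $ i))"
    by (simp_all add: 1 act_tensor_rep)
qed

lemma sum_lessThan_3: "(\<Sum>i<3. f i) = f 0 + f 1 + (f (2 :: nat) :: 'a :: comm_monoid_add)"
  by (simp add: eval_nat_numeral)

lemma sum_lessThan_2: "(\<Sum>i<2. f i) = f 0 + (f (1 :: nat) :: 'a :: comm_monoid_add)"
  by (simp add: eval_nat_numeral)

lemma vcomp_tensor_Y:
  assumes M: "D4_module M" and v: "v \<in> carrier_vec (rdim M * 3)"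
  defines "T \<equiv> tensor_rep M (int_rep 3 int_Y)"
  shows "vcomp 3 0 (act T Gen_a *\<^sub>v v) = - (act M Gen_a *\<^sub>v vcomp 3 0 v)"
    "vcomp 3 1 (act T Gen_a *\<^sub>v v) = - (act M Gen_a *\<^sub>v vcomp 3 1 v)"
    "vcomp 3 2 (act T Gen_a *\<^sub>v v) = act M Gen_a *\<^sub>v vcomp 3 2 v + vcomp 3 1 v"
    "vcomp 3 0 (act T Gen_d *\<^sub>v v) = - (act M Gen_d *\<^sub>v vcomp 3 0 v)"
    "vcomp 3 1 (act T Gen_d *\<^sub>v v) = - (act M Gen_d *\<^sub>v vcomp 3 1 v)"
    "vcomp 3 2 (act T Gen_d *\<^sub>v v) = act M Gen_d *\<^sub>v vcomp 3 2 v - vcomp 3 0 v"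
  unfolding T_def using carrier_matD [OF act_carrier [OF M]] vcomp_carrier [OF v, THEN carrier_vecD]
  by (auto intro!: eq_vecI simp: vcomp_tensor_int_rep [OF M v] sum_lessThan_3)

lemma vcomp_tensor_V2:
  assumes M: "D4_module M" and v: "v \<in> carrier_vec (rdim M * 2)"
  defines "T \<equiv> tensor_rep M (V2 0)"
  shows "vcomp 2 0 (act T Gen_a *\<^sub>v v) = act M Gen_a *\<^sub>v vcomp 2 0 v"
    "vcomp 2 1 (act T Gen_a *\<^sub>v v) = - (act M Gen_a *\<^sub>v vcomp 2 1 v) + vcomp 2 0 v"
    "vcomp 2 0 (act T Gen_d *\<^sub>v v) = - (act M Gen_d *\<^sub>v vcomp 2 0 v) + 2 \<cdot>\<^sub>v vcomp 2 1 v"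
    "vcomp 2 1 (act T Gen_d *\<^sub>v v) = act M Gen_d *\<^sub>v vcomp 2 1 v"
  unfolding T_def V2_eq_int_rep using carrier_matD [OF act_carrier [OF M]] vcomp_carrier [OF v, THEN carrier_vecD]
  by (auto intro!: eq_vecI simp: vcomp_tensor_int_rep [OF M v] sum_lessThan_2)

lemma vcomp_vec: 
  assumes "j < k" "\<And>l. l < k \<Longrightarrow> m l \<in> carrier_vec n"
  shows "vcomp k j (vec (n * k) (\<lambda>i. m (i mod k) $ (i div k))) = m j"
  using assms(1) assms(2) [OF assms(1)] vcomp_index_bound [OF _ assms(1)] by (intro eq_vecI) (auto simp: vcomp_def)

lemma from_comps:
  assumes "\<And>l. l < k \<Longrightarrow> m l \<in> carrier_vec n"
  obtains v where "v \<in> carrier_vec (n * k)" "\<And>j. j < k \<Longrightarrow> vcomp k j v = m j"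
  by (rule that [of "vec (n * k) (\<lambda>i. m (i mod k) $ (i div k))"]) (simp_all add: vcomp_vec assms)

text \<open>
  The invariant of the induction on \<open>m\<close> that keeps \<open>V(0)\<close> from being a direct summand of
  \<open>(\<Omega> V(0))\<^bsup>\<otimes>m\<^esup>\<close>: every element of \<open>d M\<close> killed by \<open>a\<close> lies in \<open>a M\<close>.
\<close>

definition a_absorbs :: "'k :: field rep \<Rightarrow> bool" where
  "a_absorbs M \<longleftrightarrow> (\<forall>v \<in> carrier_vec (rdim M). act M Gen_a *\<^sub>v (act M Gen_d *\<^sub>v v) = 0\<^sub>v (rdim M) \<longrightarrow>
     (\<exists>w \<in> carrier_vec (rdim M). act M Gen_d *\<^sub>v v = act M Gen_a *\<^sub>v w))"

lemma mult_uminus_vec: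
  fixes A :: "'k :: field mat"
  shows "A \<in> carrier_mat m n \<Longrightarrow> v \<in> carrier_vec n \<Longrightarrow> A *\<^sub>v (- v) = - (A *\<^sub>v v)"
  by (intro eq_vecI) auto

lemma mult_zero_vec: "A \<in> carrier_mat m n \<Longrightarrow> A *\<^sub>v 0\<^sub>v n = (0\<^sub>v m :: 'k :: field vec)"
  by (intro eq_vecI) auto

lemma uminus_uminus_vec [simp]: "- (- (v :: 'k :: field vec)) = v"
  by (intro eq_vecI) auto

lemma less_3_cases: "(j :: nat) < 3 \<Longrightarrow> j = 0 \<or> j = 1 \<or> j = 2"
  by auto

lemma uminus_vec_eq_0: "v \<in> carrier_vec n \<Longrightarrow> - v = 0\<^sub>v n \<longleftrightarrow> v = (0\<^sub>v n :: 'k :: field vec)"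
  by (metis uminus_uminus_vec uminus_zero_vec)

lemma vec_add_eq_0:
  assumes "v + w = 0\<^sub>v n" "v \<in> carrier_vec n" "w \<in> carrier_vec n"
  shows "w = - (v :: 'k :: field vec)"
proof (rule eq_vecI)
  fix i assume i: "i < dim_vec (- v)"
  then have "v $ i + w $ i = 0" using arg_cong [OF assms(1), of "\<lambda>u. vec_index u i"] assms(2,3) by simp
  then show "w $ i = (- v) $ i" using i by (simp add: eq_neg_iff_add_eq_0 add.commute)
qed (use assms in auto)

lemma a_absorbs_V1: "a_absorbs (V1 r :: 'k :: field rep)"
  unfolding a_absorbs_def by (auto simp: act_V1 intro!: bexI [of _ "0\<^sub>v 1"])

text \<open>
  \<open>T = M \<otimes> \<Omega> V(0)\<close> consists of triples \<open>(m\<^sub>0, m\<^sub>1, m\<^sub>2)\<close>, on which \<open>a\<close> and \<open>d\<close> act by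
  \<open>(- a m\<^sub>0, - a m\<^sub>1, a m\<^sub>2 + m\<^sub>1)\<close> and \<open>(- d m\<^sub>0, - d m\<^sub>1, d m\<^sub>2 - m\<^sub>0)\<close>.
\<close>

lemma a_absorbs_tensor_Y:
  assumes M: "D4_module M" and abs: "a_absorbs M"
  shows "a_absorbs (tensor_rep M (int_rep 3 int_Y))"
  unfolding a_absorbs_def
proof (intro ballI impI)
  let ?T = "tensor_rep M (int_rep 3 int_Y) :: 'a rep" and ?n = "rdim M"
  let ?a = "\<lambda>v. act M Gen_a *\<^sub>v v" and ?d = "\<lambda>v. act M Gen_d *\<^sub>v v"
  have T: "D4_module ?T" using M by simp
  note ac = act_carrier [OF M] and mc = mult_mat_vec_carrier [OF act_carrier [OF M]]
  fix v assume "v \<in> carrier_vec (rdim ?T)" and adv: "act ?T Gen_a *\<^sub>v (act ?T Gen_d *\<^sub>v v) = 0\<^sub>v (rdim ?T)"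
  then have v: "v \<in> carrier_vec (?n * 3)" by simp
  define m where "m j = vcomp 3 j v" for j
  have m: "m j \<in> carrier_vec ?n" for j unfolding m_def by (rule vcomp_carrier [OF v]) simp
  have Tc: "act ?T s *\<^sub>v u \<in> carrier_vec (?n * 3)" if "u \<in> carrier_vec (?n * 3)" for s u
    using mult_mat_vec_carrier [OF act_carrier [OF T], of u s] that by simp
  note dv = Tc [OF v]
  note cd = vcomp_tensor_Y(4-6) [OF M v, folded m_def]
  have zero: "vcomp 3 j (act ?T Gen_a *\<^sub>v (act ?T Gen_d *\<^sub>v v)) = 0\<^sub>v ?n" if "j < 3" for j
    unfolding adv using vcomp_zero [OF that, of ?n] by simp
  have "?a (?d (m 0)) = 0\<^sub>v ?n"
    using zero [of 0] vcomp_tensor_Y(1) [OF M dv] cd(1) mult_uminus_vec [OF ac mc [OF m], of Gen_a Gen_d 0] by simp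
  then obtain p where p: "p \<in> carrier_vec ?n" "?d (m 0) = ?a p" using abs m by (auto simp: a_absorbs_def)
  \<comment> \<open>The third component of \<open>d v\<close>. The vanishing of the third component
    of \<open>a d v\<close> then reads \<open>a q = d m_1\<close>.\<close>
  define q where "q = ?d (m 2) - m 0"
  have q: "q \<in> carrier_vec ?n" using mc [OF m] m by (simp add: q_def)
  have "?a q + - ?d (m 1) = 0\<^sub>v ?n"
    using zero [of 2] vcomp_tensor_Y(3) [OF M dv] cd(2,3) by (simp add: q_def)
  then have aq: "?a q = ?d (m 1)"
    using vec_add_eq_0 [of "?a q" "- ?d (m 1)" ?n] mc [OF q] mc [OF m] by (metis uminus_carrier_vec uminus_uminus_vec)
  \<comment> \<open>The preimage of \<open>d v\<close> under \<open>a\<close> is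
    \<open>(p, q, 0)\<close>, since its image is \<open>(- a p, - a q, q)\<close>.\<close>
  obtain w where w: "w \<in> carrier_vec (?n * 3)" "\<And>j. j < 3 \<Longrightarrow> vcomp 3 j w = (if j = 0 then p else if j = 1 then q else 0\<^sub>v ?n)"
    by (rule from_comps [of 3 "\<lambda>j. if j = 0 then p else if j = 1 then q else 0\<^sub>v ?n" ?n]) (use p q in auto)
  have "act ?T Gen_d *\<^sub>v v = act ?T Gen_a *\<^sub>v w"
  proof (rule vcomp_eqI [OF dv])
    show "act ?T Gen_a *\<^sub>v w \<in> carrier_vec (?n * 3)" by (rule Tc [OF w(1)])
    have a0: "?a (0\<^sub>v ?n) = 0\<^sub>v ?n" using ac [of Gen_a] by (intro eq_vecI) auto
    fix j :: nat assume "j < 3"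
    then show "vcomp 3 j (act ?T Gen_d *\<^sub>v v) = vcomp 3 j (act ?T Gen_a *\<^sub>v w)"
      using less_3_cases [of j] w(2) [of 0] w(2) [of 1] w(2) [of 2] vcomp_tensor_Y(1-3) [OF M w(1)] cd p aq q a0
      by (auto simp: q_def)
  qed
  then show "\<exists>w \<in> carrier_vec (rdim ?T). act ?T Gen_d *\<^sub>v v = act ?T Gen_a *\<^sub>v w" using w(1) by auto
qed

text \<open>An invariant triple satisfies \<open>m_1 = - a m_2\<close>, \<open>m_0 = d m_2\<close>
  and \<open>a d m_2 = 0\<close>. By \<open>a_absorbs\<close> there is \<open>p\<close> with
  \<open>d m_2 = a p\<close>, and the triple is the image of \<open>(- p, m_2, 0)\<close> under
  \<open>a\<close>.\<close>

lemma invs_tensor_Y: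
  assumes M: "D4_module M" and abs: "a_absorbs M"
  shows "invs (tensor_rep M (int_rep 3 int_Y)) \<subseteq> rad (tensor_rep M (int_rep 3 int_Y))"
proof
  let ?T = "tensor_rep M (int_rep 3 int_Y) :: 'a rep" and ?n = "rdim M"
  let ?a = "\<lambda>v. act M Gen_a *\<^sub>v v" and ?d = "\<lambda>v. act M Gen_d *\<^sub>v v"
  have T: "D4_module ?T" using M by simp
  note ac = act_carrier [OF M] and mc = mult_mat_vec_carrier [OF act_carrier [OF M]]
  fix v assume "v \<in> invs ?T"
  then have v: "v \<in> carrier_vec (?n * 3)" and av: "act ?T Gen_a *\<^sub>v v = 0\<^sub>v (?n * 3)" and dv: "act ?T Gen_d *\<^sub>v v = 0\<^sub>v (?n * 3)"
    using in_invs_iff [OF T] by auto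
  define m where "m j = vcomp 3 j v" for j
  have m: "m j \<in> carrier_vec ?n" for j unfolding m_def by (rule vcomp_carrier [OF v]) simp
  note ca = vcomp_tensor_Y(1-3) [OF M v, folded m_def] and cd = vcomp_tensor_Y(4-6) [OF M v, folded m_def]
  have cz: "vcomp 3 j (0\<^sub>v (?n * 3)) = (0\<^sub>v ?n :: 'a vec)" if "j < 3" for j using that by (rule vcomp_zero)
  have "?a (m 2) + m 1 = 0\<^sub>v ?n" using ca(3) cz [of 2] unfolding av by simp
  then have m1: "m 1 = - ?a (m 2)" by (rule vec_add_eq_0) (use mc m in auto)
  have "?d (m 2) - m 0 = 0\<^sub>v ?n" using cd(3) cz [of 2] unfolding dv by simp
  then have m0: "m 0 = ?d (m 2)"
    using vec_add_eq_0 [of "?d (m 2)" "- m 0" ?n] mc [OF m] m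
    by (metis minus_add_uminus_vec uminus_carrier_vec uminus_uminus_vec)
  have "- ?a (m 0) = 0\<^sub>v ?n" using ca(1) cz [of 0] unfolding av by simp
  then have "?a (?d (m 2)) = 0\<^sub>v ?n" unfolding m0 using uminus_vec_eq_0 [OF mc [OF mc [OF m]]] by blast
  then obtain p where p: "p \<in> carrier_vec ?n" "?d (m 2) = ?a p" using abs m by (auto simp: a_absorbs_def)
  obtain w where w: "w \<in> carrier_vec (?n * 3)" "\<And>j. j < 3 \<Longrightarrow> vcomp 3 j w = (if j = 0 then - p else if j = 1 then m 2 else 0\<^sub>v ?n)"
    by (rule from_comps [of 3 "\<lambda>j. if j = 0 then - p else if j = 1 then m 2 else 0\<^sub>v ?n" ?n]) (use p m in auto)
  have aw: "act ?T Gen_a *\<^sub>v w \<in> carrier_vec (?n * 3)"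
    using mult_mat_vec_carrier [OF act_carrier [OF T], of w Gen_a] w(1) by simp
  have "v = act ?T Gen_a *\<^sub>v w"
  proof (rule vcomp_eqI [OF v aw])
    have a0: "?a (0\<^sub>v ?n) = 0\<^sub>v ?n" using ac [of Gen_a] by (intro eq_vecI) auto
    fix j :: nat assume "j < 3"
    then show "vcomp 3 j v = vcomp 3 j (act ?T Gen_a *\<^sub>v w)"
      using less_3_cases [of j] w(2) [of 0] w(2) [of 1] w(2) [of 2] vcomp_tensor_Y(1-3) [OF M w(1)]
        mult_uminus_vec [OF ac p(1)] m0 m1 p a0 m unfolding m_def [symmetric]
      by (auto)
  qed
  moreover have "act ?T Gen_d *\<^sub>v 0\<^sub>v (?n * 3) = 0\<^sub>v (?n * 3)"
    using mult_zero_vec [OF act_carrier [OF T], of Gen_d] by simp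
  ultimately show "v \<in> rad ?T" using w(1) aw by (intro in_radI [of w _ "0\<^sub>v (?n * 3)"]) auto
qed

text \<open>On pairs, \<open>d\<close> acts by \<open>(- d m_0 + 2 m_1, d m_1)\<close>. If this
  vanishes, then \<open>m_1 = d m_0 / 2\<close>, and the pair is the image of
  \<open>(0, m_0 / 2)\<close> under \<open>d\<close>.\<close>

lemma invs_tensor_V2:
  assumes two: "(2 :: 'k :: field) \<noteq> 0" and M: "D4_module (M :: 'k rep)"
  shows "invs (tensor_rep M (V2 0)) \<subseteq> rad (tensor_rep M (V2 0))"
proof
  let ?T = "tensor_rep M (V2 0) :: 'k rep" and ?n = "rdim M"
  let ?a = "\<lambda>v. act M Gen_a *\<^sub>v v" and ?d = "\<lambda>v. act M Gen_d *\<^sub>v v"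
  have rdim: "rdim ?T = ?n * 2" by (simp add: V2_def)
  have T: "D4_module ?T" using M by simp
  note ac = act_carrier [OF M] and mc = mult_mat_vec_carrier [OF act_carrier [OF M]]
  fix v assume "v \<in> invs ?T"
  then have v: "v \<in> carrier_vec (?n * 2)" and dv: "act ?T Gen_d *\<^sub>v v = 0\<^sub>v (?n * 2)"
    using in_invs_iff [OF T] unfolding rdim by auto
  define m where "m j = vcomp 2 j v" for j
  have m: "m j \<in> carrier_vec ?n" for j unfolding m_def by (rule vcomp_carrier [OF v]) simp
  note cd = vcomp_tensor_V2(3,4) [OF M v, folded m_def]
  have cz: "vcomp 2 j (0\<^sub>v (?n * 2)) = (0\<^sub>v ?n :: 'k vec)" if "j < 2" for j using that by (rule vcomp_zero)
  have "- ?d (m 0) + 2 \<cdot>\<^sub>v m 1 = 0\<^sub>v ?n" using cd(1) cz [of 0] unfolding dv by simp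
  then have "2 \<cdot>\<^sub>v m 1 = ?d (m 0)" using vec_add_eq_0 [of "- ?d (m 0)" "2 \<cdot>\<^sub>v m 1" ?n] mc [OF m] m by simp
  then have "?d ((1 / 2) \<cdot>\<^sub>v m 0) = (1 / 2) \<cdot>\<^sub>v (2 \<cdot>\<^sub>v m 1)" using mult_mat_vec [OF ac m, of Gen_d "1 / 2" 0] by simp
  also have "\<dots> = m 1" using two by (simp add: smult_smult_assoc)
  finally have m1: "?d ((1 / 2) \<cdot>\<^sub>v m 0) = m 1" .
  obtain w where w: "w \<in> carrier_vec (?n * 2)" "\<And>j. j < 2 \<Longrightarrow> vcomp 2 j w = (if j = 0 then 0\<^sub>v ?n else (1 / 2) \<cdot>\<^sub>v m 0)"
    by (rule from_comps [of 2 "\<lambda>j. if j = 0 then 0\<^sub>v ?n else (1 / 2) \<cdot>\<^sub>v m 0" ?n]) (use m in auto)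
  have dw: "act ?T Gen_d *\<^sub>v w \<in> carrier_vec (?n * 2)" using mult_mat_vec_carrier [OF act_carrier [OF T]] w(1) unfolding rdim .
  have "v = act ?T Gen_d *\<^sub>v w"
  proof (rule vcomp_eqI [OF v dw])
    have d0: "- ?d (0\<^sub>v ?n) + 2 \<cdot>\<^sub>v ((1 / 2) \<cdot>\<^sub>v m 0) = m 0" using ac [of Gen_d] m [of 0] two by (intro eq_vecI) auto
    fix j :: nat assume "j < 2"
    then show "vcomp 2 j v = vcomp 2 j (act ?T Gen_d *\<^sub>v w)"
      using less_2_cases [of j] w(2) [of 0] w(2) [of 1] vcomp_tensor_V2(3,4) [OF M w(1)] m1 d0 unfolding m_def [symmetric]
      by (auto)
  qed
  moreover have "act ?T Gen_a *\<^sub>v 0\<^sub>v (?n * 2) = 0\<^sub>v (?n * 2)"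
    using mult_zero_vec [OF act_carrier [OF T], of Gen_a] unfolding rdim .
  ultimately show "v \<in> rad ?T" using w(1) dw unfolding rdim by (intro in_radI [of "0\<^sub>v (?n * 2)" _ w]) (auto simp: rdim)
qed

text \<open>On the weight space \<open>b c\<close> acts by \<open>e * e' = - s\<close>, on the whole
  module by \<open>s\<close>, so a vector of that weight equals its own negative.\<close>

lemma weight_space_eq_zero:
  assumes two: "(2 :: 'k :: field) \<noteq> 0" and M: "D4_module (M :: 'k rep)"
    and bc: "act M Gen_b * act M Gen_c = s \<cdot>\<^sub>m 1\<^sub>m (rdim M)" and "e * e' = - s" "s \<noteq> 0"
  shows "weight_space M e e' = {0\<^sub>v (rdim M)}"
proof -
  note ac = act_carrier [OF M]
  have "v = 0\<^sub>v (rdim M)" if "v \<in> weight_space M e e'" for v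
  proof -
    have v: "v \<in> carrier_vec (rdim M)" "act M Gen_b *\<^sub>v v = e \<cdot>\<^sub>v v" "act M Gen_c *\<^sub>v v = e' \<cdot>\<^sub>v v"
      using that in_weight_space_iff [OF M] by auto
    have "s \<cdot>\<^sub>v v = act M Gen_b *\<^sub>v (act M Gen_c *\<^sub>v v)"
      unfolding assoc_mult_mat_vec [OF ac ac v(1), symmetric] bc using v(1) by (intro eq_vecI) auto
    also have "\<dots> = (e * e') \<cdot>\<^sub>v v"
      unfolding v(3) mult_mat_vec [OF ac v(1)] v(2) by (simp add: smult_smult_assoc mult.commute)
    finally have "s \<cdot>\<^sub>v v = - s \<cdot>\<^sub>v v" using assms(4) by simp
    show ?thesis
    proof (rule eq_vecI)
      fix i assume "i < dim_vec (0\<^sub>v (rdim M) :: 'k vec)"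
      then have "s * v $ i = - s * v $ i"
        using arg_cong [OF \<open>s \<cdot>\<^sub>v v = - s \<cdot>\<^sub>v v\<close>, of "\<lambda>w. vec_index w i"] v(1) by simp
      then have "2 * (s * v $ i) = 0" by (simp add: algebra_simps)
      then show "v $ i = 0\<^sub>v (rdim M) $ i" using two assms(5) \<open>i < dim_vec _\<close> by simp
    qed (use v(1) in simp)
  qed
  then show ?thesis using is_subspaceD(2) [OF natural_subspaceD(1) [OF natural_weight_space M]] by blast
qed

lemma kronecker_smult: "kronecker (s \<cdot>\<^sub>m A) (t \<cdot>\<^sub>m B) = (s * t :: 'k :: field) \<cdot>\<^sub>m kronecker A B"
  by (intro eq_matI) (auto simp: index_kronecker div_mod_bounds)

text \<open>\<open>b c\<close> is a central group-like involution, so it separates blocks and its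
  scalar is multiplicative on tensor products. The scalar is 1 on V(r) and \<open>P0\<close>, and -1
  on V(2,r).\<close>

definition bc_scalar :: "'k :: field rep \<Rightarrow> 'k \<Rightarrow> bool" where
  "bc_scalar M s \<longleftrightarrow> act M Gen_b * act M Gen_c = s \<cdot>\<^sub>m 1\<^sub>m (rdim M)"

lemma bc_scalar_tensor:
  assumes M: "D4_module M" and N: "D4_module N" and "bc_scalar M s" "bc_scalar N t"
  shows "bc_scalar (tensor_rep M N) (s * t)"
  using assms(3,4) kronecker_mult [OF act_carrier [OF M] act_carrier [OF M] act_carrier [OF N] act_carrier [OF N], of Gen_b Gen_b Gen_c Gen_c]
    kronecker_smult [of s "1\<^sub>m (rdim M)" t "1\<^sub>m (rdim N)"]
  by (simp add: bc_scalar_def act_tensor_rep)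

lemma bc_scalar_V1: "bc_scalar (V1 r :: 'k :: field rep) 1"
proof -
  have "(- 1 :: 'k) ^ r * (- 1) ^ r = 1" by (simp flip: power_mult_distrib)
  then show ?thesis unfolding bc_scalar_def by (intro eq_matI) (auto simp: act_V1 scalar_prod_def)
qed

lemma bc_scalar_V2: "bc_scalar (V2 0 :: 'k :: field rep) (- 1)"
  unfolding bc_scalar_def V2_eq_int_rep
  by (intro eq_matI) (auto simp: int_mat_def scalar_prod_def atLeast0LessThan sum_lessThan_2 less_2_cases_iff)

text \<open>The functionals for \<open>a_image\<close> and \<open>ad_image\<close> only have to
  separate one nonzero value from zeros, so this form avoids computing dimensions.\<close>

lemma natural_functional:
  fixes F :: "'k :: field rep \<Rightarrow> 'k vec set"
  assumes F: "natural_subspace F"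
  obtains \<Phi> :: "('k rep set \<Rightarrow>\<^sub>0 int) \<Rightarrow> int"
  where "additive_functional \<Phi>"
    "\<And>M. D4_module M \<Longrightarrow> \<Phi> (frag_of (iso_class M)) = 0 \<longleftrightarrow> F M = {0\<^sub>v (rdim M)}"
proof -
  obtain \<Phi> :: "('k rep set \<Rightarrow>\<^sub>0 int) \<Rightarrow> int"
    where \<Phi>: "additive_functional \<Phi>" "\<And>M. D4_module M \<Longrightarrow> \<Phi> (frag_of (iso_class M)) = int (vec_dim (F M))"
    using natural_subspace_functional [OF F] by blast
  show thesis
  proof (rule that [OF \<Phi>(1)])
    fix M :: "'k rep" assume M: "D4_module M"
    show "\<Phi> (frag_of (iso_class M)) = 0 \<longleftrightarrow> F M = {0\<^sub>v (rdim M)}"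
      using \<Phi>(2) [OF M] vec_dim_eq_0_iff [OF natural_subspaceD(1) [OF F M]] by simp
  qed
qed

text \<open>The multiplicity of \<open>V(0)\<close> as a direct summand is \<open>dim (invs + rad) - dim rad\<close>.\<close>

lemma trivial_summand_functional:
  obtains \<Phi> :: "('k :: field rep set \<Rightarrow>\<^sub>0 int) \<Rightarrow> int"
  where "additive_functional \<Phi>" "\<Phi> (frag_of (iso_class (V1 0))) \<noteq> 0"
    "\<And>M. D4_module M \<Longrightarrow> invs M \<subseteq> rad M \<Longrightarrow> \<Phi> (frag_of (iso_class M)) = 0"
proof -
  obtain \<Phi>\<^sub>1 :: "('k rep set \<Rightarrow>\<^sub>0 int) \<Rightarrow> int"
    where \<Phi>1: "additive_functional \<Phi>\<^sub>1"
      "\<And>M. D4_module M \<Longrightarrow> \<Phi>\<^sub>1 (frag_of (iso_class M)) = int (vec_dim (vec_sum (invs M) (rad M)))"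
    using natural_subspace_functional [OF natural_invs_rad] by blast
  obtain \<Phi>\<^sub>2 :: "('k rep set \<Rightarrow>\<^sub>0 int) \<Rightarrow> int"
    where \<Phi>2: "additive_functional \<Phi>\<^sub>2"
      "\<And>M. D4_module M \<Longrightarrow> \<Phi>\<^sub>2 (frag_of (iso_class M)) = int (vec_dim (rad M))"
    using natural_subspace_functional [OF natural_rad] by blast
  have zero: "v \<in> carrier_vec 1 \<Longrightarrow> 0\<^sub>m 1 1 *\<^sub>v v = 0\<^sub>v 1" for v :: "'k vec" by (intro eq_vecI) auto
  have "rad (V1 0 :: 'k rep) = {0\<^sub>v 1}"
    using is_subspaceD(2) [OF natural_subspaceD(1) [OF natural_rad D4_module_V1 [of 0, where 'k = 'k]]] zero
    by (auto simp: rad_def vec_sum_def act_V1)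
  moreover have "unit_vec 1 0 \<in> vec_sum (invs (V1 0 :: 'k rep)) (rad (V1 0))"
  proof -
    have "unit_vec 1 0 \<in> invs (V1 0 :: 'k rep)"
      using zero by (auto simp: in_invs_iff act_V1 [unfolded One_nat_def])
    moreover have "unit_vec 1 0 = unit_vec 1 0 + (0\<^sub>v 1 :: 'k vec)" by (rule right_zero_vec [symmetric]) simp
    ultimately show ?thesis using \<open>rad _ = _\<close> unfolding vec_sum_def by blast
  qed
  then have "vec_sum (invs (V1 0 :: 'k rep)) (rad (V1 0)) \<noteq> {0\<^sub>v 1}" using unit_vec_nonzero [of 0 1] by auto
  ultimately have "vec_dim (vec_sum (invs (V1 0 :: 'k rep)) (rad (V1 0))) \<noteq> 0" "vec_dim (rad (V1 0 :: 'k rep)) = 0"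
    using vec_dim_eq_0_iff [OF natural_subspaceD(1) [OF natural_invs_rad D4_module_V1 [of 0, where 'k = 'k]]]
      vec_dim_eq_0_iff [OF natural_subspaceD(1) [OF natural_rad D4_module_V1 [of 0, where 'k = 'k]]] by auto
  then show thesis
    by (intro that [of "\<lambda>p. \<Phi>\<^sub>1 p - \<Phi>\<^sub>2 p"]) (use \<Phi>1(1) \<Phi>2(1) in \<open>simp_all add: \<Phi>1(2) \<Phi>2(2) vec_sum_invs_rad additive_functional_def\<close>)
qed

context char_not_2
begin

lemma weight_space_11_eq_zero:
  "D4_module M \<Longrightarrow> bc_scalar M (- 1) \<Longrightarrow> weight_space (M :: 'k rep) 1 1 = {0\<^sub>v (rdim M)}"
  by (rule weight_space_eq_zero [OF two_nonzero, of _ "- 1"]) (auto simp: bc_scalar_def)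

lemma ad_image_eq_zero: "D4_module M \<Longrightarrow> bc_scalar M (- 1) \<Longrightarrow> ad_image (M :: 'k rep) = {0\<^sub>v (rdim M)}"
  using mult_zero_vec [OF act_carrier [of M]] by (simp add: ad_image_def weight_space_11_eq_zero)

lemma a_image_eq_zero: "D4_module M \<Longrightarrow> bc_scalar M 1 \<Longrightarrow> a_image (M :: 'k rep) = {0\<^sub>v (rdim M)}"
  using mult_zero_vec [OF act_carrier [of M]] weight_space_eq_zero [OF two_nonzero, of M 1 1 "- 1"]
  by (simp add: a_image_def bc_scalar_def)

lemma invs_subset_rad_bc: "D4_module M \<Longrightarrow> bc_scalar M (- 1) \<Longrightarrow> invs (M :: 'k rep) \<subseteq> rad M"
  using weight_space_11_eq_zero [of M] is_subspaceD(2) [OF natural_subspaceD(1) [OF natural_rad, of M]]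
  by (auto simp: invs_def)

lemma invs_subset_rad_V1_1: "invs (V1 1 :: 'k rep) \<subseteq> rad (V1 1)"
proof
  fix v :: "'k vec" assume "v \<in> invs (V1 1)"
  then have v: "v \<in> carrier_vec 1" and bv: "act (V1 1) Gen_b *\<^sub>v v = v" by (auto simp: in_invs_iff)
  have "v = 0\<^sub>v 1"
  proof (rule eq_vecI)
    fix i assume "i < dim_vec (0\<^sub>v 1 :: 'k vec)"
    moreover have "(act (V1 1) Gen_b *\<^sub>v v) $ 0 = - (v $ 0)"
      using v by (simp add: act_V1 scalar_prod_def)
    ultimately have "- (v $ i) = v $ i" using bv by simp
    then have "2 * v $ i = 0" by (simp add: algebra_simps neg_eq_iff_add_eq_0)
    then show "v $ i = 0\<^sub>v 1 $ i" using two_nonzero \<open>i < _\<close> by simp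
  qed (use v in simp)
  then show "v \<in> rad (V1 1)"
    using is_subspaceD(2) [OF natural_subspaceD(1) [OF natural_rad D4_module_V1 [of 1, where 'k = 'k]]] by simp
qed

lemma a_image_V2: "a_image (V2 0 :: 'k rep) \<noteq> {0\<^sub>v 2}"
proof -
  have "unit_vec 2 0 \<in> weight_space (V2 0 :: 'k rep) 1 (- 1)"
    by (auto simp: in_weight_space_iff) 
      (auto simp: V2_eq_int_rep int_mat_def scalar_prod_def atLeast0LessThan sum_lessThan_2 less_2_cases_iff intro!: eq_vecI)
  moreover have "act (V2 0) Gen_a *\<^sub>v unit_vec 2 0 = (unit_vec 2 1 :: 'k vec)"
    by (auto simp: V2_eq_int_rep int_mat_def scalar_prod_def atLeast0LessThan sum_lessThan_2 less_2_cases_iff intro!: eq_vecI)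
  ultimately have "unit_vec 2 1 \<in> a_image (V2 0 :: 'k rep)" unfolding a_image_def by (metis imageI)
  then show ?thesis using unit_vec_nonzero [of 1 2] by auto
qed

lemma a_image_V1_V2: "a_image (tensor_rep (V1 1) (V2 0) :: 'k rep) = {0\<^sub>v 2}"
proof -
  let ?T = "tensor_rep (V1 1) (V2 0) :: 'k rep"
  have T: "D4_module ?T" by simp
  note act_T = tensor_V1_left [OF D4_module_V2_0, of 1, where 'a = 'k]
  have "act ?T Gen_a *\<^sub>v v = 0\<^sub>v 2" if "v \<in> weight_space ?T 1 (- 1)" for v
  proof -
    have v: "v \<in> carrier_vec 2" "act ?T Gen_b *\<^sub>v v = 1 \<cdot>\<^sub>v v" using that in_weight_space_iff [OF T] by auto
    have "(act ?T Gen_b *\<^sub>v v) $ 0 = - v $ 0"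
      unfolding act_T using v(1)
      by (simp add: V2_eq_int_rep int_mat_def scalar_prod_def atLeast0LessThan sum_lessThan_2)
    then have "v $ 0 = - v $ 0" using v by simp
    then have "2 * v $ 0 = 0" by (simp add: eq_neg_iff_add_eq_0)
    then have "v $ 0 = 0" using two_nonzero by simp
    then show ?thesis
      unfolding act_T using v(1)
      by (auto simp: V2_eq_int_rep int_mat_def scalar_prod_def atLeast0LessThan sum_lessThan_2 less_2_cases_iff intro!: eq_vecI)
  qed
  moreover have "0\<^sub>v 2 \<in> a_image ?T" using is_subspaceD(2) [OF natural_subspaceD(1) [OF natural_a_image T]] by simp
  ultimately show ?thesis by (auto simp: a_image_def)
qed

lemma V2_V2_eq_int_rep:
  "tensor_rep (V2 0) (V2 0) = (int_rep 4 (int_tensor 2 2 int_V2 int_V2) :: 'k rep)"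
  by (simp add: V2_eq_int_rep int_rep_tensor)

lemma int_V2_V2:
  "int_tensor 2 2 int_V2 int_V2 Gen_b = [[1, 0, 0, 0], [0, - 1, 0, 0], [0, 0, - 1, 0], [0, 0, 0, 1]]"
  "int_tensor 2 2 int_V2 int_V2 Gen_c = [[1, 0, 0, 0], [0, - 1, 0, 0], [0, 0, - 1, 0], [0, 0, 0, 1]]"
  "int_mult 4 (int_tensor 2 2 int_V2 int_V2 Gen_a) (int_tensor 2 2 int_V2 int_V2 Gen_d)
    = [[0, 0, 0, 0], [0, 2, - 2, 0], [0, 2, - 2, 0], [0, 0, 0, 0]]"
  by code_simp+

lemma ad_V2_V2:
  assumes "v \<in> carrier_vec 4"
  shows "act (tensor_rep (V2 0) (V2 0)) Gen_a *\<^sub>v (act (tensor_rep (V2 0) (V2 0)) Gen_d *\<^sub>v v)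
    = (vec 4 (\<lambda>i. if i = 1 \<or> i = 2 then 2 * (v $ 1 - v $ 2) else 0) :: 'k vec)"
  unfolding V2_V2_eq_int_rep act_int_rep assoc_mult_mat_vec [OF int_mat_carrier int_mat_carrier assms, symmetric]
    int_mat_mult [symmetric] int_V2_V2 using assms
  by (intro eq_vecI) (auto simp: int_mat_def scalar_prod_def atLeast0LessThan sum_lessThan_4 less_4_cases algebra_simps)

lemma bc_V2_V2:
  assumes "v \<in> carrier_vec 4" "s \<in> {Gen_b, Gen_c}"
  shows "act (tensor_rep (V2 0) (V2 0)) s *\<^sub>v v
    = (vec 4 (\<lambda>i. if i = 1 \<or> i = 2 then - v $ i else v $ i) :: 'k vec)"
proof -
  have s: "int_tensor 2 2 int_V2 int_V2 s = [[1, 0, 0, 0], [0, - 1, 0, 0], [0, 0, - 1, 0], [0, 0, 0, 1]]"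
    using assms(2) int_V2_V2(1,2) by blast
  show ?thesis
    unfolding V2_V2_eq_int_rep act_int_rep s using assms(1)
    by (intro eq_vecI) (auto simp: int_mat_def scalar_prod_def atLeast0LessThan sum_lessThan_4 less_4_cases)
qed

text \<open>\<open>a d\<close> sees only the two coordinates of weight (-1, -1), and these vanish in
  a vector of weight (1, 1). In module terms, the product is P(V(1)).\<close>

lemma ad_image_V2_V2: "ad_image (tensor_rep (V2 0) (V2 0) :: 'k rep) = {0\<^sub>v 4}"
proof -
  let ?T = "tensor_rep (V2 0) (V2 0) :: 'k rep"
  have T: "D4_module ?T" by simp
  have "act ?T Gen_a *\<^sub>v (act ?T Gen_d *\<^sub>v v) = 0\<^sub>v 4" if "v \<in> weight_space ?T 1 1" for v
  proof -
    have v: "v \<in> carrier_vec 4" "act ?T Gen_b *\<^sub>v v = v" using that in_weight_space_iff [OF T] by auto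
    have "v $ i = - v $ i" if "i = 1 \<or> i = 2" for i
    proof -
      have "(act ?T Gen_b *\<^sub>v v) $ i = - v $ i" using bc_V2_V2 [OF v(1), of Gen_b] that by auto
      then show ?thesis using v(2) by simp
    qed
    then have "2 * v $ 1 = 0" "2 * v $ 2 = 0" by (simp_all add: eq_neg_iff_add_eq_0)
    then have "v $ 1 = 0" "v $ 2 = 0" using two_nonzero by auto
    then show ?thesis unfolding ad_V2_V2 [OF v(1)] by (intro eq_vecI) auto
  qed
  moreover have "0\<^sub>v 4 \<in> ad_image ?T" using is_subspaceD(2) [OF natural_subspaceD(1) [OF natural_ad_image T]] by simp
  ultimately show ?thesis by (auto simp: ad_image_def)
qed

text \<open>Twisting by V(1) negates \<open>b\<close> and \<open>c\<close> and so moves the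
  coordinates on which \<open>a d\<close> is nonzero to weight (1, 1).\<close>

lemma ad_image_V1_V2_V2: "ad_image (tensor_rep (V1 1) (tensor_rep (V2 0) (V2 0)) :: 'k rep) \<noteq> {0\<^sub>v 4}"
proof -
  let ?S = "tensor_rep (V2 0) (V2 0) :: 'k rep" and ?T = "tensor_rep (V1 1) (tensor_rep (V2 0) (V2 0)) :: 'k rep"
  have S: "D4_module ?S" and T: "D4_module ?T" by simp_all
  note act_T = tensor_V1_left [OF S, of 1]
  let ?u = "unit_vec 4 1 :: 'k vec"
  have neg: "((- 1) ^ 1 \<cdot>\<^sub>m act ?S s) *\<^sub>v ?u = - (act ?S s *\<^sub>v ?u)" for s
    using act_carrier [OF S, of s] by (intro eq_vecI) auto
  have "act ?S s *\<^sub>v ?u = - ?u" if "s \<in> {Gen_b, Gen_c}" for s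
    unfolding bc_V2_V2 [OF unit_vec_carrier that] by (intro eq_vecI) auto
  then have "?u \<in> weight_space ?T 1 1"
    unfolding in_weight_space_iff [OF T] act_T neg by simp
  then have "vec 4 (\<lambda>i. if i = 1 \<or> i = 2 then 2 * (?u $ 1 - ?u $ 2) else 0) \<in> ad_image ?T"
    unfolding ad_image_def act_T ad_V2_V2 [OF unit_vec_carrier, symmetric] by blast
  moreover have "vec 4 (\<lambda>i. if i = 1 \<or> i = 2 then 2 * (?u $ 1 - ?u $ 2) else 0) \<noteq> 0\<^sub>v 4"
  proof
    assume "vec 4 (\<lambda>i. if i = 1 \<or> i = 2 then 2 * (?u $ 1 - ?u $ 2) else 0) = 0\<^sub>v 4"
    from arg_cong [OF this, of "\<lambda>w. vec_index w 1"] show False using two_nonzero by simp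
  qed
  ultimately show ?thesis by auto
qed

end

section \<open>The ideal of relations\<close>

lemma ideal_int_poly4:
  assumes "ideal J int_poly4_ring"
  shows "0 \<in> J" "p \<in> J \<Longrightarrow> q \<in> J \<Longrightarrow> p + q \<in> J" "p \<in> J \<Longrightarrow> q \<in> J \<Longrightarrow> p - q \<in> J" "p \<in> J \<Longrightarrow> r * p \<in> J"
proof -
  interpret ideal J int_poly4_ring by fact
  show "0 \<in> J" using additive_subgroup.zero_closed [OF is_additive_subgroup] by simp
  show add: "p + q \<in> J" if "p \<in> J" "q \<in> J" for p q using additive_subgroup.a_closed [OF is_additive_subgroup that] by simp
  show mult: "r * p \<in> J" if "p \<in> J" for r p using I_l_closed [OF that, of r] by simp
  show "p - q \<in> J" if "p \<in> J" "q \<in> J" using add [OF that(1) mult [OF that(2), of "- 1"]] by simp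
qed

definition relations :: "int_poly4 set" where
  "relations = {g1 ^ 2 - 1, x1 ^ 3 - 2 * x1 * (1 + g1), x1 * (y1 - 1 - 2 * g1),
     x1 * (y1 - z1), y1 * z1 - 1 - 2 * x1 ^ 2}"

definition rel_ideal :: "int_poly4 set" where
  "rel_ideal = Idl\<^bsub>int_poly4_ring\<^esub> relations"

lemma ideal_rel_ideal: "ideal rel_ideal int_poly4_ring"
  unfolding rel_ideal_def by (rule ring.genideal_ideal [OF ring_int_poly4_ring]) simp

lemmas rel_ideal = ideal_int_poly4 [OF ideal_rel_ideal]

lemma rel_ideal_relations: "r \<in> relations \<Longrightarrow> r \<in> rel_ideal"
  using ring.genideal_self [OF ring_int_poly4_ring, of relations] by (auto simp: rel_ideal_def)

lemma rel_ideal_gens: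
  "g1 * g1 - 1 \<in> rel_ideal" "x1 * x1 * x1 - 2 * x1 * (1 + g1) \<in> rel_ideal" "x1 * (y1 - 1 - 2 * g1) \<in> rel_ideal"
  "x1 * (y1 - z1) \<in> rel_ideal" "y1 * z1 - 1 - 2 * (x1 * x1) \<in> rel_ideal"
  by (rule rel_ideal_relations; simp add: relations_def power2_eq_square power3_eq_cube)+

definition x_form :: "int \<Rightarrow> int \<Rightarrow> int \<Rightarrow> int \<Rightarrow> int_poly4" where
  "x_form e0 e1 e2 e3 = of_int e0 * x1 + of_int e1 * (g1 * x1) + of_int e2 * (x1 * x1) + of_int e3 * (g1 * (x1 * x1))"

definition x_reducible :: "int_poly4 \<Rightarrow> bool" where
  "x_reducible p \<longleftrightarrow> (\<exists>e0 e1 e2 e3. p - x_form e0 e1 e2 e3 \<in> rel_ideal)"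

lemma x_reducible_x_form [simp]: "x_reducible (x_form e0 e1 e2 e3)"
  unfolding x_reducible_def using rel_ideal(1) by (metis diff_self)

lemma x_reducible_cong: "p - q \<in> rel_ideal \<Longrightarrow> x_reducible q \<Longrightarrow> x_reducible p"
  using rel_ideal(2) [of "p - q"] unfolding x_reducible_def by (fastforce simp: algebra_simps)

lemma x_reducible_diff:
  assumes "x_reducible p" "x_reducible q"
  shows "x_reducible (p - q)"
proof -
  obtain e0 e1 e2 e3 f0 f1 f2 f3 where pq: "p - x_form e0 e1 e2 e3 \<in> rel_ideal" "q - x_form f0 f1 f2 f3 \<in> rel_ideal"
    using assms by (auto simp: x_reducible_def)
  have eq: "(p - q) - x_form (e0 - f0) (e1 - f1) (e2 - f2) (e3 - f3) = (p - x_form e0 e1 e2 e3) - (q - x_form f0 f1 f2 f3)"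
    by (simp add: x_form_def algebra_simps)
  have "(p - q) - x_form (e0 - f0) (e1 - f1) (e2 - f2) (e3 - f3) \<in> rel_ideal"
    unfolding eq by (rule rel_ideal(3) [OF pq])
  then show ?thesis by (auto simp: x_reducible_def)
qed

text \<open>By \<open>g^2 = 1\<close> the coefficients are exchanged in pairs.
  \<open>poly_kernel_eq_rel_ideal\<close> uses this to test four coefficients with two
  functionals.\<close>

lemma g_x_form: "g1 * x_form e0 e1 e2 e3 - x_form e1 e0 e3 e2 \<in> rel_ideal"
proof -
  have "g1 * x_form e0 e1 e2 e3 - x_form e1 e0 e3 e2 = (of_int e1 * x1 + of_int e3 * (x1 * x1)) * (g1 * g1 - 1)"
    by (simp add: x_form_def algebra_simps)
  then show ?thesis using rel_ideal(4) [OF rel_ideal_gens(1)] by simp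
qed

lemma x_reducible_g: "x_reducible p \<Longrightarrow> x_reducible (g1 * p)"
proof -
  assume "x_reducible p"
  then obtain e0 e1 e2 e3 where p: "p - x_form e0 e1 e2 e3 \<in> rel_ideal" by (auto simp: x_reducible_def)
  have "g1 * p - g1 * x_form e0 e1 e2 e3 \<in> rel_ideal" using rel_ideal(4) [OF p, of g1] by (simp add: algebra_simps)
  then show ?thesis using x_reducible_cong x_reducible_x_form g_x_form by blast
qed

text \<open>Each variable preserves the span of the four monomials modulo the relations:
  \<open>g\<close> permutes them, \<open>x^3\<close> becomes \<open>2 x (1 + g)\<close>, and on
  multiples of \<open>x\<close> both \<open>y\<close> and \<open>z\<close> act as
  \<open>1 + 2 g\<close>.\<close>

lemma x_reducible_mult_x: "x_reducible (x1 * q)"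
proof (induction q rule: int_poly4_induct)
  case zero
  then show ?case using x_reducible_x_form [of 0 0 0 0] by (simp add: x_form_def)
next
  case one
  then show ?case using x_reducible_x_form [of 1 0 0 0] by (simp add: x_form_def)
next
  case (diff p q)
  then show ?case using x_reducible_diff by (simp add: right_diff_distrib)
next
  case (mult i q)
  then obtain e0 e1 e2 e3 where q: "x1 * q - x_form e0 e1 e2 e3 \<in> rel_ideal" by (auto simp: x_reducible_def)
  let ?w = "of_int e0 + of_int e1 * g1 + of_int e2 * x1 + of_int e3 * (g1 * x1)"
  have w: "x_form e0 e1 e2 e3 = x1 * ?w" by (simp add: x_form_def algebra_simps)
  have red: "x_reducible (pvar i * (x1 * q))" if "x_reducible (pvar i * x_form e0 e1 e2 e3)"
    using rel_ideal(4) [OF q, of "pvar i"] that by (intro x_reducible_cong [OF _ that]) (simp add: algebra_simps)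
  have y: "x_reducible (y1 * x_form e0 e1 e2 e3)"
  proof (rule x_reducible_cong)
    \<comment> \<open>The nested differences spell out \<open>(1 + 2 g)\<close> times
      \<open>x_form\<close>, in the shape that \<open>x_reducible_diff\<close> accepts.\<close>
    have "y1 * x_form e0 e1 e2 e3 - (x_form e0 e1 e2 e3 - (0 - g1 * x_form e0 e1 e2 e3 - g1 * x_form e0 e1 e2 e3))
       = ?w * (x1 * (y1 - 1 - 2 * g1))" unfolding w by (simp add: algebra_simps)
    then show "y1 * x_form e0 e1 e2 e3 - (x_form e0 e1 e2 e3 - (0 - g1 * x_form e0 e1 e2 e3 - g1 * x_form e0 e1 e2 e3)) \<in> rel_ideal"
      using rel_ideal(4) [OF rel_ideal_gens(3)] by simp
    have "x_reducible 0" using x_reducible_x_form [of 0 0 0 0] by (simp add: x_form_def)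
    then show "x_reducible (x_form e0 e1 e2 e3 - (0 - g1 * x_form e0 e1 e2 e3 - g1 * x_form e0 e1 e2 e3))"
      by (intro x_reducible_diff x_reducible_g) auto
  qed
  have "x_reducible (pvar i * (x1 * q))"
  proof (rule red, cases i)
    case Var_g
    then show "x_reducible (pvar i * x_form e0 e1 e2 e3)" by (simp add: x_reducible_g)
  next
    case Var_x
    \<comment> \<open>The cubic part is \<open>(e2 + e3 g) x^3 = 2 (e2 + e3 g) (1 + g) x\<close>; as
      \<open>g (1 + g) = 1 + g\<close>, both linear coefficients become
      \<open>2 (e2 + e3)\<close>.\<close>
    have "x1 * x_form e0 e1 e2 e3 - x_form (2 * (e2 + e3)) (2 * (e2 + e3)) e0 e1
      = (of_int e2 + of_int e3 * g1) * (x1 * x1 * x1 - 2 * x1 * (1 + g1)) + (2 * of_int e3 * x1) * (g1 * g1 - 1)"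
      by (simp add: x_form_def algebra_simps)
    then have "x1 * x_form e0 e1 e2 e3 - x_form (2 * (e2 + e3)) (2 * (e2 + e3)) e0 e1 \<in> rel_ideal"
      using rel_ideal(2) [OF rel_ideal(4) [OF rel_ideal_gens(2)] rel_ideal(4) [OF rel_ideal_gens(1)]] by simp
    then show "x_reducible (pvar i * x_form e0 e1 e2 e3)" using Var_x x_reducible_cong by simp
  next
    case Var_y
    then show "x_reducible (pvar i * x_form e0 e1 e2 e3)" using y by simp
  next
    case Var_z
    have "z1 * x_form e0 e1 e2 e3 - y1 * x_form e0 e1 e2 e3 = (- ?w) * (x1 * (y1 - z1))"
      unfolding w by (simp add: algebra_simps)
    then have "z1 * x_form e0 e1 e2 e3 - y1 * x_form e0 e1 e2 e3 \<in> rel_ideal"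
      using rel_ideal(4) [OF rel_ideal_gens(4)] by simp
    then show "x_reducible (pvar i * x_form e0 e1 e2 e3)" using Var_z x_reducible_cong y by simp
  qed
  then show ?case by (simp add: mult.left_commute)
qed

text \<open>The ideal generated by the relations and \<open>x\<close>. In its quotient
  \<open>z\<close> is the inverse of \<open>y\<close>, and \<open>g\<close> is an
  involution.\<close>

definition x_ideal :: "int_poly4 set" where
  "x_ideal = {p. \<exists>q. p - x1 * q \<in> rel_ideal}"

lemma x_ideal_rel: "p \<in> rel_ideal \<Longrightarrow> p \<in> x_ideal"
  unfolding x_ideal_def by (intro CollectI exI [of _ 0]) simp

lemma x_ideal_x: "x1 * q \<in> x_ideal"
  unfolding x_ideal_def using rel_ideal(1) by (intro CollectI exI [of _ q]) simp

lemma x_ideal_mult: "p \<in> x_ideal \<Longrightarrow> r * p \<in> x_ideal"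
proof -
  assume "p \<in> x_ideal"
  then obtain q where "p - x1 * q \<in> rel_ideal" by (auto simp: x_ideal_def)
  then have "r * p - x1 * (r * q) \<in> rel_ideal" using rel_ideal(4) [of "p - x1 * q" r] by (simp add: algebra_simps)
  then show ?thesis by (auto simp: x_ideal_def)
qed

lemma x_ideal_diff: "p \<in> x_ideal \<Longrightarrow> p' \<in> x_ideal \<Longrightarrow> p - p' \<in> x_ideal"
proof -
  assume "p \<in> x_ideal" "p' \<in> x_ideal"
  then obtain q q' where "p - x1 * q \<in> rel_ideal" "p' - x1 * q' \<in> rel_ideal" by (auto simp: x_ideal_def)
  then have "(p - p') - x1 * (q - q') \<in> rel_ideal"
    using rel_ideal(3) [of "p - x1 * q" "p' - x1 * q'"] by (simp add: algebra_simps)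
  then show ?thesis by (auto simp: x_ideal_def)
qed

lemma x_ideal_0: "0 \<in> x_ideal"
  by (rule x_ideal_rel [OF rel_ideal(1)])

lemma x_ideal_add: "p \<in> x_ideal \<Longrightarrow> p' \<in> x_ideal \<Longrightarrow> p + p' \<in> x_ideal"
  using x_ideal_diff [of p "0 - p'"] x_ideal_diff [OF x_ideal_0, of p'] by simp

lemma x_ideal_gens: "g1 * g1 - 1 \<in> x_ideal" "y1 * z1 - 1 \<in> x_ideal"
proof -
  show "g1 * g1 - 1 \<in> x_ideal" by (rule x_ideal_rel [OF rel_ideal_gens(1)])
  show "y1 * z1 - 1 \<in> x_ideal"
    using x_ideal_add [OF x_ideal_rel [OF rel_ideal_gens(5)] x_ideal_x [of "2 * x1"]] by (simp add: algebra_simps)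
qed

text \<open>Polynomials in \<open>y\<close> with coefficients \<open>c + d g\<close>, nested so that
  an induction peels off the constant term. Leading zeros are allowed, so a polynomial has several
  derivations.\<close>

inductive_set horner :: "int_poly4 set" where
  zero: "0 \<in> horner"
| step: "h \<in> horner \<Longrightarrow> of_int c + of_int d * g1 + y1 * h \<in> horner"

lemma horner_y: "h \<in> horner \<Longrightarrow> y1 ^ n * h \<in> horner"
proof (induction n)
  case (Suc n)
  then show ?case using horner.step [of "y1 ^ n * h" 0 0] by (simp add: mult.assoc)
qed simp

lemma horner_diff:
  assumes "h \<in> horner" "k \<in> horner"
  shows "h - k \<in> horner"
  using assms
proof (induction arbitrary: k)
  case zero
  have "- k \<in> horner"
    using zero
  proof induction
    case (step h c d)
    then show ?case using horner.step [OF step.IH, of "- c" "- d"] by (simp add: algebra_simps)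
  qed (simp add: horner.zero)
  then show ?case by simp
next
  case (step h c d)
  from step.prems show ?case
  proof cases
    case zero
    then show ?thesis using horner.step [OF step.hyps] by simp
  next
    case (step h' c' d')
    then show ?thesis using horner.step [OF \<open>\<And>k. k \<in> horner \<Longrightarrow> h - k \<in> horner\<close> [OF step(2)], of "c - c'" "d - d'"]
      by (simp add: algebra_simps)
  qed
qed

lemma horner_g: "h \<in> horner \<Longrightarrow> \<exists>k \<in> horner. g1 * h - k \<in> x_ideal"
proof (induction rule: horner.induct)
  case zero
  then show ?case using x_ideal_0 by (intro bexI [of _ 0]) (simp_all add: horner.zero)
next
  case (step h c d)
  then obtain k where k: "k \<in> horner" "g1 * h - k \<in> x_ideal" by blast
  have "g1 * (of_int c + of_int d * g1 + y1 * h) - (of_int d + of_int c * g1 + y1 * k)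
      = of_int d * (g1 * g1 - 1) + y1 * (g1 * h - k)"
    by (simp add: algebra_simps)
  also have "\<dots> \<in> x_ideal" by (intro x_ideal_add x_ideal_mult x_ideal_gens k)
  finally show ?case using horner.step [OF k(1)] by blast
qed

text \<open>A power of \<open>y\<close> clears the occurrences of \<open>z\<close>. Its exponent
  grows by one with each factor \<open>z\<close>, and for a difference the two exponents are
  added.\<close>

lemma horner_reduction: "\<exists>N. \<exists>h \<in> horner. y1 ^ N * p - h \<in> x_ideal"
proof (induction p rule: int_poly4_induct)
  case zero
  then show ?case using x_ideal_0 horner.zero by (intro exI [of _ 0] bexI [of _ 0]) auto
next
  case one
  then show ?case using x_ideal_0 horner.step [OF horner.zero, of 1 0] by (intro exI [of _ 0] bexI [of _ 1]) auto
next
  case (diff p q)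
  then obtain N M h k where hk: "h \<in> horner" "y1 ^ N * p - h \<in> x_ideal" "k \<in> horner" "y1 ^ M * q - k \<in> x_ideal" by blast
  have "y1 ^ (N + M) * (p - q) - (y1 ^ M * h - y1 ^ N * k) = y1 ^ M * (y1 ^ N * p - h) - y1 ^ N * (y1 ^ M * q - k)"
    by (simp add: algebra_simps power_add)
  also have "\<dots> \<in> x_ideal" by (intro x_ideal_diff x_ideal_mult hk)
  finally show ?case using horner_diff [OF horner_y [OF hk(1)] horner_y [OF hk(3)]] by blast
next
  case (mult i p)
  then obtain N h where h: "h \<in> horner" "y1 ^ N * p - h \<in> x_ideal" by blast
  show ?case
  proof (cases i)
    case Var_g
    obtain k where k: "k \<in> horner" "g1 * h - k \<in> x_ideal" using horner_g [OF h(1)] by blast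
    have "y1 ^ N * (g1 * p) - k = g1 * (y1 ^ N * p - h) + (g1 * h - k)" by (simp add: algebra_simps)
    also have "\<dots> \<in> x_ideal" by (intro x_ideal_add x_ideal_mult h k)
    finally show ?thesis using k Var_g by blast
  next
    case Var_x
    have "y1 ^ 0 * (x1 * p) - 0 \<in> x_ideal" using x_ideal_x by simp
    then show ?thesis using horner.zero Var_x by blast
  next
    case Var_y
    have "y1 ^ N * (y1 * p) - y1 ^ 1 * h = y1 * (y1 ^ N * p - h)" by (simp add: algebra_simps)
    also have "\<dots> \<in> x_ideal" by (intro x_ideal_mult h)
    finally show ?thesis using horner_y [OF h(1)] Var_y by blast
  next
    case Var_z
    have "y1 ^ Suc N * (z1 * p) - h = (y1 ^ N * p) * (y1 * z1 - 1) + (y1 ^ N * p - h)" by (simp add: algebra_simps)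
    also have "\<dots> \<in> x_ideal" by (intro x_ideal_add x_ideal_mult x_ideal_gens h)
    finally show ?thesis using h Var_z by blast
  qed
qed

text \<open>\<open>z\<close> inverts \<open>y\<close> modulo \<open>x_ideal\<close>, so the factors
  \<open>y\<close> are removed one at a time.\<close>

lemma y_power_cancel:
  assumes "y1 ^ N * p \<in> x_ideal"
  shows "p \<in> x_ideal"
  using assms
proof (induction N)
  case (Suc N)
  have "y1 ^ N * p = z1 * (y1 ^ Suc N * p) - (y1 ^ N * p) * (y1 * z1 - 1)" by (simp add: algebra_simps)
  also have "\<dots> \<in> x_ideal" by (intro x_ideal_diff x_ideal_mult x_ideal_gens Suc.prems)
  finally show ?case by (rule Suc.IH)
qed simp

section \<open>The kernel of the evaluation map\<close>

context char_not_2
begin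

definition poly_kernel :: "int_poly4 set" where
  "poly_kernel = {p. poly_class p \<in> split_relations}"

lemma poly_kernel_diff: "p \<in> poly_kernel \<Longrightarrow> q \<in> poly_kernel \<Longrightarrow> p - q \<in> poly_kernel"
  by (simp add: poly_kernel_def poly_class_simps split_relations_diff)

lemma poly_kernel_add: "p \<in> poly_kernel \<Longrightarrow> q \<in> poly_kernel \<Longrightarrow> p + q \<in> poly_kernel"
  by (simp add: poly_kernel_def poly_class_simps split_relations_add)

lemma poly_kernel_mult: "p \<in> poly_kernel \<Longrightarrow> r * p \<in> poly_kernel"
  using split_relations_mult(2) [OF _ poly_class_keys] by (simp add: poly_kernel_def poly_class_mult)

lemma poly_kernel_0: "0 \<in> poly_kernel"
  by (simp add: poly_kernel_def poly_class_simps)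

lemma ideal_poly_kernel: "ideal poly_kernel int_poly4_ring"
proof (rule idealI [OF ring_int_poly4_ring])
  interpret ring int_poly4_ring by (rule ring_int_poly4_ring)
  show "subgroup poly_kernel (add_monoid int_poly4_ring)"
  proof (rule group.subgroupI)
    show "Group.group (add_monoid int_poly4_ring)" by (rule a_group)
    fix p assume p: "p \<in> poly_kernel"
    have "\<ominus>\<^bsub>int_poly4_ring\<^esub> p = - p" by (rule minus_equality) simp_all
    then show "inv\<^bsub>add_monoid int_poly4_ring\<^esub> p \<in> poly_kernel" using poly_kernel_diff [OF poly_kernel_0 p] by (simp add: a_inv_def)
  qed (use poly_kernel_0 poly_kernel_add in auto)
qed (use poly_kernel_mult in \<open>auto simp: mult.commute\<close>)

text \<open>With integer multiples expanded into sums, a relation evaluates to a sum of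
  \<open>split_relation\<close> terms, one for each direct sum in the matching decomposition. For
  \<open>g^2 - 1\<close> and \<open>x (y - z)\<close> the two classes coincide and the value is
  zero.\<close>

lemma relations_subset_poly_kernel: "relations \<subseteq> poly_kernel"
proof -
  let ?V = "V1 0 :: 'k rep" and ?X = "V2 0 :: 'k rep" and ?XG = "tensor_rep (V2 0) (V1 1) :: 'k rep" and ?XX = "tensor_rep (V2 0) (V2 0) :: 'k rep"
  note pc = poly_class_simps poly_class_mult tensor_gen_class
  have xg: "tensor_class (gen_class Var_x) (gen_class Var_g) = iso_class ?XG" "tensor_class (gen_class Var_x) (gen_class Var_x) = iso_class ?XX"
    "gen_class Var_x = iso_class ?X"
    by (simp_all add: gen_class_def)
  have yz: "tensor_class (gen_class Var_x) (gen_class Var_y) = iso_class (direct_sum_rep ?X (direct_sum_rep ?XG ?XG))"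
    by (rule tensor_gen_class(3)) simp
  have "poly_class (g1 * g1 - 1) = 0" by (simp add: pc)
  then have 1: "g1 ^ 2 - 1 \<in> poly_kernel" by (simp add: poly_kernel_def power2_eq_square)
  have eq: "poly_class (x1 * x1 * x1 - (x1 + x1 + (x1 * g1 + x1 * g1)))
     = split_relation (direct_sum_rep ?X ?X) (direct_sum_rep ?XG ?XG) + (split_relation ?X ?X + split_relation ?XG ?XG)"
    by (simp only: pc xg(1) yz free_class_mult_frag_of) (simp add: xg(3))
  have "x1 * x1 * x1 - (x1 + x1 + (x1 * g1 + x1 * g1)) \<in> poly_kernel"
    unfolding poly_kernel_def mem_Collect_eq eq by (intro split_relations_add split_relation_in) simp_all
  then have 2: "x1 ^ 3 - 2 * x1 * (1 + g1) \<in> poly_kernel" by (simp add: power3_eq_cube algebra_simps mult_2)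
  have eq: "poly_class (x1 * y1 - (x1 + (x1 * g1 + x1 * g1))) = split_relation ?X (direct_sum_rep ?XG ?XG) + split_relation ?XG ?XG"
    by (simp only: pc xg(1) yz free_class_mult_frag_of) (simp add: xg(3))
  have "x1 * y1 - (x1 + (x1 * g1 + x1 * g1)) \<in> poly_kernel"
    unfolding poly_kernel_def mem_Collect_eq eq by (intro split_relations_add split_relation_in) simp_all
  then have 3: "x1 * (y1 - 1 - 2 * g1) \<in> poly_kernel" by (simp add: algebra_simps mult_2)
  have "poly_class (x1 * y1 - x1 * z1) = 0" by (simp add: pc)
  then have 4: "x1 * (y1 - z1) \<in> poly_kernel" by (simp add: poly_kernel_def algebra_simps)
  have eq: "poly_class (y1 * z1 - (1 + (x1 * x1 + x1 * x1))) = split_relation ?V (direct_sum_rep ?XX ?XX) + split_relation ?XX ?XX"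
    by (simp only: pc xg(2) free_class_mult_frag_of) simp
  have "y1 * z1 - (1 + (x1 * x1 + x1 * x1)) \<in> poly_kernel"
    unfolding poly_kernel_def mem_Collect_eq eq by (intro split_relations_add split_relation_in) simp_all
  then have 5: "y1 * z1 - 1 - 2 * x1 ^ 2 \<in> poly_kernel" by (simp add: power2_eq_square algebra_simps mult_2)
  show ?thesis unfolding relations_def using 1 2 3 4 5 by simp
qed

lemma rel_ideal_subset_poly_kernel: "rel_ideal \<subseteq> poly_kernel"
  unfolding rel_ideal_def
  by (rule ring.genideal_minimal [OF ring_int_poly4_ring ideal_poly_kernel relations_subset_poly_kernel])

lemma poly_kernel_cong: "p - q \<in> rel_ideal \<Longrightarrow> p \<in> poly_kernel \<longleftrightarrow> q \<in> poly_kernel"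
  using rel_ideal_subset_poly_kernel poly_kernel_add [of "p - q" q] poly_kernel_diff [of p "p - q"] by auto

end

context char_not_2
begin

context
  fixes \<Phi> :: "('k rep set \<Rightarrow>\<^sub>0 int) \<Rightarrow> int"
  assumes additive: "additive_functional \<Phi>"
begin

lemma functional_poly:
  "\<Phi> (poly_class 0) = 0"
  "\<Phi> (poly_class (p + q)) = \<Phi> (poly_class p) + \<Phi> (poly_class q)"
  "\<Phi> (poly_class (p - q)) = \<Phi> (poly_class p) - \<Phi> (poly_class q)"
  "\<Phi> (poly_class (of_int c * p)) = c * \<Phi> (poly_class p)"
proof -
  note diff = additive_functionalD(1) [OF additive] and zero = additive_functionalD(3) [OF additive]
    and add = additive_functionalD(4) [OF additive]
  show "\<Phi> (poly_class 0) = 0" "\<Phi> (poly_class (p + q)) = \<Phi> (poly_class p) + \<Phi> (poly_class q)"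
    "\<Phi> (poly_class (p - q)) = \<Phi> (poly_class p) - \<Phi> (poly_class q)"
    by (simp_all add: poly_class_simps zero add diff)
  have nat: "\<Phi> (poly_class (of_nat n * p)) = int n * \<Phi> (poly_class p)" for n
    by (induction n) (simp_all add: poly_class_simps zero add distrib_right)
  show "\<Phi> (poly_class (of_int c * p)) = c * \<Phi> (poly_class p)"
  proof (cases c)
    case (nonneg n)
    then show ?thesis using nat [of n] by simp
  next
    case (neg n)
    have "of_int c * p = 0 - of_nat (Suc n) * p"
      unfolding neg of_int_minus of_int_of_nat_eq by (simp only: mult_minus_left diff_0)
    then show ?thesis using neg nat [of "Suc n"] by (simp only: poly_class_simps diff zero)
  qed
qed

lemma functional_poly_kernel: "p \<in> poly_kernel \<Longrightarrow> \<Phi> (poly_class p) = 0"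
  by (simp add: poly_kernel_def additive_functionalD(2) [OF additive])

lemma functional_cong: "p - q \<in> rel_ideal \<Longrightarrow> \<Phi> (poly_class p) = \<Phi> (poly_class q)"
  using functional_poly_kernel [of "p - q"] functional_poly(3) [of p q] rel_ideal_subset_poly_kernel by auto

lemma functional_x_form:
  "\<Phi> (poly_class (x_form e0 e1 e2 e3)) =
     e0 * \<Phi> (frag_of (iso_class (V2 0))) + e1 * \<Phi> (frag_of (iso_class (tensor_rep (V1 1) (V2 0))))
   + e2 * \<Phi> (frag_of (iso_class (tensor_rep (V2 0) (V2 0))))
   + e3 * \<Phi> (frag_of (iso_class (tensor_rep (V1 1) (tensor_rep (V2 0) (V2 0)))))"
proof -
  have "poly_class x1 = frag_of (iso_class (V2 0))"
    "poly_class (g1 * x1) = frag_of (iso_class (tensor_rep (V1 1) (V2 0)))"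
    "poly_class (x1 * x1) = frag_of (iso_class (tensor_rep (V2 0) (V2 0)))"
    "poly_class (g1 * (x1 * x1)) = frag_of (iso_class (tensor_rep (V1 1) (tensor_rep (V2 0) (V2 0))))"
    by (simp_all add: poly_class_simps poly_class_mult gen_class_def)
  then show ?thesis by (simp only: x_form_def functional_poly)
qed

end

text \<open>A representative of \<open>g^r y^m\<close>. Adding the new factor on the right makes
  \<open>a_absorbs_tensor_Y\<close> the induction step.\<close>

fun Y_power :: "nat \<Rightarrow> nat \<Rightarrow> 'k rep" where
  "Y_power r 0 = V1 r"
| "Y_power r (Suc m) = tensor_rep (Y_power r m) (int_rep 3 int_Y)"

lemma D4_module_Y_power [simp]: "D4_module (Y_power r m)"
  by (induction m) simp_all

lemma a_absorbs_Y_power: "a_absorbs (Y_power r m)"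
  by (induction m) (simp_all add: a_absorbs_V1 a_absorbs_tensor_Y)

lemma invs_Y_power: "invs (Y_power r (Suc m)) \<subseteq> rad (Y_power r (Suc m))"
  by (simp add: invs_tensor_Y a_absorbs_Y_power)

lemma poly_class_y_power:
  "poly_class (y1 ^ m) = frag_of (iso_class (Y_power 0 m))"
  "poly_class (g1 * y1 ^ m) = frag_of (iso_class (Y_power 1 m))"
proof -
  have mult: "poly_class (p * y1) = frag_of (iso_class (Y_power r (Suc m)))"
    if "poly_class p = frag_of (iso_class (Y_power r m))" for p r m
    using that by (simp add: poly_class_mult poly_class_simps gen_class_def)
  show "poly_class (y1 ^ m) = frag_of (iso_class (Y_power 0 m))"
  proof (induction m)
    case (Suc m)
    show ?case unfolding power_Suc2 by (rule mult [OF Suc])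
  qed (simp add: poly_class_simps)
  show "poly_class (g1 * y1 ^ m) = frag_of (iso_class (Y_power 1 m))"
  proof (induction m)
    case (Suc m)
    show ?case unfolding power_Suc2 mult.assoc [symmetric] by (rule mult [OF Suc])
  qed (simp add: poly_class_simps, simp add: gen_class_def)
qed

text \<open>The summand \<open>s\<close> is carried along because a factor \<open>y\<close> is
  removed by multiplication with \<open>z\<close>, which inverts it only modulo
  \<open>x_ideal\<close>.\<close>

lemma horner_in_poly_kernel:
  assumes "h \<in> horner" "s \<in> x_ideal" "h + s \<in> poly_kernel"
  shows "h = 0"
proof -
  obtain \<Phi> :: "('k rep set \<Rightarrow>\<^sub>0 int) \<Rightarrow> int"
    where \<Phi>: "additive_functional \<Phi>"
      and nonzero: "\<Phi> (frag_of (iso_class (V1 0))) \<noteq> 0"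
      and zero: "\<And>M. D4_module M \<Longrightarrow> invs M \<subseteq> rad M \<Longrightarrow> \<Phi> (frag_of (iso_class M)) = 0"
    using trivial_summand_functional by blast
  define \<psi> where "\<psi> p = \<Phi> (poly_class p)" for p
  note \<psi> = functional_poly [OF \<Phi>, folded \<psi>_def] and \<psi>_poly_kernel = functional_poly_kernel [OF \<Phi>, folded \<psi>_def]
    and \<psi>_cong = functional_cong [OF \<Phi>, folded \<psi>_def]
  have one: "\<psi> 1 \<noteq> 0" using nonzero by (simp add: \<psi>_def poly_class_simps)
  have g: "\<psi> g1 = 0"
    using zero [OF _ invs_subset_rad_V1_1] by (simp add: \<psi>_def poly_class_simps) (simp add: gen_class_def)
  have gg: "\<psi> (g1 * (g1 * p)) = \<psi> p" for p
  proof (rule \<psi>_cong)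
    have "g1 * (g1 * p) - p = p * (g1 * g1 - 1)" by (simp add: algebra_simps)
    then show "g1 * (g1 * p) - p \<in> rel_ideal" using rel_ideal(4) [OF rel_ideal_gens(1), of p] by simp
  qed
  \<comment> \<open>Each of the four monomials is \<open>V2 0\<close> itself or a tensor product
    with right factor \<open>V2 0\<close>, so its invariants lie in \<open>rad\<close>.\<close>
  have x_form: "\<psi> (x_form e0 e1 e2 e3) = 0" for e0 e1 e2 e3
  proof -
    have "\<Phi> (frag_of (iso_class (V2 0))) = 0"
      by (rule zero [OF _ invs_subset_rad_bc]) (simp_all add: bc_scalar_V2)
    moreover have "\<Phi> (frag_of (iso_class (tensor_rep (V1 1) (V2 0)))) = 0"
      using zero [OF _ invs_tensor_V2 [OF two_nonzero, of "V1 1"]] by simp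
    moreover have "\<Phi> (frag_of (iso_class (tensor_rep (V2 0) (V2 0)))) = 0"
      using zero [OF _ invs_tensor_V2 [OF two_nonzero, of "V2 0"]] by simp
    moreover have "\<Phi> (frag_of (iso_class (tensor_rep (V1 1) (tensor_rep (V2 0) (V2 0))))) = 0"
      using zero [OF _ invs_tensor_V2 [OF two_nonzero, of "tensor_rep (V1 1) (V2 0)"]] by (simp add: tensor_rep_assoc)
    ultimately show ?thesis using functional_x_form [OF \<Phi>, of e0 e1 e2 e3] by (simp add: \<psi>_def)
  qed
  have x_ideal: "\<psi> s = 0" if s: "s \<in> x_ideal" for s
  proof -
    obtain q where q: "s - x1 * q \<in> rel_ideal" using s by (auto simp: x_ideal_def)
    obtain e0 e1 e2 e3 where "x1 * q - x_form e0 e1 e2 e3 \<in> rel_ideal"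
      using x_reducible_mult_x [of q] by (auto simp: x_reducible_def)
    then show ?thesis using \<psi>_cong [OF q] \<psi>_cong x_form by metis
  qed
  have y: "\<psi> (y1 ^ Suc m) = 0" "\<psi> (g1 * y1 ^ Suc m) = 0" for m
    unfolding \<psi>_def poly_class_y_power by (rule zero [OF D4_module_Y_power invs_Y_power])+
  have yh: "\<psi> (y1 ^ Suc m * h) = 0 \<and> \<psi> (g1 * (y1 ^ Suc m * h)) = 0" if "h \<in> horner" for h m
    using that
  proof (induction arbitrary: m)
    case (step h c d)
    have "y1 ^ Suc m * (of_int c + of_int d * g1 + y1 * h)
        = of_int c * y1 ^ Suc m + of_int d * (g1 * y1 ^ Suc m) + y1 ^ Suc (Suc m) * h"
      by (simp add: algebra_simps)
    moreover from this have "g1 * (y1 ^ Suc m * (of_int c + of_int d * g1 + y1 * h))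
        = of_int c * (g1 * y1 ^ Suc m) + of_int d * (g1 * (g1 * y1 ^ Suc m)) + g1 * (y1 ^ Suc (Suc m) * h)"
      by (simp only: distrib_left mult.left_commute)
    ultimately show ?case by (simp only: \<psi>(2,4) y gg step.IH) simp
  qed (simp add: \<psi>(1))
  show ?thesis
    using assms
  proof (induction arbitrary: s)
    case (step h c d)
    let ?h = "of_int c * 1 + of_int d * g1 + y1 ^ Suc 0 * h"
    have h: "of_int c + of_int d * g1 + y1 * h = ?h" by simp
    \<comment> \<open>Only the constant term survives: \<open>\<psi>\<close> kills \<open>g\<close>,
      the positive powers of \<open>y\<close> with or without \<open>g\<close>, and
      \<open>x_ideal\<close>.\<close>
    have "\<psi> (?h + s) = c * \<psi> 1" using yh [OF step.hyps, of 0] by (simp only: \<psi>(2,4) g x_ideal [OF step.prems(1)])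
    then have c: "c = 0" using \<psi>_poly_kernel [OF step.prems(2)] one unfolding h by simp
    \<comment> \<open>Multiplication by \<open>g\<close> moves the coefficient \<open>d\<close> to
      the constant place.\<close>
    have "g1 * (?h + s) = of_int c * (g1 * 1) + of_int d * (g1 * (g1 * 1)) + g1 * (y1 ^ Suc 0 * h) + g1 * s"
      by (simp add: algebra_simps)
    then have "\<psi> (g1 * (?h + s)) = c * \<psi> (g1 * 1) + d * \<psi> 1"
      using yh [OF step.hyps, of 0] x_ideal [OF x_ideal_mult [OF step.prems(1), of g1]] by (simp only: \<psi>(2,4) gg)
    then have d: "d = 0" using \<psi>_poly_kernel [OF poly_kernel_mult [OF step.prems(2), of g1]] one g unfolding h by simp
    \<comment> \<open>With both coefficients zero, multiplication by \<open>z\<close> lowers the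
      degree; \<open>?s\<close> collects the defect of \<open>y z = 1\<close> and the old
      \<open>s\<close>.\<close>
    let ?s = "h * (y1 * z1 - 1) + z1 * s"
    have "?s \<in> x_ideal" by (intro x_ideal_add x_ideal_mult x_ideal_gens step.prems)
    moreover have "h + ?s = z1 * (?h + s)" using c d by (simp add: algebra_simps)
    then have "h + ?s \<in> poly_kernel" using poly_kernel_mult [OF step.prems(2), of z1] unfolding h by simp
    ultimately have "h = 0" by (rule step.IH)
    then show ?case using c d by simp
  qed simp
qed

text \<open>Among the four modules \<open>a_image\<close> is nonzero only on V(2,0) and
  \<open>ad_image\<close> only on P(V(0)), which isolates \<open>e0\<close> and \<open>e3\<close>.
  The scalar of \<open>b c\<close> settles the modules in the other block.\<close>

lemma x_form_in_poly_kernel: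
  assumes "x_form e0 e1 e2 e3 \<in> poly_kernel"
  shows "e0 = 0" "e3 = 0"
proof -
  obtain \<Phi> :: "('k rep set \<Rightarrow>\<^sub>0 int) \<Rightarrow> int"
    where \<Phi>: "additive_functional \<Phi>"
      and iff: "\<And>M. D4_module M \<Longrightarrow> \<Phi> (frag_of (iso_class M)) = 0 \<longleftrightarrow> a_image M = {0\<^sub>v (rdim M)}"
    using natural_functional [OF natural_a_image] by blast
  have bc: "bc_scalar (tensor_rep (V2 0) (V2 0) :: 'k rep) 1"
    using bc_scalar_tensor [OF _ _ bc_scalar_V2 bc_scalar_V2] by simp
  have bc': "bc_scalar (tensor_rep (V1 1) (tensor_rep (V2 0) (V2 0)) :: 'k rep) 1"
    using bc_scalar_tensor [OF _ _ bc_scalar_V1 [of 1] bc] by simp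
  have bc'': "bc_scalar (tensor_rep (V1 1) (V2 0) :: 'k rep) (- 1)"
    using bc_scalar_tensor [OF _ _ bc_scalar_V1 [of 1] bc_scalar_V2] by simp
  have "\<Phi> (frag_of (iso_class (V2 0))) \<noteq> 0" "\<Phi> (frag_of (iso_class (tensor_rep (V1 1) (V2 0)))) = 0"
    "\<Phi> (frag_of (iso_class (tensor_rep (V2 0) (V2 0)))) = 0"
    "\<Phi> (frag_of (iso_class (tensor_rep (V1 1) (tensor_rep (V2 0) (V2 0))))) = 0"
    using a_image_V2 a_image_V1_V2 a_image_eq_zero [OF _ bc] a_image_eq_zero [OF _ bc'] by (simp_all add: iff)
  then show "e0 = 0"
    using functional_poly_kernel [OF \<Phi> assms] unfolding functional_x_form [OF \<Phi>] by simp
  obtain \<Psi> :: "('k rep set \<Rightarrow>\<^sub>0 int) \<Rightarrow> int"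
    where \<Psi>: "additive_functional \<Psi>"
      and iff': "\<And>M. D4_module M \<Longrightarrow> \<Psi> (frag_of (iso_class M)) = 0 \<longleftrightarrow> ad_image M = {0\<^sub>v (rdim M)}"
    using natural_functional [OF natural_ad_image] by blast
  have "\<Psi> (frag_of (iso_class (V2 0))) = 0" "\<Psi> (frag_of (iso_class (tensor_rep (V1 1) (V2 0)))) = 0"
    "\<Psi> (frag_of (iso_class (tensor_rep (V2 0) (V2 0)))) = 0"
    "\<Psi> (frag_of (iso_class (tensor_rep (V1 1) (tensor_rep (V2 0) (V2 0))))) \<noteq> 0"
    using ad_image_eq_zero [OF _ bc_scalar_V2] ad_image_eq_zero [OF _ bc''] ad_image_V2_V2 ad_image_V1_V2_V2
    by (simp_all add: iff')
  then show "e3 = 0"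
    using functional_poly_kernel [OF \<Psi> assms] unfolding functional_x_form [OF \<Psi>] by simp
qed

lemma poly_kernel_eq_rel_ideal: "poly_kernel = rel_ideal"
proof
  show "poly_kernel \<subseteq> rel_ideal"
  proof
    fix p assume p: "p \<in> poly_kernel"
    obtain N h where h: "h \<in> horner" "y1 ^ N * p - h \<in> x_ideal" using horner_reduction [of p] by blast
    \<comment> \<open>Here \<open>s\<close> is \<open>y^N p - h\<close>, so that
      \<open>h + s\<close> is the kernel element \<open>y^N p\<close>.\<close>
    have "h = 0"
      by (rule horner_in_poly_kernel [OF h]) (use poly_kernel_mult [OF p, of "y1 ^ N"] in simp)
    then have "p \<in> x_ideal" using h(2) y_power_cancel [of N p] by simp
    then obtain q where q: "p - x1 * q \<in> rel_ideal" by (auto simp: x_ideal_def)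
    obtain e0 e1 e2 e3 where e: "x1 * q - x_form e0 e1 e2 e3 \<in> rel_ideal"
      using x_reducible_mult_x [of q] by (auto simp: x_reducible_def)
    have pe: "p - x_form e0 e1 e2 e3 \<in> rel_ideal" using rel_ideal(2) [OF q e] by simp
    then have xK: "x_form e0 e1 e2 e3 \<in> poly_kernel" using p poly_kernel_cong by blast
    \<comment> \<open>After multiplication by \<open>g\<close> the same two functionals read
      \<open>e1\<close> and \<open>e2\<close>.\<close>
    have xK': "x_form e1 e0 e3 e2 \<in> poly_kernel" using poly_kernel_mult [OF xK, of g1] poly_kernel_cong [OF g_x_form] by blast
    then have "x_form e0 e1 e2 e3 = 0" using x_form_in_poly_kernel [OF xK] x_form_in_poly_kernel [OF xK'] by (simp add: x_form_def)
    then show "p \<in> rel_ideal" using pe by simp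
  qed
qed (rule rel_ideal_subset_poly_kernel)

text \<open>The first isomorphism theorem for \<open>poly_green\<close>, with its target restricted
  to its range.\<close>

lemma green_subring_iso:
  "subring_generated green_ring (range (\<lambda>i. split_relations +>\<^bsub>free_class_ring\<^esub> frag_of (gen_class i)))
     \<simeq> int_poly4_ring Quot rel_ideal"
proof -
  let ?G = "range (\<lambda>i. split_relations +>\<^bsub>free_class_ring\<^esub> frag_of (gen_class i))"
  let ?S = "subring_generated green_ring ?G"
  interpret G: ring "green_ring :: ('k rep set \<Rightarrow>\<^sub>0 int) set ring" by (rule ring_green_ring)
  have carrier: "carrier ?S = range poly_green" by (simp add: subring_generated_def poly_green_image)
  have "?G \<subseteq> carrier green_ring"
  proof (rule image_subsetI)
    fix i show "split_relations +>\<^bsub>free_class_ring\<^esub> frag_of (gen_class i) \<in> carrier green_ring"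
      using ring_hom_closed [OF poly_green_hom, of "pvar i"] by (simp add: poly_green_def poly_class_simps)
  qed
  then have S: "ring ?S" unfolding subring_generated_def by (rule G.generate_ring_is_ring)
  have "poly_green \<in> Ring.ring_hom int_poly4_ring ?S"
    using poly_green_hom unfolding Ring.ring_hom_def carrier by (simp add: subring_generated_def)
  then interpret h: ring_hom_ring int_poly4_ring ?S poly_green
    by (rule ring_hom_ringI2 [OF ring_int_poly4_ring S])
  have "a_kernel int_poly4_ring ?S poly_green = poly_kernel"
    unfolding a_kernel_def' by (simp add: poly_kernel_def subring_generated_def poly_green_eq_zero_iff)
  then have "int_poly4_ring Quot rel_ideal \<simeq> ?S"
    using h.FactRing_iso carrier by (simp add: poly_kernel_eq_rel_ideal)
  then show ?thesis
    by (rule ring_iso_sym [OF ideal.quotient_is_ring [OF ideal_rel_ideal]])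
qed

end

theorem theorem3p7:
  assumes "CHAR('k :: alg_closed_field) \<noteq> 2"
  shows "subring_generated green_ring
           {green_class (V1 1 :: 'k rep), green_class (V2 0),
            green_class (Omega (V1 0)), green_class (Omega_inv (V1 0))}
         \<simeq> int_poly4_ring Quot (Idl\<^bsub>int_poly4_ring\<^esub>
             {g1 ^ 2 - 1, x1 ^ 3 - 2 * x1 * (1 + g1), x1 * (y1 - 1 - 2 * g1),
              x1 * (y1 - z1), y1 * z1 - 1 - 2 * x1 ^ 2})"
proof -
  have "(2 :: 'k) \<noteq> 0"
  proof
    assume "(2 :: 'k) = 0"
    \<comment> \<open>A characteristic dividing 2 is 1 or 2; the hypothesis excludes 2, and 1 is
      impossible in a field.\<close>
    then have "CHAR('k) dvd 2" using of_nat_eq_0_iff_char_dvd [of 2, where 'a = 'k] by simp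
    then have "CHAR('k) = 1" using assms two_is_prime_nat by (auto simp: prime_nat_iff)
    then show False using CHAR_not_1 [where 'a = 'k] by simp
  qed
  then interpret char_not_2 "TYPE('k)" by unfold_locales
  have UNIV: "UNIV = {Var_g, Var_x, Var_y, Var_z}" using poly_var.exhaust by blast
  have "range (\<lambda>i. split_relations +>\<^bsub>free_class_ring\<^esub> frag_of (gen_class i))
      = {green_class (V1 1 :: 'k rep), green_class (V2 0), green_class (Omega (V1 0)), green_class (Omega_inv (V1 0))}"
    unfolding UNIV green_class_def iso_class_Omega iso_class_Omega_inv by (simp add: gen_class_def)
  then show ?thesis using green_subring_iso by (simp only: rel_ideal_def relations_def)
qed

end
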